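(* Let $r\ge 1$ and $n\ge 1$ be integers, let $\lambda=(\lambda_1,\dots,\lambda_{r+1})\in\mathbb{Z}^{r+1}$ with $\lambda_1\ge\lambda_2\ge\dots\ge\lambda_{r+1}\ge 0$, let $\rho=(r,r-1,\dots,1,0)$, and let $w\in S_{r+1}$ be a beginning section of the long word $w_0^{(r)}$. Then $$\Big(\sum_{u\le w}\mathcal{T}_u\Big)\big(\mathbf{x}^{w_0(\lambda)}\big)=\mathbf{x}^{-w_0(\rho)}\cdot\sum_{\mathfrak{T}\in\mathcal{C}^{(w)}_{\lambda+\rho}}G^{(n,\lambda+\rho)}(\mathfrak{T})\,\mathbf{x}^{\mathrm{wt}(\mathfrak{T})},$$ where $\le$ is the Bruhat order on $S_{r+1}$.
   Context: Notation. Write $\mathbf{x}=(x_1,\dots,x_{r+1})$ and $\mathbf{x}^\mu=x_1^{\mu_1}\cdots x_{r+1}^{\mu_{r+1}}$ for $\mu\in\mathbb{Z}^{r+1}$. Let $\alpha_i=e_i-e_{i+1}$ ($1\le i\le r$), so $\mathbf{x}^{n\alpha_i}=(x_i/x_{i+1})^n$. The Weyl group $W=S_{r+1}$ acts on $\mathbb{Z}^{r+1}$ by permuting coordinates, $\sigma_i$ is the transposition $(i\ i+1)$, and $w.f$ denotes the induced ordinary action on $\mathbb{C}(\mathbf{x})$ ($w.\mathbf{x}^\mu=\mathbf{x}^{w\mu}$). $w_0$ is the longest element: $w_0(\mu_1,\dots,\mu_{r+1})=(\mu_{r+1},\dots,\mu_1)$. For $j\in\mathbb{Z}$, $r_n(j)\in\{0,\dots,n-1\}$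 is the residue of $j$ mod $n$. Parameters (Gauss sums). Let $F$ be a number field containing the $2n$-th roots of unity, $S$ a finite set of places containing the archimedean and ramified ones and such that the ring of $S$-integers $\mathfrak{o}_S$ is a PID, $\psi$ an additive character of conductor $\mathfrak{o}_S$, $p$ a prime of $\mathfrak{o}_S$ whose residue field has cardinality $q\equiv 1 \bmod 2n$, and $(\cdot/p)_n$ the $n$-th power residue symbol. Put $v=q^{-1}$ and $g_j=\sum_{b\in(\mathfrak{o}_S/p)^\times}(b/p)_n^{\,j}\psi(b/p)$ for $j\in\mathbb{Z}$; then $g_j$ depends only on $j\bmod n$, $g_0=-1$ and $g_jg_{n-j}=v^{-1}$ for $0<j<n$. Define $h^\flat(a)=1-v$ if $n\mid a$ and $h^\flat(a)=0$ otherwise, and $g^\flat(a)=v\,g_a$ (so $g^\flat(a)=-v$ if $n\mid a$). Metaplectic (Chinta–Gunnells) action. Let $\Lambda_0=\{\mu\in\mathbb{Z}^{r+1}:\mu_i\equiv\mu_j \bmod n\ \forall i,j\}$. A character $\xi$ of $\mathbb{Z}^{r+1}/\Lambda_0$ acts on $\mathbb{C}(\mathbf{x})$ by the field automorphism $\mathbf{x}^\mu\mapsto\xi(\mu)\mathbf{x}^\mu$; let $\mathcal{K}_{\bar\mu}=\{f:\xi(f)=\xi(\mu)f\text{ for all }\xi\}$, so $\mathbb{C}(\mathbf{x})=\bigoplus_{\bar\mu}\mathcal{K}_{\bar\mu}$. The action of $W$ on $\mathbb{C}(\mathbf{x})$ is the $\mathbb{C}$-linear action given, for $f\in\mathcal{K}_{\bar\mu}$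 and any lift $\mu$, by $\sigma_i(f)=\frac{\sigma_i.f}{1-v\mathbf{x}^{n\alpha_i}}\big[\mathbf{x}^{-r_n(\mu_{i+1}-\mu_i)\alpha_i}(1-v)-v\,g_{1+\mu_{i+1}-\mu_i}\,\mathbf{x}^{(1-n)\alpha_i}(1-\mathbf{x}^{n\alpha_i})\big].$ Demazure and Demazure–Lusztig operators: $\mathcal{D}_i(f)=\frac{f-\mathbf{x}^{n\alpha_i}\sigma_i(f)}{1-\mathbf{x}^{n\alpha_i}}$, $\mathcal{T}_i(f)=(1-v\mathbf{x}^{n\alpha_i})\mathcal{D}_i(f)-f$. For $u\in W$ with reduced expression $u=\sigma_{i_1}\cdots\sigma_{i_l}$, $\mathcal{T}_u=\mathcal{T}_{i_1}\circ\cdots\circ\mathcal{T}_{i_l}$ (independent of the reduced expression). Gelfand–Tsetlin patterns. A pattern of rank $s$ with top row a non-increasing $\kappa\in\mathbb{Z}^{s+1}$ is an integer array $(a_{ij})_{0\le i\le j\le s}$ with $(a_{00},\dots,a_{0s})=\kappa$ and $a_{i-1,j-1}\ge a_{ij}\ge a_{i-1,j}$ for $1\le i\le j\le s$. Its $\Gamma$-array is $\Gamma_{ij}=\sum_{k=j}^{s}(a_{ik}-a_{i-1,k})$, $1\le i\le j\le s$. With $d_i=\sum_{j=i}^s a_{ij}$, its weight is $\mathrm{wt}(\mathfrak{T})=(d_s,d_{s-1}-d_s,\dots,d_0-d_1)$. Its coefficient is $G^{(n,\kappa)}(\mathfrak{T})=\prod_{1\le i\le j\le s}g_{ij}$, where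 $g_{ij}=1$ if $a_{ij}=a_{i-1,j}<a_{i-1,j-1}$; $g_{ij}=h^\flat(\Gamma_{ij})$ if $a_{i-1,j}<a_{ij}<a_{i-1,j-1}$; $g_{ij}=g^\flat(\Gamma_{ij})$ if $a_{i-1,j}<a_{ij}=a_{i-1,j-1}$; $g_{ij}=0$ if $a_{i-1,j}=a_{ij}=a_{i-1,j-1}$. Long word and Demazure crystal. $w_0^{(r)}=\sigma_1(\sigma_2\sigma_1)(\sigma_3\sigma_2\sigma_1)\cdots(\sigma_r\sigma_{r-1}\cdots\sigma_1)$ (a reduced word of length $N=\binom{r+1}{2}$); $w$ is a beginning section if it equals the product of the first $\ell(w)$ letters of this word. For a rank-$r$ pattern put $b_{\binom{r-i+1}{2}+j-i+1}=\Gamma_{ij}$ ($1\le i\le j\le r$), numbering the $\Gamma$-entries $b_1,\dots,b_N$. The vertices of the type $A_r$ highest weight crystal $\mathcal{C}_{\lambda+\rho}$ are identified with patterns of rank $r$ and top row $\lambda+\rho$ (the Berenstein–Zelevinsky–Littelmann array along $w_0^{(r)}$ being $(b_m)$, and the crystal weight being $\mathrm{wt}$), and the Demazure crystal $\mathcal{C}^{(w)}_{\lambda+\rho}$ is the set of such patterns with $b_m=0$ for all $m>\ell(w)$. *)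

theory Defs
  imports
    Complex_Main
    "HOL-Library.Poly_Mapping"
    "HOL-Computational_Algebra.Polynomial"
    "HOL-Computational_Algebra.Fraction_Field"
    "HOL-Combinatorics.Permutations"
    "HOL-Combinatorics.Transposition"
    "HOL-Algebra.QuotRing"
    "HOL-Algebra.Ideal_Product"
    "HOL-Algebra.Ring_Divisibility"
    "HOL-Algebra.Embedded_Algebras"
begin

section \<open>Gauss sums over a number field\<close>

text \<open>
  A number field is given together with a complex embedding, that is, as a subfield of the complex
  numbers of finite degree over the rationals.  The power residue symbol then takes its values in
  the complex \<open>n\<close>-th roots of unity.  Subrings of the complex numbers are turned into the records
  of \<^theory>\<open>HOL-Algebra.Ring\<close> by the following constant.
\<close>

definition csub :: "complex set \<Rightarrow> complex ring" where
  "csub A = \<lparr>carrier = A, mult = (*), one = 1, zero = 0, add = (+)\<rparr>"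

definition number_field :: "complex set \<Rightarrow> bool" where
  "number_field F \<longleftrightarrow> subfield F (csub UNIV) \<and> ring.finite_dimension (csub UNIV) \<rat> F"

definition ring_of_integers :: "complex set \<Rightarrow> complex set" where
  "ring_of_integers F = {x \<in> F. algebraic_int x}"

text \<open>Nonarchimedean places are represented by the nonzero prime ideals of the ring of integers.\<close>

definition finite_places :: "complex set \<Rightarrow> complex set set" where
  "finite_places F = {P. primeideal P (csub (ring_of_integers F)) \<and> P \<noteq> {0}}"

text \<open>\<open>P\<close> is ramified over the rationals iff \<open>P\<^sup>2\<close> divides (contains) a rational prime number.\<close>

definition ramified_places :: "complex set \<Rightarrow> complex set set" where
  "ramified_places F = {P \<in> finite_places F.
     \<exists>l::nat. prime_elem l \<and> of_nat l \<in> ideal_prod (csub (ring_of_integers F)) P P}"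

text \<open>
  \<open>S\<close> is the set of the nonarchimedean members of the set of places in question; the archimedean
  places always belong to the latter and impose no condition on \<open>S\<close>-integers.  The condition at
  \<open>P\<close> says that \<open>x\<close> lies in the localisation at \<open>P\<close>, i.e. has nonnegative \<open>P\<close>-adic valuation.
\<close>

definition S_integers :: "complex set \<Rightarrow> complex set set \<Rightarrow> complex set" where
  "S_integers F S = {x \<in> F. \<forall>P \<in> finite_places F - S.
     \<exists>a \<in> ring_of_integers F. \<exists>b \<in> ring_of_integers F - P. x = a / b}"

definition prime_ideal_of :: "complex set \<Rightarrow> complex set set \<Rightarrow> complex \<Rightarrow> complex set" where
  "prime_ideal_of F S p = cgenideal (csub (S_integers F S)) p"

definition residue_ring :: "complex set \<Rightarrow> complex set set \<Rightarrow> complex \<Rightarrow> complex set ring" where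
  "residue_ring F S p = FactRing (csub (S_integers F S)) (prime_ideal_of F S p)"

definition residue_card :: "complex set \<Rightarrow> complex set set \<Rightarrow> complex \<Rightarrow> nat" where
  "residue_card F S p = card (carrier (residue_ring F S p))"

definition additive_character :: "complex set \<Rightarrow> (complex \<Rightarrow> complex) \<Rightarrow> bool" where
  "additive_character F \<psi> \<longleftrightarrow>
     (\<forall>x\<in>F. \<forall>y\<in>F. \<psi> (x + y) = \<psi> x * \<psi> y) \<and> (\<forall>x\<in>F. norm (\<psi> x) = 1)"

definition has_conductor ::
    "complex set \<Rightarrow> (complex \<Rightarrow> complex) \<Rightarrow> complex set \<Rightarrow> bool" where
  "has_conductor F \<psi> A \<longleftrightarrow> {x \<in> F. \<forall>y\<in>A. \<psi> (x * y) = 1} = A"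

definition gauss_datum ::
    "nat \<Rightarrow> complex set \<Rightarrow> complex set set \<Rightarrow> (complex \<Rightarrow> complex) \<Rightarrow> complex \<Rightarrow> bool" where
  "gauss_datum n F S \<psi> p \<longleftrightarrow>
     number_field F \<and> {z. z ^ (2 * n) = 1} \<subseteq> F \<and>
     finite S \<and> S \<subseteq> finite_places F \<and> ramified_places F \<subseteq> S \<and>
     principal_domain (csub (S_integers F S)) \<and>
     additive_character F \<psi> \<and> has_conductor F \<psi> (S_integers F S) \<and>
     p \<in> S_integers F S \<and> ring_prime\<^bsub>csub (S_integers F S)\<^esub> p \<and>
     finite (carrier (residue_ring F S p)) \<and>
     residue_card F S p mod (2 * n) = 1 mod (2 * n)"

text \<open>
  For \<open>b\<close> prime to \<open>p\<close>, the symbol is the \<open>n\<close>-th root of unity congruent to \<open>b\<^bsup>(q - 1) / n\<^esup>\<close>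
  modulo \<open>p\<close>.
\<close>

definition residue_symbol ::
    "nat \<Rightarrow> complex set \<Rightarrow> complex set set \<Rightarrow> complex \<Rightarrow> complex \<Rightarrow> complex" where
  "residue_symbol n F S p b = (THE \<zeta>. \<zeta> \<in> F \<and> \<zeta> ^ n = 1 \<and>
     b ^ ((residue_card F S p - 1) div n) - \<zeta> \<in> prime_ideal_of F S p)"

text \<open>The summand does not depend on the representative \<open>b\<close> of the residue class \<open>B\<close>.\<close>

definition gauss_sum ::
    "nat \<Rightarrow> complex set \<Rightarrow> complex set set \<Rightarrow> (complex \<Rightarrow> complex) \<Rightarrow> complex \<Rightarrow> int \<Rightarrow> complex" where
  "gauss_sum n F S \<psi> p j = (\<Sum>B \<in> Units (residue_ring F S p).
     let b = (SOME b. b \<in> B) in residue_symbol n F S p b powi j * \<psi> (b / p))"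

definition hflat :: "nat \<Rightarrow> complex \<Rightarrow> int \<Rightarrow> complex" where
  "hflat n v a = (if int n dvd a then 1 - v else 0)"

definition gflat :: "complex \<Rightarrow> (int \<Rightarrow> complex) \<Rightarrow> int \<Rightarrow> complex" where
  "gflat v g a = v * g a"


section \<open>The field of rational functions\<close>

text \<open>
  Weights are finitely supported functions on the natural numbers, and \<open>\<int>\<^bsup>r+1\<^esup>\<close> is the subgroup of
  those supported on \<open>{1..r+1}\<close>.  Laurent polynomials are the monoid algebra of the weights.
  The field of rational functions in \<open>x\<^sub>1, \<dots>, x\<^bsub>r+1\<^esub>\<close> is the subset \<open>ratfuns r\<close> of the fraction field
  of the ring of Laurent polynomials in all variables.
\<close>

type_synonym weight = "nat \<Rightarrow>\<^sub>0 int"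
type_synonym laurent = "weight \<Rightarrow>\<^sub>0 complex"
type_synonym ratfun = "laurent fract"

definition weights :: "nat \<Rightarrow> weight set" where
  "weights r = {\<mu>. Poly_Mapping.keys \<mu> \<subseteq> {1..r+1}}"

definition ratfuns :: "nat \<Rightarrow> ratfun set" where
  "ratfuns r = {Fract a b | a b.
     Poly_Mapping.keys a \<subseteq> weights r \<and> Poly_Mapping.keys b \<subseteq> weights r \<and> b \<noteq> 0}"

definition cst :: "complex \<Rightarrow> ratfun" where
  "cst c = Fract (Poly_Mapping.single 0 c) 1"

definition xpow :: "weight \<Rightarrow> ratfun" where
  "xpow \<mu> = Fract (Poly_Mapping.single \<mu> 1) 1"

text \<open>\<open>kalpha k i\<close> is \<open>k \<alpha>\<^sub>i\<close>.\<close>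

definition kalpha :: "int \<Rightarrow> nat \<Rightarrow> weight" where
  "kalpha k i = Poly_Mapping.single i k - Poly_Mapping.single (i + 1) k"

text \<open>
  Reindexing along \<open>h\<close>.  For a permutation \<open>w\<close>, \<open>push w \<mu>\<close> is the weight \<open>w \<mu>\<close>, whose entry at
  \<open>w i\<close> is \<open>\<mu>\<^sub>i\<close>, and \<open>push (push w)\<close> is the induced automorphism of Laurent polynomials.
\<close>

definition push :: "('a \<Rightarrow> 'b) \<Rightarrow> ('a \<Rightarrow>\<^sub>0 'c) \<Rightarrow> ('b \<Rightarrow>\<^sub>0 'c::comm_monoid_add)" where
  "push h P = (\<Sum>k \<in> Poly_Mapping.keys P. Poly_Mapping.single (h k) (Poly_Mapping.lookup P k))"

definition twist :: "(weight \<Rightarrow> complex) \<Rightarrow> laurent \<Rightarrow> laurent" where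
  "twist \<xi> P = (\<Sum>\<mu> \<in> Poly_Mapping.keys P. Poly_Mapping.single \<mu> (\<xi> \<mu> * Poly_Mapping.lookup P \<mu>))"

text \<open>The extension of an injective ring endomorphism to the fraction field.\<close>

definition fract_ext :: "('a::idom \<Rightarrow> 'a) \<Rightarrow> 'a fract \<Rightarrow> 'a fract" where
  "fract_ext \<phi> f = (THE y. \<exists>a b. b \<noteq> 0 \<and> f = Fract a b \<and> y = Fract (\<phi> a) (\<phi> b))"

definition perm_ratfun :: "(nat \<Rightarrow> nat) \<Rightarrow> ratfun \<Rightarrow> ratfun" where
  "perm_ratfun w = fract_ext (push (push w))"


section \<open>The symmetric group\<close>

definition sigma :: "nat \<Rightarrow> nat \<Rightarrow> nat" where
  "sigma i = Transposition.transpose i (i + 1)"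

definition word_perm :: "nat list \<Rightarrow> nat \<Rightarrow> nat" where
  "word_perm is = foldr (\<lambda>i u. sigma i \<circ> u) is id"

definition ell :: "nat \<Rightarrow> (nat \<Rightarrow> nat) \<Rightarrow> nat" where
  "ell r u = (LEAST k. \<exists>is. set is \<subseteq> {1..r} \<and> word_perm is = u \<and> length is = k)"

definition reduced_word :: "nat \<Rightarrow> (nat \<Rightarrow> nat) \<Rightarrow> nat list \<Rightarrow> bool" where
  "reduced_word r u is \<longleftrightarrow> set is \<subseteq> {1..r} \<and> word_perm is = u \<and> length is = ell r u"

text \<open>The reflections of \<open>S\<^bsub>r+1\<^esub>\<close> are the transpositions.\<close>

definition bruhat_step :: "nat \<Rightarrow> (nat \<Rightarrow> nat) \<Rightarrow> (nat \<Rightarrow> nat) \<Rightarrow> bool" where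
  "bruhat_step r u u' \<longleftrightarrow> (\<exists>a b. 1 \<le> a \<and> a < b \<and> b \<le> r + 1 \<and>
     u' = u \<circ> Transposition.transpose a b \<and> ell r u < ell r u')"

definition bruhat_le :: "nat \<Rightarrow> (nat \<Rightarrow> nat) \<Rightarrow> (nat \<Rightarrow> nat) \<Rightarrow> bool" where
  "bruhat_le r = (bruhat_step r)\<^sup>*\<^sup>*"

definition w0 :: "nat \<Rightarrow> nat \<Rightarrow> nat" where
  "w0 r i = (if i \<in> {1..r+1} then r + 2 - i else i)"

definition long_word :: "nat \<Rightarrow> nat list" where
  "long_word r = concat (map (\<lambda>k. rev [1..<k+1]) [1..<r+1])"

definition beginning_section :: "nat \<Rightarrow> (nat \<Rightarrow> nat) \<Rightarrow> bool" where
  "beginning_section r w \<longleftrightarrow>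
     w permutes {1..r+1} \<and> w = word_perm (take (ell r w) (long_word r))"

definition rho :: "nat \<Rightarrow> weight" where
  "rho r = (\<Sum>i = 1..r+1. Poly_Mapping.single i (int (r + 1 - i)))"


section \<open>The metaplectic action and the Demazure--Lusztig operators\<close>

definition Lambda0 :: "nat \<Rightarrow> nat \<Rightarrow> weight set" where
  "Lambda0 r n = {\<mu> \<in> weights r. \<forall>i \<in> {1..r+1}. \<forall>j \<in> {1..r+1}.
     Poly_Mapping.lookup \<mu> i mod int n = Poly_Mapping.lookup \<mu> j mod int n}"

text \<open>
  Characters of \<open>\<int>\<^bsup>r+1\<^esup> / \<Lambda>\<^sub>0\<close>, each extended arbitrarily from \<open>\<int>\<^bsup>r+1\<^esup>\<close> to all weights; every
  character of the direct summand \<open>\<int>\<^bsup>r+1\<^esup>\<close> has such an extension, and only its restriction matters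
  below.
\<close>

definition lattice_chars :: "nat \<Rightarrow> nat \<Rightarrow> (weight \<Rightarrow> complex) set" where
  "lattice_chars r n =
     {\<xi>. (\<forall>\<mu> \<nu>. \<xi> (\<mu> + \<nu>) = \<xi> \<mu> * \<xi> \<nu>) \<and> (\<forall>\<mu> \<in> Lambda0 r n. \<xi> \<mu> = 1)}"

definition Kspace :: "nat \<Rightarrow> nat \<Rightarrow> weight \<Rightarrow> ratfun set" where
  "Kspace r n \<mu> =
     {f \<in> ratfuns r. \<forall>\<xi> \<in> lattice_chars r n. fract_ext (twist \<xi>) f = cst (\<xi> \<mu>) * f}"

definition cg_formula ::
    "nat \<Rightarrow> complex \<Rightarrow> (int \<Rightarrow> complex) \<Rightarrow> nat \<Rightarrow> weight \<Rightarrow> ratfun \<Rightarrow> ratfun" where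
  "cg_formula n v g i \<mu> f =
     (let d = Poly_Mapping.lookup \<mu> (i + 1) - Poly_Mapping.lookup \<mu> i in
      perm_ratfun (sigma i) f / (1 - cst v * xpow (kalpha (int n) i)) *
        (xpow (kalpha (- (d mod int n)) i) * cst (1 - v)
         - cst v * cst (g (1 + d)) * xpow (kalpha (1 - int n) i)
             * (1 - xpow (kalpha (int n) i))))"

text \<open>
  The linear extension of \<open>cg_formula\<close> from the summands \<open>Kspace r n \<mu>\<close> to \<open>ratfuns r\<close>: the value at
  \<open>f\<close> is computed from any decomposition of \<open>f\<close> into members \<open>\<phi> \<mu>\<close> of these summands.
\<close>

definition cg_action ::
    "nat \<Rightarrow> nat \<Rightarrow> complex \<Rightarrow> (int \<Rightarrow> complex) \<Rightarrow> nat \<Rightarrow> ratfun \<Rightarrow> ratfun" where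
  "cg_action r n v g i f = (THE h. \<exists>M \<phi>. finite M \<and> M \<subseteq> weights r \<and>
     (\<forall>\<mu> \<in> M. \<phi> \<mu> \<in> Kspace r n \<mu>) \<and> f = (\<Sum>\<mu> \<in> M. \<phi> \<mu>) \<and>
     h = (\<Sum>\<mu> \<in> M. cg_formula n v g i \<mu> (\<phi> \<mu>)))"

definition demazure ::
    "nat \<Rightarrow> nat \<Rightarrow> complex \<Rightarrow> (int \<Rightarrow> complex) \<Rightarrow> nat \<Rightarrow> ratfun \<Rightarrow> ratfun" where
  "demazure r n v g i f =
     (f - xpow (kalpha (int n) i) * cg_action r n v g i f) / (1 - xpow (kalpha (int n) i))"

definition demazure_lusztig ::
    "nat \<Rightarrow> nat \<Rightarrow> complex \<Rightarrow> (int \<Rightarrow> complex) \<Rightarrow> nat \<Rightarrow> ratfun \<Rightarrow> ratfun" where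
  "demazure_lusztig r n v g i f =
     (1 - cst v * xpow (kalpha (int n) i)) * demazure r n v g i f - f"

text \<open>The choice of the reduced expression is immaterial.\<close>

definition T_op ::
    "nat \<Rightarrow> nat \<Rightarrow> complex \<Rightarrow> (int \<Rightarrow> complex) \<Rightarrow> (nat \<Rightarrow> nat) \<Rightarrow> ratfun \<Rightarrow> ratfun" where
  "T_op r n v g u = foldr (demazure_lusztig r n v g) (SOME is. reduced_word r u is)"


section \<open>Gelfand--Tsetlin patterns\<close>

text \<open>The entries outside the triangle \<open>i \<le> j \<le> s\<close> are normalised to zero.\<close>

definition gt_patterns :: "nat \<Rightarrow> (nat \<Rightarrow> int) \<Rightarrow> (nat \<Rightarrow> nat \<Rightarrow> int) set" where
  "gt_patterns s \<kappa> = {a.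
     (\<forall>i j. \<not> (i \<le> j \<and> j \<le> s) \<longrightarrow> a i j = 0) \<and>
     (\<forall>j \<le> s. a 0 j = \<kappa> j) \<and>
     (\<forall>i j. 1 \<le> i \<and> i \<le> j \<and> j \<le> s \<longrightarrow>
        a (i - 1) (j - 1) \<ge> a i j \<and> a i j \<ge> a (i - 1) j)}"

definition gt_Gamma :: "nat \<Rightarrow> (nat \<Rightarrow> nat \<Rightarrow> int) \<Rightarrow> nat \<Rightarrow> nat \<Rightarrow> int" where
  "gt_Gamma s a i j = (\<Sum>k = j..s. a i k - a (i - 1) k)"

definition gt_d :: "nat \<Rightarrow> (nat \<Rightarrow> nat \<Rightarrow> int) \<Rightarrow> nat \<Rightarrow> int" where
  "gt_d s a i = (\<Sum>j = i..s. a i j)"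

text \<open>The entry at \<open>m\<close> is \<open>d\<^bsub>s+1-m\<^esub> - d\<^bsub>s+2-m\<^esub>\<close>, where \<open>d\<^bsub>s+1\<^esub> = 0\<close> as an empty sum.\<close>

definition gt_wt :: "nat \<Rightarrow> (nat \<Rightarrow> nat \<Rightarrow> int) \<Rightarrow> weight" where
  "gt_wt s a =
     (\<Sum>m = 1..s+1. Poly_Mapping.single m (gt_d s a (s + 1 - m) - gt_d s a (s + 2 - m)))"

definition gt_factor ::
    "nat \<Rightarrow> complex \<Rightarrow> (int \<Rightarrow> complex) \<Rightarrow> nat \<Rightarrow> (nat \<Rightarrow> nat \<Rightarrow> int) \<Rightarrow> nat \<Rightarrow> nat \<Rightarrow> complex" where
  "gt_factor n v g s a i j =
     (if a i j = a (i - 1) j \<and> a (i - 1) j < a (i - 1) (j - 1) then 1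
      else if a (i - 1) j < a i j \<and> a i j < a (i - 1) (j - 1) then hflat n v (gt_Gamma s a i j)
      else if a (i - 1) j < a i j \<and> a i j = a (i - 1) (j - 1) then gflat v g (gt_Gamma s a i j)
      else 0)"

definition gt_coeff ::
    "nat \<Rightarrow> complex \<Rightarrow> (int \<Rightarrow> complex) \<Rightarrow> nat \<Rightarrow> (nat \<Rightarrow> nat \<Rightarrow> int) \<Rightarrow> complex" where
  "gt_coeff n v g s a = (\<Prod>i = 1..s. \<Prod>j = i..s. gt_factor n v g s a i j)"

text \<open>\<open>\<Gamma>\<^bsub>ij\<^esub>\<close> is the entry of the Berenstein--Zelevinsky--Littelmann array with this index.\<close>

definition bzl_index :: "nat \<Rightarrow> nat \<Rightarrow> nat \<Rightarrow> nat" where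
  "bzl_index r i j = ((r - i + 1) choose 2) + (j - i) + 1"

text \<open>
  The vertices of the crystal with highest weight \<open>\<mu>\<close> are the patterns with top row \<open>\<mu>\<close>; patterns
  are indexed from 0 and weights from 1.
\<close>

definition demazure_crystal ::
    "nat \<Rightarrow> weight \<Rightarrow> (nat \<Rightarrow> nat) \<Rightarrow> (nat \<Rightarrow> nat \<Rightarrow> int) set" where
  "demazure_crystal r \<mu> w = {a \<in> gt_patterns r (\<lambda>j. Poly_Mapping.lookup \<mu> (j + 1)).
     \<forall>i j. 1 \<le> i \<and> i \<le> j \<and> j \<le> r \<and> bzl_index r i j > ell r w \<longrightarrow> gt_Gamma r a i j = 0}"

end

(*
  In the shifted monomials y^nu = x^(nu - delta), delta = (0,1,...,r), the operator T_i sends y^nu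
  with d = nu_(i+1) - nu_i > 0 to the sum of c(G) y^(nu + G alpha_i) over 0 < G <= d, where c(G) is
  the coefficient of a pattern of rank one, and T_i y^nu = -y^nu if d = 0.

  The T_i are semilinear over the Laurent polynomials in the x_j^n, up to a Demazure operator.  This
  reduces the quadratic and the braid relations to exponents in a box of side n, where T_i y^nu has
  at most two terms and only g_j g_(-j) = q and g_0 = -1 are needed.

  The permutations of {1..k+1} are the products of one of {1..k} with one of the cycles
  sigma_k ... sigma_m, with lengths adding up, and the Bruhat interval below a beginning section of
  the long word consists of those with m >= j for some j.  Modulo vectors f with T_i f = -f, i < k,
  which are killed by the sum over the permutations of {1..k}, the chains T_k ... T_m with m >= j
  turn y^nu into the sum over all rows interlacing with nu whose entries at positions below j agree
  with those of nu: the terms with non-interlacing rows are absorbed by the quadratic relation.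
  Rows with two equal entries contribute zero on both sides, so the identity follows by induction
  on k.  Below its top row, the first r - k rows of a pattern in the Demazure crystal are forced.
*)
theory Submission
  imports Defs "HOL-Algebra.Multiplicative_Group"
begin

text \<open>Interlacing is not respected one operator at a time: each operator of a chain acts on a
  gap already widened by its predecessor, so a chain yields more monomials than there are rows, and
  the surplus does not vanish by itself. It vanishes under the outer sum over a symmetric group.
  That sum has 1 + T_i as a right factor, since the elements pair off as u and u sigma_i with
  lengths differing by one; so it kills the kernel of T_i + 1 and, by (T_i + 1)(T_i - v) = 0, cannot
  tell T_i from the scalar v. The surplus then cancels because (1 - v) + v = 1. The action of the
  statement is a description over decompositions, and T_u depends on a chosen word. Both are
  replaced by closed forms: averaging over characters makes the action a total operator, and the
  Hecke relations make the word irrelevant. The relations are hard to check directly because T_i on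
  a monomial contains a geometric sum whose length is a floor; in the box that floor takes only the
  values 0 and -1.\<close>

abbreviation (input) "lookup \<equiv> Poly_Mapping.lookup"
abbreviation (input) "single \<equiv> Poly_Mapping.single"
abbreviation (input) "keys \<equiv> Poly_Mapping.keys"

section \<open>Laurent monomials and field automorphisms\<close>

lemma poly_mapping_induct [case_names zero plus]:
  fixes P :: "('a \<Rightarrow>\<^sub>0 'b::comm_monoid_add) \<Rightarrow> bool"
  assumes "P 0" "\<And>k c f. P f \<Longrightarrow> P (single k c + f)"
  shows "P f"
proof (induction f rule: update_induct)
  case const
  show ?case by (rule assms(1))
next
  case (update f a b)
  have "Poly_Mapping.update a b f = single a b + f"
    using update(1)
    by (intro poly_mapping_eqI) (auto simp: lookup_update lookup_add lookup_single when_def in_keys_iff)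
  then show ?case using assms(2)[OF update(3)] by simp
qed

section \<open>Extending injective endomorphisms of a domain to its fraction field\<close>

locale inj_endo =
  fixes \<phi> :: "'a::idom \<Rightarrow> 'a"
  assumes add: "\<phi> (a + b) = \<phi> a + \<phi> b"
    and mult: "\<phi> (a * b) = \<phi> a * \<phi> b"
    and one: "\<phi> 1 = 1"
    and eq_0: "\<phi> a = 0 \<Longrightarrow> a = 0"
begin

lemma zero: "\<phi> 0 = 0"
  using add[of 0 0] by (metis add_0 add_cancel_right_left)

text \<open>Equality of cross products survives the endomorphism, and injectivity keeps denominators
  nonzero, so the description in \<open>fract_ext\<close> has exactly one solution. For
  \<open>b = 0\<close> both sides are 0, since a fraction with zero denominator is 0 by
  convention.\<close>

lemma ext_Fract: "fract_ext \<phi> (Fract a b) = Fract (\<phi> a) (\<phi> b)"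
proof (cases "b = 0")
  case True
  then have F: "Fract a b = Fract 0 1"
    by (simp add: fract_collapse)
  show ?thesis
    unfolding fract_ext_def True F[unfolded True]
  proof (rule the_equality)
    show "\<exists>c d. d \<noteq> 0 \<and> Fract 0 1 = Fract c d \<and> Fract (\<phi> a) (\<phi> 0) = Fract (\<phi> c) (\<phi> d)"
      by (intro exI[of _ 0] exI[of _ 1]) (simp add: zero one fract_collapse)
    fix y assume "\<exists>c d. d \<noteq> 0 \<and> Fract 0 1 = Fract c d \<and> y = Fract (\<phi> c) (\<phi> d)"
    then obtain c d where d: "d \<noteq> 0" "Fract 0 1 = Fract c d" "y = Fract (\<phi> c) (\<phi> d)" by blast
    then have "c = 0" by (simp add: eq_fract)
    then show "y = Fract (\<phi> a) (\<phi> 0)"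
      using d by (simp add: zero fract_collapse)
  qed
next
  case False
  show ?thesis unfolding fract_ext_def
  proof (rule the_equality)
    show "\<exists>a' b'. b' \<noteq> 0 \<and> Fract a b = Fract a' b' \<and> Fract (\<phi> a) (\<phi> b) = Fract (\<phi> a') (\<phi> b')"
      using False by blast
    fix y assume "\<exists>a' b'. b' \<noteq> 0 \<and> Fract a b = Fract a' b' \<and> y = Fract (\<phi> a') (\<phi> b')"
    then obtain c d where d: "d \<noteq> 0" "Fract a b = Fract c d" "y = Fract (\<phi> c) (\<phi> d)" by blast
    then have "a * d = c * b" using False by (simp add: eq_fract)
    then have "\<phi> a * \<phi> d = \<phi> c * \<phi> b" by (metis mult)
    moreover have "\<phi> b \<noteq> 0" "\<phi> d \<noteq> 0" using False d eq_0 by blast+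
    ultimately show "y = Fract (\<phi> a) (\<phi> b)"
      using d by (simp add: eq_fract)
  qed
qed

lemma ext_0: "fract_ext \<phi> 0 = 0"
  by (simp add: Zero_fract_def ext_Fract zero one)

lemma ext_1: "fract_ext \<phi> 1 = 1"
  by (simp add: One_fract_def ext_Fract one)

lemma ext_add: "fract_ext \<phi> (x + y) = fract_ext \<phi> x + fract_ext \<phi> y"
proof (cases x rule: Fract_cases)
  case x: (Fract a b)
  show ?thesis
  proof (cases y rule: Fract_cases)
    case (Fract c d)
    then have "\<phi> b \<noteq> 0" "\<phi> d \<noteq> 0" using x eq_0 by blast+
    then show ?thesis using x Fract by (simp add: ext_Fract add mult)
  qed
qed

lemma ext_mult: "fract_ext \<phi> (x * y) = fract_ext \<phi> x * fract_ext \<phi> y"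
proof (cases x rule: Fract_cases)
  case x: (Fract a b)
  show ?thesis
  proof (cases y rule: Fract_cases)
    case (Fract c d)
    then show ?thesis using x by (auto simp: ext_Fract mult)
  qed
qed

lemma ext_inverse: "fract_ext \<phi> (inverse x) = inverse (fract_ext \<phi> x)"
  by (cases x rule: Fract_cases) (auto simp: ext_Fract)

lemma ext_divide: "fract_ext \<phi> (x / y) = fract_ext \<phi> x / fract_ext \<phi> y"
  by (simp add: divide_inverse ext_mult ext_inverse)

lemma ext_uminus: "fract_ext \<phi> (- x) = - fract_ext \<phi> x"
  using ext_add[of x "-x"] by (simp add: ext_0 eq_neg_iff_add_eq_0 add.commute)

lemma ext_diff: "fract_ext \<phi> (x - y) = fract_ext \<phi> x - fract_ext \<phi> y"
  using ext_add[of x "-y"] by (simp add: ext_uminus)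

lemmas ext_simps = ext_0 ext_1 ext_add ext_mult ext_divide ext_uminus ext_diff

end

section \<open>Two kinds of automorphisms of the Laurent ring: permuting variables and twisting by
  characters\<close>

lemma push_superset:
  assumes "finite A" "keys P \<subseteq> A"
  shows "push h P = (\<Sum>k \<in> A. single (h k) (lookup P k))"
  unfolding push_def using assms
  by (intro sum.mono_neutral_left) (auto simp: in_keys_iff)

lemma push_single: "push h (single k c) = single (h k) c"
  by (subst push_superset[of "{k}"]) auto

lemma push_0: "push h 0 = 0"
  by (simp add: push_def)

lemma push_add: "push h (P + Q) = push h P + push h Q"
proof -
  let ?A = "keys P \<union> keys Q"
  have "push h (P + Q) = (\<Sum>k\<in>?A. single (h k) (lookup (P + Q) k))"
    using keys_add[of P Q] by (intro push_superset) auto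
  also have "\<dots> = (\<Sum>k\<in>?A. single (h k) (lookup P k)) +
      (\<Sum>k\<in>?A. single (h k) (lookup Q k))"
    by (simp add: lookup_add single_add sum.distrib)
  also have "\<dots> = push h P + push h Q"
    by (subst (1 2) push_superset[symmetric]) auto
  finally show ?thesis .
qed

lemma lookup_push_inj:
  assumes "inj h"
  shows "lookup (push h P) (h k) = lookup P k"
proof (induction P rule: poly_mapping_induct)
  case (plus l c f)
  then show ?case
    by (auto simp: push_add push_single lookup_add lookup_single inj_eq[OF assms])
qed (simp add: push_0)

lemma push_eq_iff: "inj h \<Longrightarrow> push h P = push h Q \<longleftrightarrow> P = Q"
  by (metis lookup_push_inj poly_mapping_eqI)

lemma push_mult:
  fixes P Q :: "'a::comm_monoid_add \<Rightarrow>\<^sub>0 'c::comm_semiring_1"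
  assumes "\<And>k l. h (k + l) = h k + h l"
  shows "push h (P * Q) = push h P * push h Q"
proof (induction P rule: poly_mapping_induct)
  case (plus k c P)
  have "push h (single k c * Q) = single (h k) c * push h Q"
  proof (induction Q rule: poly_mapping_induct)
    case (plus l d Q)
    then show ?case
      by (simp add: distrib_left push_add push_single mult_single assms)
  qed (simp add: push_0)
  with plus show ?case by (simp add: distrib_right push_add push_single)
qed (simp add: push_0)

lemma twist_superset:
  assumes "finite A" "keys P \<subseteq> A"
  shows "twist \<xi> P = (\<Sum>\<mu> \<in> A. single \<mu> (\<xi> \<mu> * lookup P \<mu>))"
  unfolding twist_def using assms
  by (intro sum.mono_neutral_left) (auto simp: in_keys_iff)

lemma twist_single: "twist \<xi> (single k c) = single k (\<xi> k * c)"
  by (subst twist_superset[of "{k}"]) auto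

lemma twist_0: "twist \<xi> 0 = 0"
  by (simp add: twist_def)

lemma twist_add: "twist \<xi> (P + Q) = twist \<xi> P + twist \<xi> Q"
proof -
  let ?A = "keys P \<union> keys Q"
  have "twist \<xi> (P + Q) = (\<Sum>k\<in>?A. single k (\<xi> k * lookup (P + Q) k))"
    using keys_add[of P Q] by (intro twist_superset) auto
  also have "\<dots> = (\<Sum>k\<in>?A. single k (\<xi> k * lookup P k)) +
      (\<Sum>k\<in>?A. single k (\<xi> k * lookup Q k))"
    by (simp add: lookup_add single_add sum.distrib distrib_left)
  also have "\<dots> = twist \<xi> P + twist \<xi> Q"
    by (subst (1 2) twist_superset[symmetric]) auto
  finally show ?thesis .
qed

lemma lookup_twist: "lookup (twist \<xi> P) k = \<xi> k * lookup P k"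
proof (induction P rule: poly_mapping_induct)
  case (plus l c f)
  then show ?case
    by (auto simp: twist_add twist_single lookup_add lookup_single distrib_left when_def)
qed (simp add: twist_0)

lemma twist_mult:
  assumes "\<And>k l. \<xi> (k + l) = \<xi> k * \<xi> l"
  shows "twist \<xi> (P * Q) = twist \<xi> P * twist \<xi> Q"
proof (induction P rule: poly_mapping_induct)
  case (plus k c P)
  have "twist \<xi> (single k c * Q) = single k (\<xi> k * c) * twist \<xi> Q"
  proof (induction Q rule: poly_mapping_induct)
    case (plus l d Q)
    then show ?case
      by (simp add: distrib_left twist_add twist_single mult_single assms mult_ac)
  qed (simp add: twist_0)
  with plus show ?case by (simp add: distrib_right twist_add twist_single)
qed (simp add: twist_0)

text \<open>The value 1 at 0 excludes the zero function; all values are then invertible, which makes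
  twisting injective.\<close>

definition wchar :: "(weight \<Rightarrow> complex) \<Rightarrow> bool" where
  "wchar \<xi> \<longleftrightarrow> (\<forall>\<mu> \<nu>. \<xi> (\<mu> + \<nu>) = \<xi> \<mu> * \<xi> \<nu>) \<and> \<xi> 0 = 1"

lemma inj_endo_twist:
  assumes "wchar \<xi>"
  shows "inj_endo (twist \<xi>)"
proof
  have nz: "\<xi> k \<noteq> 0" for k
  proof
    assume "\<xi> k = 0"
    then have "\<xi> (k + (-k)) = 0" using assms unfolding wchar_def by (metis mult_zero_left)
    then show False using assms by (simp add: wchar_def)
  qed
  show "twist \<xi> 1 = 1"
    using twist_single[of \<xi> 0 1] assms by (simp add: wchar_def)
  show "a = 0" if "twist \<xi> a = 0" for a
    using that lookup_twist[of \<xi> a] nz by (intro poly_mapping_eqI) (metis lookup_zero mult_eq_0_iff)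
qed (use assms in \<open>simp_all add: twist_add twist_mult wchar_def\<close>)

lemma inj_endo_push:
  assumes "inj h" "h 0 = 0" "\<And>k l. h (k + l) = h k + h l"
  shows "inj_endo (push h :: laurent \<Rightarrow> laurent)"
proof
  show "push h 1 = (1::laurent)"
    using push_single[of h 0 "1::complex"] assms by simp
  show "a = 0" if "push h a = 0" for a :: laurent
    using that push_eq_iff[OF assms(1), of a 0] by (simp add: push_0)
qed (use assms in \<open>simp_all add: push_add push_mult\<close>)

lemma inj_sigma: "inj (sigma i)"
  by (simp add: sigma_def)

lemma sigma_sigma [simp]: "sigma i (sigma i j) = j"
  by (simp add: sigma_def)

lemma lookup_push_sigma: "lookup (push (sigma i) \<mu>) j = lookup \<mu> (sigma i j)"
  using lookup_push_inj[OF inj_sigma, of i \<mu> "sigma i j"] by simp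

interpretation sig: inj_endo "push (push (sigma i)) :: laurent \<Rightarrow> laurent" for i
proof (rule inj_endo_push)
  show "inj (push (sigma i) :: weight \<Rightarrow> weight)"
    by (rule injI) (simp add: push_eq_iff inj_sigma)
qed (simp_all add: push_0 push_add)

abbreviation perm_s :: "nat \<Rightarrow> ratfun \<Rightarrow> ratfun" where
  "perm_s i \<equiv> perm_ratfun (sigma i)"

lemmas perm_s_simps = sig.ext_simps[folded perm_ratfun_def]

section \<open>Constants and monomials inside the field, and the automorphisms on them\<close>

lemma cst_0 [simp]: "cst 0 = 0" and cst_1 [simp]: "cst 1 = 1"
  by (simp_all add: cst_def Zero_fract_def One_fract_def)

lemma cst_add: "cst (a + b) = cst a + cst b" and cst_mult: "cst (a * b) = cst a * cst b"
  by (simp_all add: cst_def single_add mult_single)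

lemma cst_uminus: "cst (- a) = - cst a"
  by (simp add: cst_def single_uminus)

lemma cst_diff: "cst (a - b) = cst a - cst b"
  by (simp add: cst_def single_diff)

lemma cst_sum: "cst (sum f A) = (\<Sum>a\<in>A. cst (f a))"
  by (induction A rule: infinite_finite_induct) (simp_all add: cst_add)

lemma xpow_0 [simp]: "xpow 0 = 1"
  by (simp add: xpow_def One_fract_def)

lemma xpow_add: "xpow (\<mu> + \<nu>) = xpow \<mu> * xpow \<nu>"
  by (simp add: xpow_def mult_single)

lemma cst_xpow_eq_iff:
  "cst a * xpow \<mu> = cst b * xpow \<nu> \<longleftrightarrow> single \<mu> a = single \<nu> b"
  by (simp add: cst_def xpow_def mult_single eq_fract)

lemma xpow_nz [simp]: "xpow \<mu> \<noteq> 0"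
  by (simp add: xpow_def Zero_fract_def eq_fract) (metis lookup_single_eq lookup_zero zero_neq_one)

lemma xpow_uminus: "xpow (- \<mu>) = inverse (xpow \<mu>)"
proof -
  have "xpow \<mu> * xpow (- \<mu>) = 1" by (simp flip: xpow_add)
  then show ?thesis by (simp add: inverse_unique)
qed

lemma xpow_diff: "xpow (\<mu> - \<nu>) = xpow \<mu> / xpow \<nu>"
  using xpow_add[of \<mu> "-\<nu>"] by (simp add: xpow_uminus divide_inverse)

lemma lookup_kalpha:
  "lookup (kalpha k i) j = (if j = i then k else if j = i + 1 then - k else 0)"
  by (simp add: kalpha_def lookup_minus lookup_single)

lemma kalpha_0 [simp]: "kalpha 0 i = 0"
  by (simp add: kalpha_def)

lemma kalpha_add: "kalpha (a + b) i = kalpha a i + kalpha b i"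
  by (simp add: kalpha_def single_add)

lemma kalpha_uminus: "kalpha (- a) i = - kalpha a i"
  by (simp add: kalpha_def single_uminus)

lemma kalpha_eq_0_iff [simp]: "kalpha k i = 0 \<longleftrightarrow> k = 0"
  by (metis kalpha_0 lookup_kalpha lookup_zero)

text \<open>Distinct monomials are linearly independent. All denominators of the operators are of
  this form.\<close>

lemma one_minus_cst_xpow_nz:
  assumes "\<mu> \<noteq> 0"
  shows "1 - cst a * xpow \<mu> \<noteq> 0"
proof
  assume "1 - cst a * xpow \<mu> = 0"
  then have "cst 1 * xpow 0 = cst a * xpow \<mu>" by simp
  then have "single 0 (1::complex) = single \<mu> a"
    by (subst (asm) cst_xpow_eq_iff)
  then have "lookup (single 0 (1::complex)) 0 = lookup (single \<mu> a) 0"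
    by simp
  then show False using assms by (simp add: lookup_single when_def)
qed

lemma perm_s_xpow: "perm_s i (xpow \<mu>) = xpow (push (sigma i) \<mu>)"
  by (simp add: perm_ratfun_def xpow_def sig.ext_Fract push_single sig.one)

lemma perm_s_cst: "perm_s i (cst c) = cst c"
  by (simp add: perm_ratfun_def cst_def sig.ext_Fract push_single sig.one push_0)

text \<open>In this form the transposition becomes a translation by a multiple of alpha_i, so that
  all terms of T_i on a monomial lie on one line in the direction alpha_i.\<close>

lemma push_sigma: "push (sigma i) \<mu> =
   \<mu> + kalpha (lookup \<mu> (i + 1) - lookup \<mu> i) i"
  by (intro poly_mapping_eqI)
    (simp only: lookup_push_sigma lookup_add lookup_kalpha, simp add: sigma_def transpose_def)

abbreviation tw :: "(weight \<Rightarrow> complex) \<Rightarrow> ratfun \<Rightarrow> ratfun" where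
  "tw \<xi> \<equiv> fract_ext (twist \<xi>)"

lemma tw_xpow: "wchar \<xi> \<Longrightarrow> tw \<xi> (xpow \<mu>) = cst (\<xi> \<mu>) * xpow \<mu>"
  by (simp add: xpow_def cst_def inj_endo.ext_Fract[OF inj_endo_twist] twist_single mult_single
      inj_endo.one[OF inj_endo_twist])

lemma tw_cst: "wchar \<xi> \<Longrightarrow> tw \<xi> (cst c) = cst c"
  by (simp add: cst_def inj_endo.ext_Fract[OF inj_endo_twist] twist_single
      inj_endo.one[OF inj_endo_twist]) (simp add: wchar_def)

lemmas tw_simps = inj_endo.ext_simps[OF inj_endo_twist]

text \<open>A twist passes through a permutation at the price of transforming the character; this is
  what makes \<open>ninv\<close> stable under permutations.\<close>

lemma tw_perm_s:
  assumes "wchar \<xi>"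
  shows "wchar (\<lambda>\<mu>. \<xi> (push (sigma i) \<mu>))"
    and "tw \<xi> (perm_s i f) = perm_s i (tw (\<lambda>\<mu>. \<xi> (push (sigma i) \<mu>)) f)"
proof -
  show *: "wchar (\<lambda>\<mu>. \<xi> (push (sigma i) \<mu>))"
    using assms by (simp add: wchar_def push_add push_0)
  have **: "twist \<xi> (push (push (sigma i)) P) = push (push (sigma i)) (twist (\<lambda>\<mu>. \<xi> (push (sigma i) \<mu>)) P)"
    for P :: laurent
  proof (induction P rule: poly_mapping_induct)
    case (plus k c f)
    then show ?case by (simp add: push_add twist_add push_single twist_single)
  qed (simp add: push_0 twist_0)
  show "tw \<xi> (perm_s i f) = perm_s i (tw (\<lambda>\<mu>. \<xi> (push (sigma i) \<mu>)) f)"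
    by (cases f rule: Fract_cases)
      (simp add: perm_ratfun_def sig.ext_Fract inj_endo.ext_Fract[OF inj_endo_twist] * ** assms)
qed

lemma perm_s_perm_s: "perm_s i (perm_s i f) = f"
proof -
  have 1: "push (sigma i) (push (sigma i) \<mu>) = \<mu>" for \<mu> :: weight
    by (intro poly_mapping_eqI) (simp add: lookup_push_sigma)
  have "push (push (sigma i)) (push (push (sigma i)) P) = P" for P :: laurent
  proof (induction P rule: poly_mapping_induct)
    case (plus k c f)
    then show ?case by (simp add: push_add push_single 1)
  qed (simp add: push_0)
  then show ?thesis by (cases f rule: Fract_cases) (simp add: perm_ratfun_def sig.ext_Fract)
qed

lemma perm_s_braid: "perm_s i (perm_s (Suc i) (perm_s i f)) = perm_s (Suc i) (perm_s i (perm_s (Suc i) f))"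
proof -
  have 1: "push (sigma i) (push (sigma (Suc i)) (push (sigma i) \<mu>)) =
      push (sigma (Suc i)) (push (sigma i) (push (sigma (Suc i)) \<mu>))" for \<mu> :: weight
    by (intro poly_mapping_eqI) (simp only: lookup_push_sigma, simp add: sigma_def transpose_def)
  have "push (push (sigma i)) (push (push (sigma (Suc i))) (push (push (sigma i)) P)) =
     push (push (sigma (Suc i))) (push (push (sigma i)) (push (push (sigma (Suc i))) P))" for P :: laurent
  proof (induction P rule: poly_mapping_induct)
    case (plus k c f)
    then show ?case by (simp add: push_add push_single 1)
  qed (simp add: push_0)
  then show ?thesis by (cases f rule: Fract_cases) (simp add: perm_ratfun_def sig.ext_Fract)
qed

section \<open>The Demazure--Lusztig operators on all rational functions\<close>

text \<open>The arithmetic enters through these properties of the parameters alone; here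
  \<open>inverse v\<close> plays the role of q, and the Gauss sums are substituted in the last
  proof.\<close>

locale metaplectic =
  fixes n :: nat and v :: complex and g :: "int \<Rightarrow> complex"
  assumes n_pos: "n \<ge> 1"
    and v_nz: "v \<noteq> 0"
    and g_periodic: "g (a + int n) = g a"
    and g_dvd: "int n dvd a \<Longrightarrow> g a = - 1"
    and g_not_dvd: "\<not> int n dvd a \<Longrightarrow> g a * g (- a) = inverse v"
begin

lemma g_mod: "g (a mod int n) = g a"
proof -
  have 1: "g (a + int k * int n) = g a" for a k
  proof (induction k)
    case (Suc k)
    then show ?case using g_periodic[of "a + int k * int n"] by (simp add: algebra_simps)
  qed simp
  have "g (a + k * int n) = g a" for k :: int
  proof (cases "k \<ge> 0")
    case True
    then show ?thesis using 1[of a "nat k"] by simp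
  next
    case False
    then show ?thesis using 1[of "a + k * int n" "nat (-k)"] by simp
  qed
  from this[of "-(a div int n)"] show ?thesis
    by (simp add: minus_div_mult_eq_mod)
qed

lemma g_cong: "a mod int n = b mod int n \<Longrightarrow> g a = g b"
  using g_mod[of a] g_mod[of b] by simp

section \<open>The grading modulo n and a total form of the Chinta-Gunnells action\<close>

definition X :: "nat \<Rightarrow> ratfun" where
  "X i = xpow (kalpha (int n) i)"

text \<open>These characters detect mu_(i+1) - mu_i modulo n, which is all that the formula for
  sigma_i uses of the class of mu modulo \<open>Lambda0\<close>.\<close>

definition chi :: "nat \<Rightarrow> nat \<Rightarrow> weight \<Rightarrow> complex" where
  "chi i k \<mu> = cis (2 * pi * real k *
     of_int (lookup \<mu> (i + 1) - lookup \<mu> i) / real n)"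

definition avg :: "nat \<Rightarrow> int \<Rightarrow> ratfun \<Rightarrow> ratfun" where
  "avg i c f = cst (1 / of_nat n) *
     (\<Sum>k<n. cst (cis (- (2 * pi * real k * of_int c / real n))) * tw (chi i k) f)"

definition cgf :: "nat \<Rightarrow> int \<Rightarrow> ratfun \<Rightarrow> ratfun" where
  "cgf i c f = perm_s i f / (1 - cst v * X i) * (xpow (kalpha (- c) i) * cst (1 - v) -
     cst v * cst (g (1 + c)) * xpow (kalpha (1 - int n) i) * (1 - X i))"

text \<open>The Chinta--Gunnells action, extended to the whole field: the component of \<open>f\<close> on which
  \<open>\<mu>\<^bsub>i+1\<^esub> - \<mu>\<^sub>i \<equiv> c\<close> is extracted by averaging over characters.\<close>

definition tau :: "nat \<Rightarrow> ratfun \<Rightarrow> ratfun" where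
  "tau i f = (\<Sum>c = 0..<int n. cgf i c (avg i c f))"

definition T :: "nat \<Rightarrow> ratfun \<Rightarrow> ratfun" where
  "T i f = (1 - cst v * X i) * ((f - X i * tau i f) / (1 - X i)) - f"

lemma wchar_chi: "wchar (chi i k)"
  by (auto simp: wchar_def chi_def lookup_add cis_mult add_divide_distrib[symmetric] algebra_simps)

text \<open>Orthogonality of the characters of the cyclic group of order n, by summing a geometric
  series with ratio an n-th root of unity.\<close>

lemma sum_cis:
  fixes e :: int
  shows "(\<Sum>k<n. cis (2 * pi * real k * of_int e / real n)) = (if int n dvd e then of_nat n else 0)"
proof -
  define z where "z = cis (2 * pi * of_int e / real n)"
  have zk: "cis (2 * pi * real k * of_int e / real n) = z ^ k" for k
    by (simp add: z_def Complex.DeMoivre mult_ac)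
  have zn: "z ^ n = 1"
    using n_pos by (simp add: z_def Complex.DeMoivre cis_multiple_2pi)
  show ?thesis
  proof (cases "int n dvd e")
    case True
    then obtain m where m: "e = int n * m" by blast
    have "2 * pi * of_int e / real n = 2 * pi * of_int m" using n_pos by (simp add: m)
    then have "z = 1" unfolding z_def by (metis cis_multiple_2pi Ints_of_int)
    with True show ?thesis by (simp add: zk)
  next
    case False
    have "z \<noteq> 1"
    proof
      assume "z = 1"
      then have "cos (2 * pi * of_int e / real n) = 1" by (simp add: z_def complex_eq_iff)
      then obtain m :: int where "2 * pi * of_int e / real n = of_int m * 2 * pi"
        by (auto simp: cos_one_2pi_int)
      then have "real_of_int e = of_int (m * int n)"
        using n_pos by (simp add: field_simps)
      then show False using False by (metis dvd_triv_right of_int_eq_iff)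
    qed
    with False show ?thesis by (simp add: zk geometric_sum zn)
  qed
qed

text \<open>The grading by mu_(i+1) - mu_i modulo n, which is coarser than the one by
  \<open>Kspace\<close>. Its degree-zero part consists of the functions over which
  \<open>tau i\<close> is semilinear.\<close>

definition homog :: "nat \<Rightarrow> int \<Rightarrow> ratfun \<Rightarrow> bool" where
  "homog i d f \<longleftrightarrow> (\<forall>k. tw (chi i k) f = cst (cis (2 * pi * real k * of_int d / real n)) * f)"

lemma avg_homog:
  assumes "homog i d f"
  shows "avg i c f = (if int n dvd d - c then f else 0)"
proof -
  have "(\<Sum>k<n. cst (cis (- (2 * pi * real k * of_int c / real n))) * tw (chi i k) f) =
     (\<Sum>k<n. cst (cis (2 * pi * real k * of_int (d - c) / real n)) * f)"
  proof (intro sum.cong refl)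
    fix k
    have "cst (cis (- (2 * pi * real k * of_int c / real n))) * tw (chi i k) f =
      cst (cis (- (2 * pi * real k * of_int c / real n)) * cis (2 * pi * real k * of_int d / real n)) * f"
      using assms by (simp add: homog_def cst_mult)
    also have "cis (- (2 * pi * real k * of_int c / real n)) * cis (2 * pi * real k * of_int d / real n)
      = cis (2 * pi * real k * of_int (d - c) / real n)"
      by (simp add: cis_mult diff_divide_distrib right_diff_distrib)
    finally show "cst (cis (- (2 * pi * real k * of_int c / real n))) * tw (chi i k) f =
       cst (cis (2 * pi * real k * of_int (d - c) / real n)) * f" .
  qed
  also have "\<dots> = cst (if int n dvd d - c then of_nat n else 0) * f"
    by (simp only: sum_cis cst_sum[symmetric] sum_distrib_right[symmetric])
  finally show ?thesis
    using n_pos by (simp add: avg_def mult.assoc[symmetric] cst_mult[symmetric])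
qed

lemma cgf_0 [simp]: "cgf i c 0 = 0"
  by (simp add: cgf_def perm_s_simps)

lemma cgf_add: "cgf i c (f + h) = cgf i c f + cgf i c h"
  by (simp add: cgf_def perm_s_simps add_divide_distrib distrib_right)

lemma cgf_mult: "cgf i c (f * h) = perm_s i f * cgf i c h"
  by (simp add: cgf_def perm_s_simps)

lemma avg_add: "avg i c (f + h) = avg i c f + avg i c h"
  by (simp add: avg_def tw_simps[OF wchar_chi] distrib_left sum.distrib)

lemma avg_mult:
  assumes "homog i 0 f"
  shows "avg i c (f * h) = f * avg i c h"
  using assms by (simp add: avg_def tw_simps[OF wchar_chi] homog_def sum_distrib_left mult_ac)

lemma tau_add: "tau i (f + h) = tau i f + tau i h"
  by (simp add: tau_def avg_add cgf_add sum.distrib)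

lemma tau_mult: "homog i 0 f \<Longrightarrow> tau i (f * h) = perm_s i f * tau i h"
  by (simp add: tau_def avg_mult cgf_mult sum_distrib_left)

lemma tau_homog:
  assumes "homog i d f"
  shows "tau i f = cgf i (d mod int n) f"
proof -
  have "tau i f = (\<Sum>c = 0..<int n. if c = d mod int n then cgf i c f else 0)"
    unfolding tau_def
  proof (intro sum.cong refl)
    fix c assume c: "c \<in> {0..<int n}"
    then have "int n dvd d - c \<longleftrightarrow> c = d mod int n"
      by (simp add: mod_eq_dvd_iff[symmetric]) auto
    then show "cgf i c (avg i c f) = (if c = d mod int n then cgf i c f else 0)"
      by (simp add: avg_homog[OF assms])
  qed
  also have "\<dots> = cgf i (d mod int n) f"
    using n_pos by simp
  finally show ?thesis .
qed

lemma homog_xpow: "homog i (lookup \<mu> (i + 1) - lookup \<mu> i) (xpow \<mu>)"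
  by (simp add: homog_def tw_xpow[OF wchar_chi]) (simp add: chi_def)

lemma homog_cst: "homog i 0 (cst c)"
  by (simp add: homog_def tw_cst[OF wchar_chi])

lemma X_nz: "1 - cst v * X i \<noteq> 0" "1 - X i \<noteq> 0" "X i \<noteq> 0"
  using one_minus_cst_xpow_nz[of "kalpha (int n) i" v] one_minus_cst_xpow_nz[of "kalpha (int n) i" 1] n_pos
  by (simp_all add: X_def)

lemma T_eq: "T i f = cst (1 - v) * X i / (1 - X i) * f - (1 - cst v * X i) * X i / (1 - X i) * tau i f"
proof -
  have "T i f = (1 - cst v * X i) / (1 - X i) * f - f - (1 - cst v * X i) * X i / (1 - X i) * tau i f"
    unfolding T_def by (simp add: diff_divide_distrib[of f] right_diff_distrib[of "1 - cst v * X i"] mult.assoc)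
  also have "(1 - cst v * X i) / (1 - X i) * f - f = cst (1 - v) * X i / (1 - X i) * f"
    using X_nz(2)[of i] by (simp add: divide_simps cst_diff) (simp add: algebra_simps)
  finally show ?thesis .
qed

section \<open>Semilinearity of the operators and their values on monomials\<close>

lemma T_add: "T i (f + h) = T i f + T i h"
  by (simp add: T_eq tau_add distrib_left)

text \<open>A divided difference for the ordinary action, with respect to X_i = x^(n alpha_i); it
  measures how far T_i is from being semilinear.\<close>

definition Dm :: "nat \<Rightarrow> ratfun \<Rightarrow> ratfun" where
  "Dm i f = X i * (f - perm_s i f) / (1 - X i)"

text \<open>Since \<open>tau i\<close> is semilinear over f, only the summand (1 - v) X_i f h / (1 -
  X_i) deviates; replacing f there by its reflection costs exactly the divided difference.\<close>

lemma T_mult: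
  assumes "homog i 0 f"
  shows "T i (f * h) = perm_s i f * T i h + cst (1 - v) * Dm i f * h"
proof -
  define E where "E = X i / (1 - X i)"
  have D: "Dm i f = E * f - E * perm_s i f"
    by (simp add: E_def Dm_def right_diff_distrib diff_divide_distrib)
  define Q where "Q = (1 - cst v * X i) * E"
  have T: "T i f = cst (1 - v) * E * f - Q * tau i f" for f
    by (simp add: T_eq E_def Q_def)
  show ?thesis
    unfolding D T tau_mult[OF assms] by (simp add: algebra_simps)
qed

lemma T_fixed:
  assumes "homog i 0 f" "perm_s i f = f"
  shows "T i (f * h) = f * T i h"
  using T_mult[OF assms(1)] assms(2) by (simp add: Dm_def)

lemma T_cst: "T i (cst c * h) = cst c * T i h"
  by (rule T_fixed) (simp_all add: homog_cst perm_s_cst)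

lemma T_0 [simp]: "T i 0 = 0"
  using T_cst[of i 0 0] by simp

text \<open>The reflected monomial is x^(mu + d alpha_i). In the first term, subtracting d mod n and
  multiplying by X_i leaves the multiple n (d div n + 1) of alpha_i. In the Gauss sum term the
  shifts 1 - n and n leave d + 1, and the factor 1 - X_i cancels the denominator.\<close>

lemma T_xpow:
  fixes \<mu> i
  defines "d \<equiv> lookup \<mu> (i + 1) - lookup \<mu> i"
  shows "T i (xpow \<mu>) = cst (1 - v) * ((X i - xpow (kalpha (int n * (d div int n + 1)) i)) / (1 - X i)) * xpow \<mu>
     + cst (gflat v g (d + 1)) * xpow (\<mu> + kalpha (d + 1) i)"
proof -
  define x where "x k = xpow (kalpha k i)" for k
  have x_add: "x (a + b) = x a * x b" for a b
    by (simp add: x_def kalpha_add xpow_add)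
  have d: "d = int n * (d div int n) + d mod int n" by simp
  have g: "g (1 + d mod int n) = g (d + 1)"
    by (rule g_cong) (simp add: add.commute mod_add_right_eq)
  have X: "X i = x (int n)" by (simp add: X_def x_def)
  have 1: "x d * x (- (d mod int n)) * x (int n) = x (int n * (d div int n + 1))"
  proof -
    have "d + - (d mod int n) + int n = int n * (d div int n + 1)"
      using d unfolding distrib_left by linarith
    then show ?thesis by (simp only: x_add[symmetric])
  qed
  have 2: "x d * x (1 - int n) * x (int n) = x (d + 1)"
    by (simp add: x_add[symmetric] add.commute)
  have "tau i (xpow \<mu>) = xpow (push (sigma i) \<mu>) / (1 - cst v * X i) * (x (- (d mod int n)) * cst (1 - v) -
     cst v * cst (g (d + 1)) * x (1 - int n) * (1 - X i))"
    unfolding tau_homog[OF homog_xpow[of i \<mu>], folded d_def] cgf_def perm_s_xpow g x_def ..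
  also have "xpow (push (sigma i) \<mu>) = xpow \<mu> * x d"
    by (simp only: push_sigma xpow_add x_def d_def)
  finally have tau: "tau i (xpow \<mu>) = xpow \<mu> * x d / (1 - cst v * X i) * (x (- (d mod int n)) * cst (1 - v) -
     cst v * cst (g (d + 1)) * x (1 - int n) * (1 - X i))" .
  define A where "A = x (int n * (d div int n + 1))"
  define B where "B = x (d + 1)"
  define G where "G = cst (gflat v g (d + 1))"
  have G: "cst v * cst (g (d + 1)) = G"
    by (simp add: G_def gflat_def cst_mult)
  have "(1 - cst v * X i) * X i * tau i (xpow \<mu>) =
     xpow \<mu> * (cst (1 - v) * (x d * x (- (d mod int n)) * x (int n)) -
        G * (x d * x (1 - int n) * x (int n)) * (1 - X i))"
    unfolding tau G X using X_nz(1)[of i, unfolded X] by (simp add: field_simps)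
  also have "\<dots> = xpow \<mu> * (cst (1 - v) * A - G * B * (1 - X i))"
    unfolding 1 2 A_def B_def ..
  finally have "T i (xpow \<mu>) = (cst (1 - v) * X i * xpow \<mu> - xpow \<mu> * (cst (1 - v) * A - G * B * (1 - X i))) / (1 - X i)"
    unfolding T_eq by (simp add: diff_divide_distrib)
  also have "\<dots> = cst (1 - v) * ((X i - A) / (1 - X i)) * xpow \<mu> + G * (xpow \<mu> * B)"
    using X_nz(2)[of i] by (simp add: field_simps)
  finally show ?thesis
    by (simp add: xpow_add A_def B_def x_def G_def)
qed

section \<open>Agreement with the operators of the statement on Laurent polynomials\<close>

lemma cg_formula_eq:
  "cg_formula n v g i \<mu> f = cgf i ((lookup \<mu> (i + 1) - lookup \<mu> i) mod int n) f"
proof -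
  let ?d = "lookup \<mu> (i + 1) - lookup \<mu> i"
  have g: "g (1 + ?d mod int n) = g (1 + ?d)"
    by (rule g_cong) (simp add: mod_add_right_eq)
  show ?thesis unfolding cg_formula_def cgf_def Let_def X_def g by simp
qed

lemma chi_eq_1:
  assumes "int n dvd lookup \<mu> (i + 1) - lookup \<mu> i"
  shows "chi i k \<mu> = 1"
proof -
  obtain m where m: "lookup \<mu> (i + 1) - lookup \<mu> i = int n * m"
    using assms by blast
  have "2 * pi * real k * of_int (int n * m) / real n = 2 * pi * of_int (int k * m)"
    using n_pos by (simp add: field_simps)
  then show ?thesis unfolding chi_def m by (metis cis_multiple_2pi Ints_of_int)
qed

lemma chi_lattice:
  assumes "1 \<le> i" "i \<le> r"
  shows "chi i k \<in> lattice_chars r n"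
proof -
  have "chi i k \<mu> = 1" if "\<mu> \<in> Lambda0 r n" for \<mu>
  proof -
    have "lookup \<mu> (i+1) mod int n = lookup \<mu> i mod int n"
      using that assms by (auto simp: Lambda0_def)
    then show ?thesis by (intro chi_eq_1) (simp add: mod_eq_dvd_iff)
  qed
  then show ?thesis using wchar_chi[of i k] by (auto simp: lattice_chars_def wchar_def)
qed

text \<open>The description in \<open>cg_action\<close> ranges over all decompositions. As
  \<open>tau i\<close> is additive and agrees with \<open>cg_formula\<close> on each summand, every
  decomposition gives the same value.\<close>

lemma cg_action_eq:
  assumes "1 \<le> i" "i \<le> r" "finite M" "M \<subseteq> weights r" "\<And>\<mu>. \<mu> \<in> M \<Longrightarrow> \<phi> \<mu> \<in> Kspace r n \<mu>"
  shows "cg_action r n v g i (\<Sum>\<mu>\<in>M. \<phi> \<mu>) = tau i (\<Sum>\<mu>\<in>M. \<phi> \<mu>)"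
proof -
  have *: "(\<Sum>\<mu>\<in>N. cg_formula n v g i \<mu> (\<psi> \<mu>)) = tau i (\<Sum>\<mu>\<in>N. \<psi> \<mu>)"
    if "finite N" "\<And>\<mu>. \<mu> \<in> N \<Longrightarrow> \<psi> \<mu> \<in> Kspace r n \<mu>" for N \<psi>
    using that
  proof (induction N rule: finite_induct)
    case empty
    show ?case using tau_mult[OF homog_cst, of i 0 0] by (simp add: perm_s_simps)
  next
    case (insert \<mu> N)
    have "homog i (lookup \<mu> (i + 1) - lookup \<mu> i) (\<psi> \<mu>)"
      using insert.prems[of \<mu>] chi_lattice[OF assms(1,2)] by (auto simp: Kspace_def homog_def chi_def)
    then have "tau i (\<psi> \<mu>) = cg_formula n v g i \<mu> (\<psi> \<mu>)"
      by (simp add: tau_homog cg_formula_eq)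
    with insert show ?case by (simp add: tau_add)
  qed
  show ?thesis unfolding cg_action_def
  proof (rule the_equality)
    show "\<exists>N \<psi>. finite N \<and> N \<subseteq> weights r \<and> (\<forall>\<mu>\<in>N. \<psi> \<mu> \<in> Kspace r n \<mu>) \<and>
      (\<Sum>\<mu>\<in>M. \<phi> \<mu>) = (\<Sum>\<mu>\<in>N. \<psi> \<mu>) \<and>
      tau i (\<Sum>\<mu>\<in>M. \<phi> \<mu>) = (\<Sum>\<mu>\<in>N. cg_formula n v g i \<mu> (\<psi> \<mu>))"
      by (intro exI[of _ M] exI[of _ \<phi>]) (simp add: assms *)
  next
    fix h
    assume "\<exists>N \<psi>. finite N \<and> N \<subseteq> weights r \<and> (\<forall>\<mu>\<in>N. \<psi> \<mu> \<in> Kspace r n \<mu>) \<and>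
      (\<Sum>\<mu>\<in>M. \<phi> \<mu>) = (\<Sum>\<mu>\<in>N. \<psi> \<mu>) \<and> h = (\<Sum>\<mu>\<in>N. cg_formula n v g i \<mu> (\<psi> \<mu>))"
    then obtain N \<psi> where N: "finite N" "\<forall>\<mu>\<in>N. \<psi> \<mu> \<in> Kspace r n \<mu>"
      "(\<Sum>\<mu>\<in>M. \<phi> \<mu>) = (\<Sum>\<mu>\<in>N. \<psi> \<mu>)" "h = (\<Sum>\<mu>\<in>N. cg_formula n v g i \<mu> (\<psi> \<mu>))"
      by blast
    show "h = tau i (\<Sum>\<mu>\<in>M. \<phi> \<mu>)"
      unfolding N(3,4) using N(1,2) by (intro *) auto
  qed
qed

text \<open>The Laurent polynomials in x_1, ..., x_(r+1) as elements of the field: a domain on which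
  \<open>cg_action\<close> is known and which the operators preserve. Generation term by term
  reduces linear identities to monomials.\<close>

inductive_set laur :: "nat \<Rightarrow> ratfun set" for r where
  zero: "0 \<in> laur r"
| step: "\<mu> \<in> weights r \<Longrightarrow> f \<in> laur r \<Longrightarrow> cst c * xpow \<mu> + f \<in> laur r"

lemma laur_add: "f \<in> laur r \<Longrightarrow> h \<in> laur r \<Longrightarrow> f + h \<in> laur r"
  by (induction f rule: laur.induct) (auto simp: add.assoc intro: laur.intros)

lemma laur_cst_xpow: "\<mu> \<in> weights r \<Longrightarrow> cst c * xpow \<mu> \<in> laur r"
  using laur.step[OF _ laur.zero] by simp

lemma laur_xpow: "\<mu> \<in> weights r \<Longrightarrow> xpow \<mu> \<in> laur r"
  using laur_cst_xpow[of \<mu> r 1] by simp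

lemma laur_cst: "f \<in> laur r \<Longrightarrow> cst c * f \<in> laur r"
  by (induction f rule: laur.induct)
    (auto simp: distrib_left mult.assoc[symmetric] cst_mult[symmetric] intro: laur.intros)

lemma laur_sum: "(\<And>a. a \<in> A \<Longrightarrow> f a \<in> laur r) \<Longrightarrow> sum f A \<in> laur r"
  by (induction A rule: infinite_finite_induct) (auto intro: laur.zero laur_add)

lemma laur_decomp:
  assumes "f \<in> laur r"
  shows "\<exists>M c. finite M \<and> M \<subseteq> weights r \<and> f = (\<Sum>\<mu>\<in>M. cst (c \<mu>) * xpow \<mu>)"
  using assms
proof (induction f rule: laur.induct)
  case zero
  show ?case by (intro exI[of _ "{}"]) simp
next
  case (step \<mu> f a)
  then obtain M c where M: "finite M" "M \<subseteq> weights r" "f = (\<Sum>\<mu>\<in>M. cst (c \<mu>) * xpow \<mu>)" by blast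
  let ?c = "c(\<mu> := a + (if \<mu> \<in> M then c \<mu> else 0))"
  have "cst a * xpow \<mu> + f = cst (?c \<mu>) * xpow \<mu> + (\<Sum>\<nu>\<in>M - {\<mu>}. cst (c \<nu>) * xpow \<nu>)"
    using M by (cases "\<mu> \<in> M") (auto simp: sum.remove cst_add distrib_right)
  also have "\<dots> = (\<Sum>\<nu>\<in>insert \<mu> M. cst (?c \<nu>) * xpow \<nu>)"
    using M by (simp add: sum.insert_remove)
  finally show ?case using M step.hyps by (intro exI[of _ "insert \<mu> M"] exI[of _ ?c]) auto
qed

lemma xpow_Kspace:
  assumes "\<mu> \<in> weights r"
  shows "cst c * xpow \<mu> \<in> Kspace r n \<mu>"
proof -
  have "cst c * xpow \<mu> \<in> ratfuns r"
    unfolding ratfuns_def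
    using assms by (intro CollectI exI[of _ "single \<mu> c"] exI[of _ "1::laurent"])
      (auto simp: cst_def xpow_def mult_single weights_def)
  moreover have "tw \<xi> (cst c * xpow \<mu>) = cst (\<xi> \<mu>) * (cst c * xpow \<mu>)" if "\<xi> \<in> lattice_chars r n" for \<xi>
  proof -
    have "wchar \<xi>" using that by (auto simp: lattice_chars_def wchar_def Lambda0_def weights_def)
    then show ?thesis by (simp add: tw_simps tw_cst tw_xpow)
  qed
  ultimately show ?thesis by (simp add: Kspace_def)
qed

lemma demazure_lusztig_eq:
  assumes "1 \<le> i" "i \<le> r" "f \<in> laur r"
  shows "demazure_lusztig r n v g i f = T i f"
proof -
  obtain M c where M: "finite M" "M \<subseteq> weights r" "f = (\<Sum>\<mu>\<in>M. cst (c \<mu>) * xpow \<mu>)"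
    using laur_decomp[OF assms(3)] by blast
  have "cg_action r n v g i f = tau i f"
    unfolding M(3) using M(1,2) by (intro cg_action_eq assms) (auto intro: xpow_Kspace)
  then show ?thesis by (simp add: demazure_lusztig_def demazure_def T_def X_def)
qed

section \<open>The Hecke relations\<close>

lemma geo_sum:
  assumes "a \<le> c + 1"
  shows "(\<Sum>k = a..c. xpow (kalpha (int n * k) i)) * (1 - X i) =
    xpow (kalpha (int n * a) i) - xpow (kalpha (int n * (c + 1)) i)"
proof -
  have "(\<Sum>k = a..e - 1. xpow (kalpha (int n * k) i)) * (1 - X i) =
    xpow (kalpha (int n * a) i) - xpow (kalpha (int n * e) i)" if "a \<le> e" for e
    using that
  proof (induction e rule: int_ge_induct)
    case (step e)
    have "{a..e + 1 - 1} = insert e {a..e - 1}" using step.hyps by auto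
    then have "(\<Sum>k = a..e + 1 - 1. xpow (kalpha (int n * k) i)) * (1 - X i) =
      xpow (kalpha (int n * e) i) * (1 - X i) + (\<Sum>k = a..e - 1. xpow (kalpha (int n * k) i)) * (1 - X i)"
      by (simp add: distrib_right)
    also have "xpow (kalpha (int n * e) i) * (1 - X i) =
        xpow (kalpha (int n * e) i) - xpow (kalpha (int n * (e + 1)) i)"
      by (simp add: X_def right_diff_distrib distrib_left kalpha_add xpow_add)
    finally show ?case using step.IH by simp
  qed simp
  from this[of "c + 1"] assms show ?thesis by simp
qed

text \<open>For negative m the numerator is a geometric difference in the reverse order, whence the
  sign. The values 0 for m = 0 and -1 for m = -1 are the only ones met in the box.\<close>

lemma geo_quot:
  "(X i - xpow (kalpha (int n * (m + 1)) i)) / (1 - X i) =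
   (if m \<ge> 0 then (\<Sum>k = 1..m. xpow (kalpha (int n * k) i))
    else - (\<Sum>k = m + 1..0. xpow (kalpha (int n * k) i)))"
proof (cases "m \<ge> 0")
  case True
  then have "X i - xpow (kalpha (int n * (m + 1)) i) = (\<Sum>k = 1..m. xpow (kalpha (int n * k) i)) * (1 - X i)"
    using geo_sum[of 1 m i] by (simp add: X_def)
  then show ?thesis using True X_nz(2)[of i] by (simp only: nonzero_mult_div_cancel_right if_True not_False_eq_True)
next
  case False
  then have "X i - xpow (kalpha (int n * (m + 1)) i) =
      - (\<Sum>k = m + 1..0. xpow (kalpha (int n * k) i)) * (1 - X i)"
    using geo_sum[of "m + 1" 0 i] by (simp add: X_def)
  then show ?thesis using False X_nz(2)[of i] by (simp only: nonzero_mult_div_cancel_right if_False not_False_eq_True)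
qed

text \<open>The geometric sum runs over k up to (D - 1) div n, that is, over the multiples G = n k
  with G < D. On 1 \<le> G < D this is precisely the support of \<open>hflat\<close>, whose value
  there is 1 - v.\<close>

lemma T_xpow_pos:
  assumes D: "D = lookup \<mu> (i + 1) - lookup \<mu> i + 1" "D \<ge> 1"
  shows "T i (xpow \<mu>) = (\<Sum>G = 1..D. cst (if G < D then hflat n v G else gflat v g G) * xpow (\<mu> + kalpha G i))"
proof -
  define m where "m = (D - 1) div int n"
  have m: "m \<ge> 0" using n_pos D(2) by (simp add: m_def pos_imp_zdiv_nonneg_iff)
  have im: "{G \<in> {1..D-1}. int n dvd G} = (\<lambda>k. int n * k) ` {1..m}"
  proof (intro equalityI subsetI)
    fix G assume "G \<in> {G \<in> {1..D-1}. int n dvd G}"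
    then obtain k where k: "G = int n * k" "1 \<le> G" "G \<le> D - 1" by auto
    have "k \<ge> 1" using k(1,2) n_pos mult_nonneg_nonpos[of "int n" k] by linarith
    moreover have "k \<le> m" 
      using zdiv_mono1[OF k(3), of "int n"] n_pos by (simp add: m_def k(1))
    ultimately show "G \<in> (\<lambda>k. int n * k) ` {1..m}" using k by auto
  next
    fix G assume "G \<in> (\<lambda>k. int n * k) ` {1..m}"
    then have "\<exists>k. G = int n * k \<and> 1 \<le> k \<and> k \<le> m" by auto
    then obtain k where k: "G = int n * k" "1 \<le> k" "k \<le> m" by blast
    have "int n * k \<le> int n * m" using k by (simp add: mult_left_mono)
    also have "\<dots> \<le> D - 1" using mult_div_mod_eq[of "int n" "D - 1"] pos_mod_sign[of "int n" "D - 1"] n_pos unfolding m_def by linarith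
    finally show "G \<in> {G \<in> {1..D-1}. int n dvd G}"
      using k n_pos by (auto intro: order_trans[OF _ mult_mono[of 1 "int n" 1 k]])
  qed
  have "(\<Sum>G = 1..D. cst (if G < D then hflat n v G else gflat v g G) * xpow (\<mu> + kalpha G i)) =
     (\<Sum>G \<in> insert D {1..D-1}. cst (if G < D then hflat n v G else gflat v g G) * xpow (\<mu> + kalpha G i))"
    using D(2) by (intro sum.cong) auto
  also have "\<dots> = cst (gflat v g D) * xpow (\<mu> + kalpha D i) +
     (\<Sum>G = 1..D-1. cst (hflat n v G) * xpow (\<mu> + kalpha G i))"
    by simp
  also have "(\<Sum>G = 1..D-1. cst (hflat n v G) * xpow (\<mu> + kalpha G i)) =
     (\<Sum>G \<in> {G \<in> {1..D-1}. int n dvd G}. cst (1 - v) * xpow (\<mu> + kalpha G i))"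
    by (subst sum.inter_filter) (auto intro!: sum.cong simp: hflat_def)
  also have "\<dots> = (\<Sum>k = 1..m. cst (1 - v) * xpow (\<mu> + kalpha (int n * k) i))"
    unfolding im using n_pos by (subst sum.reindex) (auto simp: inj_on_def)
  also have "\<dots> = cst (1 - v) * (\<Sum>k = 1..m. xpow (kalpha (int n * k) i)) * xpow \<mu>"
    by (simp add: xpow_add sum_distrib_left sum_distrib_right mult_ac)
  also have "(\<Sum>k = 1..m. xpow (kalpha (int n * k) i)) = (X i - xpow (kalpha (int n * (m + 1)) i)) / (1 - X i)"
    using m by (simp add: geo_quot)
  finally have eq: "(\<Sum>G = 1..D. cst (if G < D then hflat n v G else gflat v g G) * xpow (\<mu> + kalpha G i)) =
    cst (gflat v g D) * xpow (\<mu> + kalpha D i) +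
    cst (1 - v) * ((X i - xpow (kalpha (int n * (m + 1)) i)) / (1 - X i)) * xpow \<mu>" .
  have d: "lookup \<mu> (i + 1) - lookup \<mu> i = D - 1" using D by simp
  show ?thesis unfolding T_xpow d eq m_def by (simp add: add.commute)
qed

text \<open>The geometric quotient contributes -(1 - v) and \<open>gflat\<close> at 0 contributes
  -v, on the same monomial.\<close>

lemma T_xpow_0:
  assumes "lookup \<mu> (i + 1) - lookup \<mu> i + 1 = 0"
  shows "T i (xpow \<mu>) = - xpow \<mu>"
proof -
  have d: "lookup \<mu> (i + 1) - lookup \<mu> i = -1" using assms by simp
  have m: "(-1) div int n = -1" using n_pos int_div_pos_eq[of "-1" "int n" "-1" "int n - 1"] by simp
  have q: "(X i - xpow (kalpha (int n * (-1 + 1)) i)) / (1 - X i) = -1"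
    unfolding geo_quot by simp
  show ?thesis unfolding T_xpow d m q
    by (simp add: gflat_def g_dvd cst_diff cst_uminus algebra_simps)
qed

text \<open>The number (1 - v) ((D - 1) div n) for |D| < n, where the quotient is 0 or -1.\<close>

definition box_coeff :: "int \<Rightarrow> complex" where
  "box_coeff D = (if D \<le> 0 then - (1 - v) else 0)"

lemma T_xpow_box:
  assumes D: "D = lookup \<mu> (i + 1) - lookup \<mu> i + 1" "\<bar>D\<bar> < int n"
  shows "T i (xpow \<mu>) = cst (box_coeff D) * xpow \<mu> + cst (gflat v g D) * xpow (\<mu> + kalpha D i)"
proof -
  have d: "lookup \<mu> (i + 1) - lookup \<mu> i = D - 1" using D by simp
  have m: "(D - 1) div int n = (if D \<le> 0 then - 1 else 0)"
    using D(2) int_div_pos_eq[of "D - 1" "int n" "- 1" "D - 1 + int n"] by (auto simp: zdiv_eq_0_iff)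
  have q: "(X i - xpow (kalpha (int n * ((if D \<le> 0 then - 1 else 0) + 1)) i)) / (1 - X i) = (if D \<le> 0 then -1 else 0)"
    unfolding geo_quot by simp
  show ?thesis unfolding T_xpow d m q
    by (simp add: box_coeff_def cst_diff)
qed

lemma T_laur:
  assumes "f \<in> laur r" "1 \<le> i" "i \<le> r"
  shows "T i f \<in> laur r"
  using assms(1)
proof (induction f rule: laur.induct)
  case zero
  then show ?case by (simp add: laur.zero)
next
  case (step \<mu> f c)
  have ka: "\<mu> + kalpha k i \<in> weights r" for k
    using step.hyps assms(2,3) by (auto simp: weights_def in_keys_iff lookup_add lookup_kalpha split: if_splits)
  have lm: "cst a * (xpow (kalpha k i) * xpow \<mu>) \<in> laur r" for a k
    using laur_cst_xpow[OF ka, of a k] by (simp add: xpow_add mult_ac)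
  have "cst (1 - v) * ((X i - xpow (kalpha (int n * (m + 1)) i)) / (1 - X i)) * xpow \<mu> \<in> laur r" for m
  proof -
    have "(X i - xpow (kalpha (int n * (m + 1)) i)) / (1 - X i) * xpow \<mu> \<in> laur r"
      using lm[of 1] lm[of "-1"]
      by (auto simp: geo_quot sum_distrib_right sum_negf[symmetric] cst_uminus intro!: laur_sum simp del: sum_negf)
    from laur_cst[OF this] show ?thesis by (simp only: mult.assoc)
  qed
  then have "T i (xpow \<mu>) \<in> laur r"
    unfolding T_xpow by (intro laur_add laur_cst_xpow ka)
  with step show ?case by (simp add: T_add T_cst laur_add laur_cst)
qed

lemma T_cst': "T i (h * cst c) = cst c * T i h"
  using T_cst[of i c h] by (simp add: mult.commute)

lemma T_cst_cst: "T i (h * (cst c * cst d)) = cst c * cst d * T i h"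
  using T_cst'[of i h "c * d"] by (simp add: cst_mult)

lemma laur_linear_eq:
  assumes "f \<in> laur r"
    and "\<And>f h. A (f + h) = A f + A h" "\<And>c f. A (cst c * f) = cst c * A f"
    and "\<And>f h. B (f + h) = B f + B h" "\<And>c f. B (cst c * f) = cst c * B f"
    and "\<And>\<mu>. \<mu> \<in> weights r \<Longrightarrow> A (xpow \<mu>) = B (xpow \<mu>)"
  shows "A f = (B f :: ratfun)"
  using assms(1)
proof (induction f rule: laur.induct)
  case zero
  then show ?case using assms(3)[of 0 0] assms(5)[of 0 0] by simp
next
  case (step \<mu> f c)
  then show ?case by (simp add: assms)
qed

text \<open>These stand for the rational functions in the n-th powers of the variables. Invariance
  under characters, in place of generators, makes closure under field operations and permutations
  immediate.\<close>

definition ninv :: "ratfun set" where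
  "ninv = {f. \<forall>\<xi>. wchar \<xi> \<longrightarrow> (\<forall>\<mu>. (\<forall>j. int n dvd lookup \<mu> j) \<longrightarrow> \<xi> \<mu> = 1) \<longrightarrow> tw \<xi> f = f}"

lemma ninv_simps:
  assumes "f \<in> ninv" "h \<in> ninv"
  shows "f + h \<in> ninv" "f - h \<in> ninv" "f * h \<in> ninv" "f / h \<in> ninv" "- f \<in> ninv"
  using assms by (auto simp: ninv_def tw_simps)

lemma ninv_1: "1 \<in> ninv"
  by (auto simp: ninv_def tw_simps)

lemma ninv_xpow: "(\<And>j. int n dvd lookup \<mu> j) \<Longrightarrow> xpow \<mu> \<in> ninv"
  by (auto simp: ninv_def tw_xpow)

lemma ninv_X: "X i \<in> ninv"
  unfolding X_def by (rule ninv_xpow) (simp add: lookup_kalpha)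

lemma ninv_perm: "f \<in> ninv \<Longrightarrow> perm_s i f \<in> ninv"
  unfolding ninv_def using tw_perm_s by (auto simp: lookup_push_sigma)

lemma ninv_D: "f \<in> ninv \<Longrightarrow> Dm i f \<in> ninv"
  unfolding Dm_def by (intro ninv_simps ninv_X ninv_perm ninv_1)

lemma ninv_homog:
  assumes "f \<in> ninv"
  shows "homog i 0 f"
proof -
  have "chi i k \<mu> = 1" if "\<forall>j. int n dvd lookup \<mu> j" for \<mu> k
    using that by (intro chi_eq_1) simp
  then show ?thesis using assms wchar_chi by (auto simp: ninv_def homog_def)
qed

lemma T_ninv: "f \<in> ninv \<Longrightarrow> T i (f * h) = perm_s i f * T i h + cst (1 - v) * Dm i f * h"
  by (simp add: T_mult ninv_homog)

lemma perm_s_X: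
  "perm_s i (X i) = inverse (X i)"
  "perm_s i (X (Suc i)) = X i * X (Suc i)"
  "perm_s (Suc i) (X i) = X i * X (Suc i)"
proof -
  have 1: "push (sigma i) (kalpha (int n) i) = - kalpha (int n) i"
    "push (sigma i) (kalpha (int n) (Suc i)) = kalpha (int n) i + kalpha (int n) (Suc i)"
    "push (sigma (Suc i)) (kalpha (int n) i) = kalpha (int n) i + kalpha (int n) (Suc i)"
    unfolding push_sigma by (intro poly_mapping_eqI; simp add: lookup_add lookup_kalpha)+
  show "perm_s i (X i) = inverse (X i)" "perm_s i (X (Suc i)) = X i * X (Suc i)"
    "perm_s (Suc i) (X i) = X i * X (Suc i)"
    unfolding X_def perm_s_xpow 1 by (simp_all add: xpow_add xpow_uminus)
qed

text \<open>Each shifted entry mu_j + j is reduced modulo n, for the three positions that one braid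
  relation involves. The summand j accounts for the 1 in the shifted difference beta_(j+1) - beta_j
  + 1 and for the 2 at distance two.\<close>

lemma box_decomp:
  obtains \<eta> \<beta> where "\<mu> = \<eta> + \<beta>" "\<And>j. int n dvd lookup \<eta> j"
    "\<And>j k. j \<in> {i..i+2} \<Longrightarrow> k \<in> {i..i+2} \<Longrightarrow>
      \<bar>lookup \<beta> j + int j - (lookup \<beta> k + int k)\<bar> < int n"
proof
  define \<eta> :: weight where "\<eta> = (\<Sum>j = i..i+2. single j (int n * ((lookup \<mu> j + int j) div int n)))"
  have l: "lookup \<eta> j = (if j \<in> {i..i+2} then int n * ((lookup \<mu> j + int j) div int n) else 0)" for j
    unfolding \<eta>_def by (simp add: lookup_sum lookup_single when_def del: sum.cl_ivl_Suc)
  show "\<mu> = \<eta> + (\<mu> - \<eta>)" by simp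
  show "int n dvd lookup \<eta> j" for j by (simp add: l)
  have m: "lookup (\<mu> - \<eta>) j + int j = (lookup \<mu> j + int j) mod int n" if "j \<in> {i..i+2}" for j
    using that by (simp add: lookup_minus l minus_div_mult_eq_mod[symmetric] mult.commute)
  show "\<bar>lookup (\<mu> - \<eta>) j + int j - (lookup (\<mu> - \<eta>) k + int k)\<bar> < int n"
    if "j \<in> {i..i+2}" "k \<in> {i..i+2}" for j k
  proof -
    have "0 \<le> a mod int n" "a mod int n < int n" for a using n_pos by simp_all
    then show ?thesis unfolding m[OF that(1)] m[OF that(2)] by (smt (verit))
  qed
qed

section \<open>The quadratic relation\<close>

lemma gflat_mult:
  assumes "\<bar>d\<bar> < int n" "d \<noteq> 0"
  shows "gflat v g d * gflat v g (- d) = v" "gflat v g (- d) * gflat v g d = v"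
proof -
  have "\<not> int n dvd d" using assms zdvd_not_zless[of "\<bar>d\<bar>" "int n"] by auto
  from g_not_dvd[OF this] v_nz show "gflat v g d * gflat v g (- d) = v" by (simp add: gflat_def field_simps)
  then show "gflat v g (- d) * gflat v g d = v" by (simp add: mult.commute)
qed

lemma gflat_0: "gflat v g 0 = - v"
  by (simp add: gflat_def g_dvd)

text \<open>The shifted difference d changes sign from mu to nu, so T_i acts on the span of the two
  monomials. For d \<noteq> 0 its matrix has trace -(1 - v), because exactly one diagonal entry is
  nonzero, and determinant -v, because the off-diagonal entries multiply to v. For d = 0 the
  monomials coincide and T_i is -1.\<close>

lemma T_quadratic_box:
  assumes "\<bar>lookup \<mu> (i + 1) - lookup \<mu> i + 1\<bar> < int n"
  shows "T i (T i (xpow \<mu>)) = cst v * xpow \<mu> - cst (1 - v) * T i (xpow \<mu>)"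
proof -
  define d where "d = lookup \<mu> (i + 1) - lookup \<mu> i + 1"
  define \<nu> where "\<nu> = \<mu> + kalpha d i"
  have \<mu>: "\<mu> = \<nu> + kalpha (- d) i" by (simp add: \<nu>_def kalpha_uminus)
  have 1: "T i (xpow \<mu>) = cst (box_coeff d) * xpow \<mu> + cst (gflat v g d) * xpow \<nu>"
    using assms unfolding \<nu>_def d_def by (rule T_xpow_box[OF refl])
  have "T i (xpow \<nu>) = cst (box_coeff (- d)) * xpow \<nu> + cst (gflat v g (- d)) * xpow (\<nu> + kalpha (- d) i)"
    using assms by (intro T_xpow_box) (simp_all add: \<nu>_def lookup_add lookup_kalpha d_def)
  then have 2: "T i (xpow \<nu>) = cst (box_coeff (- d)) * xpow \<nu> + cst (gflat v g (- d)) * xpow \<mu>"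
    by (simp add: \<mu>[symmetric])
  have *: "T i (T i (xpow \<mu>)) = cst (box_coeff d * box_coeff d + gflat v g d * gflat v g (- d)) * xpow \<mu> +
     cst (gflat v g d * (box_coeff d + box_coeff (- d))) * xpow \<nu>"
    unfolding 1 unfolding T_add T_cst unfolding 1 2 by (simp add: cst_add cst_mult algebra_simps)
  show ?thesis
  proof (cases "d = 0")
    case True
    then have "\<nu> = \<mu>" by (simp add: \<nu>_def)
    then show ?thesis using True unfolding * unfolding 1
      by (simp add: box_coeff_def gflat_0 cst_mult cst_add cst_diff cst_uminus algebra_simps)
  next
    case False
    have p1: "box_coeff d + box_coeff (- d) = - (1 - v)" using False by (auto simp: box_coeff_def)
    have p2: "box_coeff d * box_coeff d = - (1 - v) * box_coeff d" by (simp add: box_coeff_def)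
    have p3: "gflat v g d * gflat v g (- d) = v"
      using False assms by (intro gflat_mult) (simp_all add: d_def)
    show ?thesis unfolding * p1 p2 p3 unfolding 1
      by (simp add: cst_mult cst_add cst_diff cst_uminus algebra_simps)
  qed
qed

text \<open>The Leibniz rule \<open>T_ninv\<close> is used twice, with E the divided difference of
  f. The reflection sends X_i E to E, so the mixed terms recombine to the coefficient s_i f of T_i
  h.\<close>

lemma T_quadratic_mult:
  assumes f: "f \<in> ninv" and h: "T i (T i h) = cst v * h - cst (1 - v) * T i h"
  shows "T i (T i (f * h)) = cst v * (f * h) - cst (1 - v) * T i (f * h)"
proof -
  define b where "b = cst (1 - v)"
  define E where "E = (f - perm_s i f) / (1 - X i)"
  have D1: "Dm i f = X i * E" by (simp add: Dm_def E_def)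
  have D2: "Dm i (perm_s i f) = - (X i * E)"
    by (simp add: Dm_def E_def perm_s_perm_s minus_divide_left[symmetric] flip: minus_divide_left) (simp add: algebra_simps diff_divide_distrib)
  have fE: "f - perm_s i f = E * (1 - X i)" using X_nz(2)[of i] by (simp add: E_def)
  have s1: "perm_s i (X i * E) = E"
    using X_nz[of i] by (simp add: E_def perm_s_simps perm_s_X perm_s_perm_s divide_simps) (simp add: algebra_simps)
  have D3: "Dm i (X i * E) = - (X i * E)"
    using X_nz(2)[of i] by (simp add: Dm_def s1 divide_simps) (simp add: algebra_simps)
  have XE: "X i * E \<in> ninv" using ninv_D[OF f, of i] by (simp add: D1)
  have "T i (T i (f * h)) = T i (perm_s i f * T i h) + b * T i ((X i * E) * h)"
    by (simp add: T_ninv[OF f] D1 T_add b_def mult.assoc T_cst)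
  also have "\<dots> = f * T i (T i h) - b * (X i * E) * T i h + b * (E * T i h - b * (X i * E) * h)"
    unfolding T_ninv[OF ninv_perm[OF f]] T_ninv[OF XE] D2 D3 s1 perm_s_perm_s b_def by simp
  also have "\<dots> = cst v * (f * h) - b * ((f - E * (1 - X i)) * T i h + b * (X i * E) * h)"
    by (simp add: h b_def[symmetric] algebra_simps)
  also have "f - E * (1 - X i) = perm_s i f" by (simp add: fE[symmetric])
  finally show ?thesis by (simp add: T_ninv[OF f] D1 b_def)
qed

lemma T_quadratic:
  assumes "f \<in> laur r"
  shows "T i (T i f) = cst v * f - cst (1 - v) * T i f"
  using assms
proof (rule laur_linear_eq)
  fix \<mu>
  obtain \<eta> \<beta> where *: "\<mu> = \<eta> + \<beta>" "\<And>j. int n dvd lookup \<eta> j"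
    "\<And>j k. j \<in> {i..i+2} \<Longrightarrow> k \<in> {i..i+2} \<Longrightarrow>
      \<bar>lookup \<beta> j + int j - (lookup \<beta> k + int k)\<bar> < int n"
    using box_decomp[of \<mu> i] by blast
  show "T i (T i (xpow \<mu>)) = cst v * xpow \<mu> - cst (1 - v) * T i (xpow \<mu>)"
    unfolding *(1) xpow_add using *(3)[of "i+1" i]
    by (intro T_quadratic_mult ninv_xpow *(2) T_quadratic_box) (simp add: algebra_simps)
qed (simp_all add: T_add T_cst right_diff_distrib distrib_left mult.left_commute)

section \<open>Commutation of distant operators\<close>

lemma perm_s_commute:
  assumes "i + 1 < j \<or> j + 1 < i"
  shows "perm_s i (xpow (kalpha k j)) = xpow (kalpha k j)" "homog i 0 (xpow (kalpha k j))"
  using assms homog_xpow[of i "kalpha k j"] by (auto simp: perm_s_xpow push_sigma lookup_kalpha)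

lemma fixed_closed:
  assumes "homog i 0 f" "perm_s i f = f" "homog i 0 h" "perm_s i h = h"
  shows "homog i 0 (f + h) \<and> perm_s i (f + h) = f + h" "homog i 0 (f - h) \<and> perm_s i (f - h) = f - h"
    "homog i 0 (f * h) \<and> perm_s i (f * h) = f * h" "homog i 0 (f / h) \<and> perm_s i (f / h) = f / h"
  using assms by (auto simp: homog_def tw_simps[OF wchar_chi] perm_s_simps)

text \<open>On the given monomial each T_j is multiplication by a function C_j of x_j / x_(j+1). For
  distant i this function has degree zero and is fixed by sigma_i, so T_i is linear over it.\<close>

lemma T_commute:
  assumes "f \<in> laur r" and ij: "i + 1 < j \<or> j + 1 < i"
  shows "T i (T j f) = T j (T i f)"
  using assms(1)
proof (rule laur_linear_eq)
  fix \<mu>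
  define C where "C i = (let d = lookup \<mu> (i + 1) - lookup \<mu> i in
    cst (1 - v) * ((X i - xpow (kalpha (int n * (d div int n + 1)) i)) / (1 - X i))
     + cst (gflat v g (d + 1)) * xpow (kalpha (d + 1) i))" for i
  have T: "T i (xpow \<mu>) = C i * xpow \<mu>" for i
    unfolding T_xpow C_def Let_def by (simp add: xpow_add algebra_simps)
  have C: "homog i 0 (C j) \<and> perm_s i (C j) = C j" if "i + 1 < j \<or> j + 1 < i" for i j
  proof -
    have x: "homog i 0 (xpow (kalpha k j)) \<and> perm_s i (xpow (kalpha k j)) = xpow (kalpha k j)" for k
      using perm_s_commute[OF that] by simp
    have c: "homog i 0 (cst c) \<and> perm_s i (cst c) = cst c" for c by (simp add: homog_cst perm_s_cst)
    \<comment> \<open>Reading 1 as \<open>cst 1\<close> exhibits C_j as built from constants and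
      monomials by field operations alone.\<close>
    show ?thesis unfolding C_def Let_def X_def cst_1[symmetric]
      using fixed_closed x c by (metis (no_types, lifting))
  qed
  show "T i (T j (xpow \<mu>)) = T j (T i (xpow \<mu>))"
    using C[of i j] C[of j i] ij by (auto simp: T[of j] T[of i] T_fixed mult_ac)
qed (simp_all add: T_add T_cst)

section \<open>The braid relation\<close>

lemma cst_2: "cst (a * 2) = cst a * 2"
  using cst_add[of a a] by (simp add: mult_2_right)

text \<open>Both sides lie in the span of at most six monomials, the orbit of mu under the shifted
  action of S_3, written in coordinates along alpha_i and alpha_(i+1). The bound on d1 + d2 keeps
  the difference seen by the middle operator in the box.\<close>

lemma T_braid_box:
  assumes "\<bar>lookup \<mu> (i + 1) - lookup \<mu> i + 1\<bar> < int n"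
    "\<bar>lookup \<mu> (i + 2) - lookup \<mu> (i + 1) + 1\<bar> < int n"
    "\<bar>lookup \<mu> (i + 2) - lookup \<mu> i + 2\<bar> < int n"
  shows "T i (T (Suc i) (T i (xpow \<mu>))) = T (Suc i) (T i (T (Suc i) (xpow \<mu>)))"
proof -
  define d1 where "d1 = lookup \<mu> (i + 1) - lookup \<mu> i + 1"
  define d2 where "d2 = lookup \<mu> (i + 2) - lookup \<mu> (i + 1) + 1"
  have dd: "\<bar>d1\<bar> < int n" "\<bar>d2\<bar> < int n" "\<bar>d1 + d2\<bar> < int n" using assms by (simp_all add: d1_def d2_def)
  define e where "e j k = xpow (\<mu> + kalpha j i + kalpha k (Suc i))" for j k
  have T1: "T i (e j k) = cst (box_coeff (d1 + k - 2 * j)) * e j k + cst (gflat v g (d1 + k - 2 * j)) * e (d1 + k - j) k"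
    if "\<bar>d1 + k - 2 * j\<bar> < int n" for j k
  proof -
    have "\<mu> + kalpha j i + kalpha k (Suc i) + kalpha (d1 + k - 2 * j) i = \<mu> + kalpha (d1 + k - j) i + kalpha k (Suc i)"
      by (intro poly_mapping_eqI) (simp only: lookup_add lookup_kalpha, simp)
    moreover have "T i (e j k) = cst (box_coeff (d1 + k - 2 * j)) * e j k +
        cst (gflat v g (d1 + k - 2 * j)) * xpow (\<mu> + kalpha j i + kalpha k (Suc i) + kalpha (d1 + k - 2 * j) i)"
      unfolding e_def using that by (intro T_xpow_box) (simp_all add: lookup_add lookup_kalpha d1_def)
    ultimately show ?thesis by (simp only: e_def)
  qed
  have T2: "T (Suc i) (e j k) = cst (box_coeff (d2 + j - 2 * k)) * e j k + cst (gflat v g (d2 + j - 2 * k)) * e j (d2 + j - k)"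
    if "\<bar>d2 + j - 2 * k\<bar> < int n" for j k
  proof -
    have "\<mu> + kalpha j i + kalpha k (Suc i) + kalpha (d2 + j - 2 * k) (Suc i) = \<mu> + kalpha j i + kalpha (d2 + j - k) (Suc i)"
      by (intro poly_mapping_eqI) (simp only: lookup_add lookup_kalpha, simp)
    moreover have "T (Suc i) (e j k) = cst (box_coeff (d2 + j - 2 * k)) * e j k +
        cst (gflat v g (d2 + j - 2 * k)) * xpow (\<mu> + kalpha j i + kalpha k (Suc i) + kalpha (d2 + j - 2 * k) (Suc i))"
      unfolding e_def using that by (intro T_xpow_box) (simp_all add: lookup_add lookup_kalpha d2_def)
    ultimately show ?thesis by (simp only: e_def)
  qed
  let ?p = box_coeff and ?q = "gflat v g"
  have L: "T i (T (Suc i) (T i (e 0 0))) =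
    cst (?q d1 * ?p (d1 + d2) * ?p (- d1) + ?p d1 * ?p d2 * ?q d1) * e d1 0 +
    cst (?q d1 * ?q (- d1) * ?p (d1 + d2) + ?p d1 * ?p d2 * ?p d1) * e 0 0 +
    cst (?q d1 * ?q (d1 + d2) * ?p d2) * e d1 (d1 + d2) +
    cst (?q d1 * ?q (d1 + d2) * ?q d2) * e (d1 + d2) (d1 + d2) +
    cst (?p d1 * ?q d2 * ?p (d1 + d2)) * e 0 d2 +
    cst (?p d1 * ?q d2 * ?q (d1 + d2)) * e (d1 + d2) d2"
    using dd by (simp add: T1 T2 T_add T_cst T_cst' T_cst_cst cst_add cst_mult algebra_simps)
  have R: "T (Suc i) (T i (T (Suc i) (e 0 0))) =
    cst (?q d2 * ?p (d1 + d2) * ?p (- d2) + ?p d2 * ?p d1 * ?q d2) * e 0 d2 +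
    cst (?q d2 * ?q (- d2) * ?p (d1 + d2) + ?p d2 * ?p d1 * ?p d2) * e 0 0 +
    cst (?q d2 * ?q (d1 + d2) * ?p d1) * e (d1 + d2) d2 +
    cst (?q d2 * ?q (d1 + d2) * ?q d1) * e (d1 + d2) (d1 + d2) +
    cst (?p d2 * ?q d1 * ?p (d1 + d2)) * e d1 0 +
    cst (?p d2 * ?q d1 * ?q (d1 + d2)) * e d1 (d1 + d2)"
    using dd by (simp add: T1 T2 T_add T_cst T_cst' T_cst_cst cst_add cst_mult algebra_simps)
  have "T i (T (Suc i) (T i (e 0 0))) = T (Suc i) (T i (T (Suc i) (e 0 0)))"
  proof -
    consider "d1 = 0" "d2 = 0" | "d1 = 0" "d2 \<noteq> 0" | "d1 \<noteq> 0" "d2 = 0" | "d1 \<noteq> 0" "d2 \<noteq> 0" by blast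
    then show ?thesis
    proof cases
      \<comment> \<open>The sum d1 + d2 may vanish here: the three identities between box
        coefficients hold in that case too, and the comparison is made coefficient by
        coefficient.\<close>
      case 4
      have "?p (d1 + d2) * ?p (- d1) + ?p d1 * ?p d2 = ?p d2 * ?p (d1 + d2)"
        "?p (d1 + d2) * ?p (- d2) + ?p d2 * ?p d1 = ?p d1 * ?p (d1 + d2)"
        "v * ?p (d1 + d2) + ?p d1 * ?p d2 * ?p d1 = v * ?p (d1 + d2) + ?p d2 * ?p d1 * ?p d2"
        using 4 by (auto simp: box_coeff_def)
      note c = this
      have "?q d1 * ?p (d1 + d2) * ?p (- d1) + ?p d1 * ?p d2 * ?q d1 = ?p d2 * ?q d1 * ?p (d1 + d2)"
        using arg_cong[OF c(1), of "\<lambda>x. ?q d1 * x"] by (simp add: algebra_simps)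
      moreover have "?q d2 * ?p (d1 + d2) * ?p (- d2) + ?p d2 * ?p d1 * ?q d2 = ?p d1 * ?q d2 * ?p (d1 + d2)"
        using arg_cong[OF c(2), of "\<lambda>x. ?q d2 * x"] by (simp add: algebra_simps)
      ultimately show ?thesis
        unfolding L R gflat_mult(1)[OF dd(1) 4(1)] gflat_mult(1)[OF dd(2) 4(2)] c(3)
        by (simp add: mult_ac add_ac)
    next
      case 1
      then show ?thesis unfolding L R by (simp add: algebra_simps)
    next
      \<comment> \<open>If one difference is 0, the six monomials coincide in pairs and
        \<open>gflat\<close> at 0 is -v, so coefficients have to be added before they are
        compared.\<close>
      case 2
      have "gflat v g d2 * gflat v g (- d2) = v" by (rule gflat_mult(1)[OF dd(2) 2(2)])
      then show ?thesis unfolding L R using 2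
        by (simp add: gflat_0 box_coeff_def cst_add cst_mult cst_diff cst_uminus algebra_simps cst_2 flip: cst_mult)
    next
      case 3
      have "gflat v g d1 * gflat v g (- d1) = v" by (rule gflat_mult(1)[OF dd(1) 3(1)])
      then show ?thesis unfolding L R using 3
        by (simp add: gflat_0 box_coeff_def cst_add cst_mult cst_diff cst_uminus algebra_simps cst_2 flip: cst_mult)
    qed
  qed
  moreover have "e 0 0 = xpow \<mu>" by (simp add: e_def)
  ultimately show ?thesis by simp
qed

lemma X_Suc_nz: "1 - X i * X (Suc i) \<noteq> 0"
proof -
  have "kalpha (int n) i + kalpha (int n) (Suc i) \<noteq> 0"
  proof
    assume "kalpha (int n) i + kalpha (int n) (Suc i) = 0"
    then have "lookup (kalpha (int n) i + kalpha (int n) (Suc i)) i = 0" by simp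
    then show False using n_pos by (simp add: lookup_add lookup_kalpha)
  qed
  from one_minus_cst_xpow_nz[OF this, of 1] show ?thesis by (simp add: X_def xpow_add)
qed

text \<open>Identities of rational functions in x = X_i and y = X_(i+1), where s_i sends x to 1/x
  and y to x y, and symmetrically for s_(i+1). They are the coefficient comparisons required in
  \<open>T_braid_mult\<close>.\<close>

lemma D_braid:
  fixes i f
  defines "j \<equiv> Suc i"
  shows "Dm i (perm_s j (perm_s i f)) = perm_s j (perm_s i (Dm j f))"
    and "Dm j (perm_s i (perm_s j f)) = perm_s i (perm_s j (Dm i f))"
    and "perm_s i (Dm j (perm_s i f)) = perm_s j (Dm i (perm_s j f))"
    and "Dm i (Dm j (perm_s i f)) + perm_s i (Dm j (Dm i f)) - perm_s i (Dm j (perm_s i f)) = Dm j (perm_s i (Dm j f))"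
    and "Dm j (Dm i (perm_s j f)) + perm_s j (Dm i (Dm j f)) - perm_s j (Dm i (perm_s j f)) = Dm i (perm_s j (Dm i f))"
    and "Dm i (Dm j (Dm i f)) = Dm j (Dm i (Dm j f))"
proof -
  define x where "x = X i"
  define y where "y = X j"
  have s: "perm_s i x = inverse x" "perm_s i y = x * y" "perm_s j x = x * y" "perm_s j y = inverse y"
    using perm_s_X[of i] perm_s_X(1)[of j] by (simp_all add: x_def y_def j_def)
  have nz: "1 - x \<noteq> 0" "1 - y \<noteq> 0" "1 - x * y \<noteq> 0" "x \<noteq> 0" "y \<noteq> 0"
    using X_nz X_Suc_nz by (simp_all add: x_def y_def j_def)
  have nz': "x \<noteq> 1" "y \<noteq> 1" "x * y \<noteq> 1" "y * x \<noteq> 1" using nz by (auto simp: mult.commute)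
  have D: "Dm i f = x * (f - perm_s i f) / (1 - x)" "Dm j f = y * (f - perm_s j f) / (1 - y)" for f
    by (simp_all add: Dm_def x_def y_def)
  have br: "perm_s j (perm_s i (perm_s j f)) = perm_s i (perm_s j (perm_s i f))" for f
    using perm_s_braid[of i f] by (simp add: j_def)
  have xy: "x * y * inverse y = x" "x * y * inverse x = y" "inverse x * (x * y) = y" "inverse y * (x * y) = x"
    using nz by simp_all
  note ss = xy D s perm_s_simps perm_s_perm_s br
  show "Dm i (perm_s j (perm_s i f)) = perm_s j (perm_s i (Dm j f))"
    using nz by (simp add: ss)
  show "Dm j (perm_s i (perm_s j f)) = perm_s i (perm_s j (Dm i f))"
    using nz by (simp add: ss)
  show "perm_s i (Dm j (perm_s i f)) = perm_s j (Dm i (perm_s j f))"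
    using nz by (simp add: ss)
  show "Dm i (Dm j (perm_s i f)) + perm_s i (Dm j (Dm i f)) - perm_s i (Dm j (perm_s i f)) = Dm j (perm_s i (Dm j f))"
    using nz nz' by (simp add: ss divide_simps) (simp add: algebra_simps)?
  show "Dm j (Dm i (perm_s j f)) + perm_s j (Dm i (Dm j f)) - perm_s j (Dm i (perm_s j f)) = Dm i (perm_s j (Dm i f))"
    using nz nz' by (simp add: ss divide_simps) (simp add: algebra_simps)?
  show "Dm i (Dm j (Dm i f)) = Dm j (Dm i (Dm j f))"
    using nz nz' by (simp add: ss divide_simps) (simp add: algebra_simps)?
qed

text \<open>Three applications of the Leibniz rule write each side as a combination of h and its
  images under words in T_i and T_j. The square T_k T_k h that arises is removed by the quadratic
  relation, and the remaining coefficients match by \<open>D_braid\<close>.\<close>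

lemma T_braid_mult:
  fixes i f h
  defines "j \<equiv> Suc i"
  assumes f: "f \<in> ninv"
    and qi: "T i (T i h) = cst v * h - cst (1 - v) * T i h"
    and qj: "T j (T j h) = cst v * h - cst (1 - v) * T j h"
    and br: "T i (T j (T i h)) = T j (T i (T j h))"
  shows "T i (T j (T i (f * h))) = T j (T i (T j (f * h)))"
proof -
  define b where "b = cst (1 - v)"
  have *: "T k (T l (T k (f * h))) =
      perm_s k (perm_s l (perm_s k f)) * T k (T l (T k h))
      + b * Dm k (perm_s l (perm_s k f)) * T l (T k h)
      + b * perm_s k (perm_s l (Dm k f)) * T k (T l h)
      + b * b * Dm k (perm_s l (Dm k f)) * T l h
      + b * b * (Dm k (Dm l (perm_s k f)) + perm_s k (Dm l (Dm k f)) - perm_s k (Dm l (perm_s k f))) * T k h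
      + (b * cst v * perm_s k (Dm l (perm_s k f)) + b * b * b * Dm k (Dm l (Dm k f))) * h"
    if q: "T k (T k h) = cst v * h - cst (1 - v) * T k h" for k l
  proof -
    note ni = ninv_perm ninv_D f
    have 1: "T k (f * h) = perm_s k f * T k h + cst (1 - v) * (Dm k f * h)"
      by (simp add: T_ninv f mult.assoc)
    have 2: "T l (T k (f * h)) = perm_s l (perm_s k f) * T l (T k h) + cst (1 - v) * (Dm l (perm_s k f) * T k h)
       + cst (1 - v) * (perm_s l (Dm k f) * T l h + cst (1 - v) * (Dm l (Dm k f) * h))"
      unfolding 1 T_add T_cst by (simp add: T_ninv ni mult.assoc)
    have "T k (T l (T k (f * h))) = perm_s k (perm_s l (perm_s k f)) * T k (T l (T k h))
       + b * Dm k (perm_s l (perm_s k f)) * T l (T k h)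
       + b * (perm_s k (Dm l (perm_s k f)) * T k (T k h) + b * Dm k (Dm l (perm_s k f)) * T k h)
       + b * (perm_s k (perm_s l (Dm k f)) * T k (T l h) + b * Dm k (perm_s l (Dm k f)) * T l h
       + b * (perm_s k (Dm l (Dm k f)) * T k h + b * Dm k (Dm l (Dm k f)) * h))"
      unfolding 2 T_add T_cst by (simp add: T_ninv ni b_def)
    then show ?thesis unfolding q b_def[symmetric] by (simp add: algebra_simps)
  qed
  have bp: "perm_s i (perm_s j (perm_s i f)) = perm_s j (perm_s i (perm_s j f))"
    by (simp add: j_def perm_s_braid)
  note D = D_braid[of i f, folded j_def]
  show ?thesis
    unfolding *[OF qi] *[OF qj] br bp D(4) D(5) unfolding D(1,2,6) D(3)
    by (simp add: algebra_simps)
qed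

lemma T_braid:
  assumes "f \<in> laur r"
  shows "T i (T (Suc i) (T i f)) = T (Suc i) (T i (T (Suc i) f))"
  using assms
proof (rule laur_linear_eq)
  fix \<mu>
  obtain \<eta> \<beta> where *: "\<mu> = \<eta> + \<beta>" "\<And>j. int n dvd lookup \<eta> j"
    "\<And>j k. j \<in> {i..i+2} \<Longrightarrow> k \<in> {i..i+2} \<Longrightarrow>
      \<bar>lookup \<beta> j + int j - (lookup \<beta> k + int k)\<bar> < int n"
    using box_decomp[of \<mu> i] by blast
  have box: "\<bar>lookup \<beta> (i + 1) - lookup \<beta> i + 1\<bar> < int n"
    "\<bar>lookup \<beta> (i + 2) - lookup \<beta> (i + 1) + 1\<bar> < int n"
    "\<bar>lookup \<beta> (i + 2) - lookup \<beta> i + 2\<bar> < int n"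
    using *(3)[of "i+1" i] *(3)[of "i+2" "i+1"] *(3)[of "i+2" i] by (simp_all add: algebra_simps)
  show "T i (T (Suc i) (T i (xpow \<mu>))) = T (Suc i) (T i (T (Suc i) (xpow \<mu>)))"
    unfolding *(1) xpow_add using box
    by (intro T_braid_mult ninv_xpow *(2) T_quadratic_box T_braid_box) simp_all
qed (simp_all add: T_add T_cst)

section \<open>Summation over the symmetric group and row expansions\<close>

text \<open>T_m is applied first and T_k last. The empty chain, m = k + 1, represents the trivial
  coset.\<close>

definition chain :: "nat \<Rightarrow> nat \<Rightarrow> ratfun \<Rightarrow> ratfun" where
  "chain k m = foldr T (rev [m..<Suc k])"

lemma chain_id: "k < m \<Longrightarrow> chain k m f = f"
  by (simp add: chain_def)

lemma chain_first: "m \<le> k \<Longrightarrow> chain k m f = chain k (Suc m) (T m f)"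
  by (simp add: chain_def upt_conv_Cons del: upt_Suc)

lemma chain_last: "m \<le> Suc k \<Longrightarrow> chain (Suc k) m f = T (Suc k) (chain k m f)"
  by (simp add: chain_def)

lemma foldr_T_add: "foldr T is (f + h) = foldr T is f + foldr T is h"
  by (induction "is") (simp_all add: T_add)

lemma foldr_T_cst: "foldr T is (cst c * f) = cst c * foldr T is f"
  by (induction "is") (simp_all add: T_cst)

lemma foldr_T_laur: "set is \<subseteq> {1..r} \<Longrightarrow> f \<in> laur r \<Longrightarrow> foldr T is f \<in> laur r"
  by (induction "is") (auto intro: T_laur)

lemmas chain_add = foldr_T_add[of "rev [m..<Suc k]" for m k, folded chain_def]
lemmas chain_cst = foldr_T_cst[of "rev [m..<Suc k]" for m k, folded chain_def]

lemma chain_laur: "1 \<le> m \<Longrightarrow> k \<le> r \<Longrightarrow> f \<in> laur r \<Longrightarrow> chain k m f \<in> laur r"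
  unfolding chain_def by (rule foldr_T_laur) auto

text \<open>The sum of T_u over the permutations of {1..k+1}, grouped in each step by the position m
  of the largest value; \<open>sum_T_op\<close> proves the identification.\<close>

primrec Z :: "nat \<Rightarrow> ratfun \<Rightarrow> ratfun" where
  "Z 0 f = f"
| "Z (Suc k) f = (\<Sum>m = 1..Suc (Suc k). Z k (chain (Suc k) m f))"

lemma Z_add: "Z k (f + h) = Z k f + Z k h"
  by (induction k arbitrary: f h) (simp_all add: chain_add sum.distrib del: sum.cl_ivl_Suc)

lemma Z_cst: "Z k (cst c * f) = cst c * Z k f"
  by (induction k arbitrary: f) (simp_all add: chain_cst sum_distrib_left del: sum.cl_ivl_Suc)

lemma chain_commute_below:
  assumes "f \<in> laur r" "i + 1 < m" "1 \<le> i" "k \<le> r"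
  shows "T i (chain k m f) = chain k m (T i f)"
  using assms(4)
proof (induction k)
  case 0
  then show ?case using assms by (simp add: chain_id)
next
  case (Suc k)
  show ?case
  proof (cases "m \<le> Suc k")
    case True
    have "chain k m f \<in> laur r" using assms Suc by (intro chain_laur) auto
    then show ?thesis using True Suc assms T_commute[of _ r i "Suc k"] by (simp add: chain_last)
  qed (simp add: chain_id)
qed

lemma chain_commute_above:
  assumes "f \<in> laur r" "k + 1 < i" "1 \<le> m" "k \<le> r"
  shows "T i (chain k m f) = chain k m (T i f)"
  using assms(2,4)
proof (induction k)
  case 0
  then show ?case using assms by (simp add: chain_id)
next
  case (Suc k)
  show ?case
  proof (cases "m \<le> Suc k")
    case True
    have "chain k m f \<in> laur r" using assms Suc by (intro chain_laur) auto
    then show ?thesis using True Suc assms T_commute[of _ r i "Suc k"] by (simp add: chain_last)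
  qed (simp add: chain_id)
qed

text \<open>T_i commutes with the chain up to the place where T_i T_(i-1) stands; one braid relation
  there turns it into T_(i-1), which commutes with the rest.\<close>

lemma chain_shift:
  assumes "f \<in> laur r" "m < i" "i \<le> k" "1 \<le> m" "k \<le> r"
  shows "chain k m (T i f) = T (i - 1) (chain k m f)"
  using assms(3,5)
proof (induction k)
  case (Suc k)
  show ?case
  proof (cases "i \<le> k")
    case True
    have "chain k m f \<in> laur r" using assms Suc by (intro chain_laur) auto
    then show ?thesis using True Suc assms T_commute[of _ r "i - 1" "Suc k"] by (simp add: chain_last)
  next
    case False
    with Suc have i: "i = Suc k" by simp
    with assms obtain l where l: "k = Suc l" by (cases k) auto
    have "chain l m f \<in> laur r" using assms Suc l by (intro chain_laur) auto
    moreover have "chain l m (T (Suc (Suc l)) f) = T (Suc (Suc l)) (chain l m f)"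
      using assms Suc l by (subst chain_commute_above) auto
    ultimately show ?thesis
      using i l assms T_braid[of "chain l m f" r k] by (simp add: chain_last)
  qed
qed (use assms in simp)

text \<open>A chain starting below i carries the eigenvector to one of T_(i-1), a chain starting
  above i + 1 to one of T_i, so both vanish by induction. The chains starting at i and at i + 1
  cancel, because the former applies T_i to f first.\<close>

lemma Z_kill:
  assumes "f \<in> laur r" "1 \<le> i" "i \<le> k" "k \<le> r" "T i f = - f"
  shows "Z k f = 0"
  using assms
proof (induction k arbitrary: i f)
  case (Suc k)
  have laur: "chain (Suc k) m f \<in> laur r" if "m \<ge> 1" for m
    using that Suc.prems by (intro chain_laur) auto
  have neg: "chain (Suc k) m (- f) = - chain (Suc k) m f" for m
    using chain_cst[of "Suc k" m "-1" f] by (simp add: cst_uminus)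
  have 0: "Z k (chain (Suc k) m f) = 0" if m: "1 \<le> m" "m \<le> Suc (Suc k)" "m \<noteq> i" "m \<noteq> Suc i" for m
  proof (cases "m < i")
    case True
    have "T (i - 1) (chain (Suc k) m f) = - chain (Suc k) m f"
      using chain_shift[of f r m i "Suc k"] Suc.prems True m by (simp add: neg)
    then show ?thesis using True m Suc.prems by (intro Suc.IH[of _ "i - 1"] laur) auto
  next
    case False
    then have im: "i + 1 < m" using m by simp
    have "T i (chain (Suc k) m f) = - chain (Suc k) m f"
      using chain_commute_below[of f r i m "Suc k"] Suc.prems im by (simp add: neg)
    then show ?thesis using im m Suc.prems by (intro Suc.IH[of _ i] laur) auto
  qed
  have "Z (Suc k) f = (\<Sum>m \<in> {i, Suc i}. Z k (chain (Suc k) m f))"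
    unfolding Z.simps using Suc.prems by (intro sum.mono_neutral_right) (auto simp: 0)
  also have "\<dots> = Z k (chain (Suc k) i f + chain (Suc k) (Suc i) f)"
    by (simp add: Z_add)
  also have "chain (Suc k) i f = - chain (Suc k) (Suc i) f"
    using chain_first[of i "Suc k" f] Suc.prems by (simp add: neg)
  finally show ?case using Z_cst[of k 0 0] by simp
qed simp

section \<open>Monomials with shifted exponents\<close>

definition delta :: "nat \<Rightarrow> weight" where
  "delta r = (\<Sum>j = 1..r+1. single j (int j - 1))"

lemma lookup_delta: "lookup (delta r) j = (if j \<in> {1..r+1} then int j - 1 else 0)"
  unfolding delta_def by (simp add: lookup_sum lookup_single when_def del: sum.cl_ivl_Suc)

text \<open>The shift by \<open>delta\<close>, which is the image of rho under w_0, makes the number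
  D of \<open>T_xpow_pos\<close> the plain difference of adjacent entries and turns dominance into
  strict increase.\<close>

definition y :: "nat \<Rightarrow> weight \<Rightarrow> ratfun" where
  "y r \<kappa> = xpow (\<kappa> - delta r)"

definition topc :: "int \<Rightarrow> int \<Rightarrow> complex" where
  "topc d G = (if G < d then hflat n v G else gflat v g G)"

lemma T_y_pos:
  assumes "1 \<le> i" "i \<le> r" "d = lookup \<kappa> (i + 1) - lookup \<kappa> i" "d \<ge> 1"
  shows "T i (y r \<kappa>) = (\<Sum>G = 1..d. cst (topc d G) * y r (\<kappa> + kalpha G i))"
proof -
  have "T i (y r \<kappa>) = (\<Sum>G = 1..d. cst (topc d G) * xpow (\<kappa> - delta r + kalpha G i))"
    unfolding y_def topc_def using assms
    by (intro T_xpow_pos) (simp_all add: lookup_minus lookup_delta)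
  then show ?thesis by (simp add: y_def algebra_simps)
qed

lemma T_y_0:
  assumes "1 \<le> i" "i \<le> r" "lookup \<kappa> (i + 1) = lookup \<kappa> i"
  shows "T i (y r \<kappa>) = - y r \<kappa>"
  unfolding y_def using assms by (intro T_xpow_0) (simp_all add: lookup_minus lookup_delta)

lemma weights_iff: "\<mu> \<in> weights r \<longleftrightarrow> (\<forall>j. j \<notin> {1..r+1} \<longrightarrow> lookup \<mu> j = 0)"
  by (auto simp: weights_def in_keys_iff)

lemma weights_simps:
  "\<mu> \<in> weights r \<Longrightarrow> \<nu> \<in> weights r \<Longrightarrow> \<mu> + \<nu> \<in> weights r"
  "\<mu> \<in> weights r \<Longrightarrow> \<nu> \<in> weights r \<Longrightarrow> \<mu> - \<nu> \<in> weights r"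
  "1 \<le> i \<Longrightarrow> i \<le> r \<Longrightarrow> kalpha k i \<in> weights r"
  "delta r \<in> weights r"
  by (auto simp: weights_iff lookup_add lookup_minus lookup_kalpha lookup_delta)

lemma laur_mult: "f \<in> laur r \<Longrightarrow> h \<in> laur r \<Longrightarrow> f * h \<in> laur r"
proof (induction f rule: laur.induct)
  case (step \<mu> f c)
  have "xpow \<mu> * h \<in> laur r"
    using step.prems
  proof (induction h rule: laur.induct)
    case (step \<nu> h d)
    have "xpow \<mu> * (cst d * xpow \<nu> + h) = cst d * xpow (\<mu> + \<nu>) + xpow \<mu> * h"
      by (simp add: xpow_add algebra_simps)
    then show ?case using step \<open>\<mu> \<in> weights r\<close> by (simp add: laur.step weights_simps)
  qed (simp add: laur.zero)
  then show ?case using step by (simp add: distrib_right mult.assoc laur_add laur_cst)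
qed (simp add: laur.zero)

lemma y_laur: "\<kappa> \<in> weights r \<Longrightarrow> y r \<kappa> \<in> laur r"
  unfolding y_def by (intro laur_xpow weights_simps)

text \<open>Here d is a gap of the row above, and G and G' are consecutive Gamma-values. An entry
  that stays in place has factor 1, or 0 if the gap is empty; a moved one is maximal at G' = G +
  d.\<close>

definition rowc :: "int \<Rightarrow> int \<Rightarrow> int \<Rightarrow> complex" where
  "rowc d G G' = (if G' = G then (if d = 0 then 0 else 1) else topc (G + d) G')"

text \<open>The expansion of one row of a pattern, entry by entry from position \<open>m\<close> on: \<open>G\<close> is the
  value of \<open>\<Gamma>\<close> at the previous position, and \<open>\<kappa>\<close> is the weight reached so far, so that its
  entry at \<open>m\<close> is already lowered by \<open>G\<close>.\<close>

primrec W :: "nat \<Rightarrow> nat \<Rightarrow> int \<Rightarrow> weight \<Rightarrow> ratfun" where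
  "W 0 m G \<kappa> = 1"
| "W (Suc t) m G \<kappa> = (let d = lookup \<kappa> (m + 1) - lookup \<kappa> m - G in
     \<Sum>G' = G..G+d. cst (rowc d G G') * xpow (kalpha G' m) * W t (Suc m) G' (\<kappa> + kalpha G' m))"

lemma W_cong:
  "(\<And>j. j \<ge> m \<Longrightarrow> lookup \<kappa> j = lookup \<kappa>' j) \<Longrightarrow> W t m G \<kappa> = W t m G \<kappa>'"
proof (induction t arbitrary: m G \<kappa> \<kappa>')
  case (Suc t)
  have "W t (Suc m) G' (\<kappa> + kalpha G' m) = W t (Suc m) G' (\<kappa>' + kalpha G' m)" for G'
    using Suc.prems by (intro Suc.IH) (simp add: lookup_add)
  then show ?case using Suc.prems[of m] Suc.prems[of "m + 1"] by (simp add: Let_def)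
qed simp

lemma W_laur: "1 \<le> m \<Longrightarrow> m + t \<le> r + 1 \<Longrightarrow> W t m G \<kappa> \<in> laur r"
proof (induction t arbitrary: m G \<kappa>)
  case 0
  show ?case using laur_xpow[of 0 r] by (simp add: weights_def)
next
  case (Suc t)
  then show ?case
    by (auto simp: Let_def intro!: laur_sum laur_mult[OF laur_cst_xpow] weights_simps)
qed

text \<open>The expansion involves only the variables x_j with j \<ge> m, so operators T_i with i +
  1 < m are linear over it.\<close>

lemma W_fixed: "i + 1 < m \<Longrightarrow> homog i 0 (W t m G \<kappa>) \<and> perm_s i (W t m G \<kappa>) = W t m G \<kappa>"
proof (induction t arbitrary: m G \<kappa>)
  case 0
  show ?case using homog_cst[of i 1] perm_s_cst[of i 1] by simp
next
  case (Suc t)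
  have s: "homog i 0 (\<Sum>a\<in>A. F a) \<and> perm_s i (\<Sum>a\<in>A. F a) = (\<Sum>a\<in>A. F a)"
    if "\<And>a. a \<in> A \<Longrightarrow> homog i 0 (F a) \<and> perm_s i (F a) = F a" for F and A :: "int set"
    using that
  proof (induction A rule: infinite_finite_induct)
    case (insert a A)
    then show ?case using fixed_closed(1)[of i "F a" "sum F A"] by simp
  qed (use homog_cst[of i 0] perm_s_cst[of i 0] in simp_all)
  have "homog i 0 (cst c * xpow (kalpha G' m) * W t (Suc m) G' \<kappa>') \<and>
    perm_s i (cst c * xpow (kalpha G' m) * W t (Suc m) G' \<kappa>') = cst c * xpow (kalpha G' m) * W t (Suc m) G' \<kappa>'"
    for c G' \<kappa>'
    using Suc.IH[of "Suc m" G' \<kappa>'] Suc.prems perm_s_commute[of i m G'] homog_cst[of i c] perm_s_cst[of i c]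
    by (intro fixed_closed(3) conjunct1[OF fixed_closed(3)] conjunct2[OF fixed_closed(3)]) simp_all
  then show ?case unfolding W.simps Let_def by (intro s) simp
qed

text \<open>Terms of \<open>T i\<close>-chains that do not come from interlacing rows are removed by the quadratic
  relation.\<close>

lemma mismatch:
  assumes \<Phi>: "\<And>f h. \<Phi> (f + h) = \<Phi> f + \<Phi> h" "\<And>c f. \<Phi> (cst c * f) = cst c * \<Phi> f"
    and kill: "\<And>f. f \<in> laur r \<Longrightarrow> T m f = - f \<Longrightarrow> \<Phi> f = (0::ratfun)"
    and m: "1 \<le> m" "m \<le> r" and \<kappa>: "\<kappa> \<in> weights r"
    and w: "w \<in> laur r" "homog m 0 w" "perm_s m w = w"
    and G: "1 \<le> G" "G \<le> d" and d: "d = G + (lookup \<kappa> (m + 1) - lookup \<kappa> m)"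
  shows "cst (hflat n v G) * (\<Sum>H = G..d. cst (topc d H) * \<Phi> (y r (\<kappa> + kalpha (H - G) m) * w))
    = cst (topc d G) * \<Phi> (y r \<kappa> * w)"
proof -
  have sum: "\<Phi> (sum F A) = (\<Sum>a\<in>A. \<Phi> (F a))" for F and A :: "int set"
    using \<Phi>(2)[of 0 0] by (induction A rule: infinite_finite_induct) (simp_all add: \<Phi>(1))
  define u where "u = y r \<kappa> * w"
  have u: "u \<in> laur r" unfolding u_def by (intro laur_mult y_laur w \<kappa>)
  have Tw: "T m (f * w) = T m f * w" for f
    using T_fixed[OF w(2,3), of f] by (simp add: mult.commute)
  show ?thesis
  proof (cases "G = d")
    \<comment> \<open>The entries at m and m + 1 now agree, so y is a (-1)-eigenvector of T_m and
      both sides are 0.\<close>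
    case True
    then have "T m (y r \<kappa>) = - y r \<kappa>" using d m by (intro T_y_0) simp_all
    then have "\<Phi> (y r \<kappa> * w) = 0" using u by (intro kill) (simp_all add: u_def Tw)
    then show ?thesis using True by simp
  next
    case False
    then have Gd: "G < d" using G by simp
    show ?thesis
    proof (cases "int n dvd G")
      case False
      then show ?thesis using Gd by (simp add: hflat_def topc_def)
    next
      case True
      \<comment> \<open>As n divides G, shifting by G changes neither the support of
        \<open>hflat\<close> nor the values of g.\<close>
      have per: "topc d (G + H) = topc (d - G) H" for H
      proof -
        have "g (G + H) = g H" using True by (intro g_cong) (simp add: mod_eq_dvd_iff)
        then show ?thesis using True by (auto simp: topc_def hflat_def gflat_def dvd_add_right_iff)
      qed
      have split: "{G..d} = insert G ((\<lambda>H. G + H) ` {1..d - G})"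
        using Gd by (auto simp: image_def intro!: exI[of _ "_ - G"] bexI[of _ "_ - G"])
      have "(\<Sum>H = G..d. cst (topc d H) * \<Phi> (y r (\<kappa> + kalpha (H - G) m) * w)) =
        cst (topc d G) * \<Phi> u + (\<Sum>H \<in> (\<lambda>H. G + H) ` {1..d - G}. cst (topc d H) * \<Phi> (y r (\<kappa> + kalpha (H - G) m) * w))"
        unfolding split by (subst sum.insert) (auto simp: u_def)
      also have "(\<Sum>H \<in> (\<lambda>H. G + H) ` {1..d - G}. cst (topc d H) * \<Phi> (y r (\<kappa> + kalpha (H - G) m) * w)) =
        (\<Sum>H = 1..d - G. cst (topc (d - G) H) * \<Phi> (y r (\<kappa> + kalpha H m) * w))"
        by (subst sum.reindex) (auto simp: inj_on_def per)
      also have "\<dots> = \<Phi> (T m u)"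
        unfolding u_def Tw using m d Gd
        by (subst T_y_pos[of m r "d - G"]) (simp_all add: sum_distrib_right sum mult.assoc \<Phi>(2))
      finally have s: "(\<Sum>H = G..d. cst (topc d H) * \<Phi> (y r (\<kappa> + kalpha (H - G) m) * w)) =
         cst (1 - v) * \<Phi> u + \<Phi> (T m u)"
        using Gd True by (simp add: topc_def hflat_def)
      \<comment> \<open>By the quadratic relation T_m u - v u is a (-1)-eigenvector. Hence T_m acts
        under \<Phi> as v, and the sum above becomes (1 - v) + v = 1 times \<Phi> u.\<close>
      have "\<Phi> (T m u + cst (- v) * u) = 0"
      proof (rule kill)
        show "T m u + cst (- v) * u \<in> laur r" using u m by (intro laur_add laur_cst T_laur)
        show "T m (T m u + cst (- v) * u) = - (T m u + cst (- v) * u)"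
          unfolding T_add T_cst T_quadratic[OF u] by (simp add: cst_uminus cst_diff algebra_simps)
      qed
      then have "\<Phi> (T m u) = cst v * \<Phi> u" unfolding \<Phi> by (simp add: cst_uminus)
      then show ?thesis unfolding s using Gd True
        by (simp add: topc_def hflat_def u_def cst_diff algebra_simps)
    qed
  qed
qed

text \<open>After T_m has moved H units, the next gap is d2 + H, so the rest of the chain produces G
  from 1 to H + d2, whereas interlacing requires G from H on, with coefficient 1 at G = H. For a
  single H the two sides differ; the differences cancel by \<open>mismatch\<close> once they are
  summed over H.\<close>

lemma chain_rows:
  assumes \<Phi>: "\<And>f h. \<Phi> (f + h) = \<Phi> f + \<Phi> h" "\<And>c f. \<Phi> (cst c * f) = cst c * \<Phi> f"
    and kill: "\<And>i f. m \<le> i \<Longrightarrow> i < m + t \<Longrightarrow> f \<in> laur r \<Longrightarrow> T i f = - f \<Longrightarrow> \<Phi> f = (0::ratfun)"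
    and m: "1 \<le> m" "m + t \<le> r" and \<kappa>: "\<kappa> \<in> weights r"
    and incr: "\<And>i. m \<le> i \<Longrightarrow> i \<le> m + t \<Longrightarrow> lookup \<kappa> i < lookup \<kappa> (i + 1)"
    and d: "d = lookup \<kappa> (m + 1) - lookup \<kappa> m"
  shows "\<Phi> (chain (m + t) m (y r \<kappa>)) =
    (\<Sum>G = 1..d. cst (topc d G) * \<Phi> (y r (\<kappa> + kalpha G m) * W t (Suc m) G (\<kappa> + kalpha G m)))"
  using kill m \<kappa> incr d
proof (induction t arbitrary: m \<kappa> d)
  have sum: "\<Phi> (sum F A) = (\<Sum>a\<in>A. \<Phi> (F a))" for F and A :: "int set"
    using \<Phi>(2)[of 0 0] by (induction A rule: infinite_finite_induct) (simp_all add: \<Phi>(1))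
  {
    case 0
    have "d \<ge> 1" using 0(5)[of m] 0(6) by simp
    then show ?case
      using 0 T_y_pos[of m r d \<kappa>] by (simp add: chain_first chain_id sum \<Phi>(2))
  next
    case (Suc t)
    define d2 where "d2 = lookup \<kappa> (m + 2) - lookup \<kappa> (m + 1)"
    have d1: "d \<ge> 1" using Suc.prems(5)[of m] Suc.prems(6) by simp
    have d2: "d2 \<ge> 1" using Suc.prems(5)[of "m + 1"] by (simp add: d2_def)
    define w where "w G = W t (m + 2) G (\<kappa> + kalpha G (m + 1))" for G
    have w: "W t (Suc (Suc m)) G (\<kappa> + kalpha H m + kalpha G (Suc m)) = w G" for G H
      unfolding w_def by (simp, rule W_cong) (simp add: lookup_add lookup_kalpha)
    define F where "F H G = \<Phi> (y r (\<kappa> + kalpha H m + kalpha G (m + 1)) * w G)" for H G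
    have row: "\<Phi> (y r (\<kappa> + kalpha H m) * W (Suc t) (Suc m) H (\<kappa> + kalpha H m)) =
        (\<Sum>G = H..H+d2. cst (rowc d2 H G) * F H G)" for H
    proof -
      have "lookup (\<kappa> + kalpha H m) (Suc m + 1) - lookup (\<kappa> + kalpha H m) (Suc m) - H = d2"
        by (simp add: lookup_add lookup_kalpha d2_def)
      then have "y r (\<kappa> + kalpha H m) * W (Suc t) (Suc m) H (\<kappa> + kalpha H m) =
        (\<Sum>G = H..H+d2. cst (rowc d2 H G) * (y r (\<kappa> + kalpha H m + kalpha G (m + 1)) * w G))"
        unfolding W.simps Let_def w
        by (simp add: sum_distrib_left y_def xpow_add xpow_diff mult_ac)
      then show ?thesis by (simp only: sum \<Phi>(2) F_def)
    qed
    have ch: "\<Phi> (chain (m + Suc t) (Suc m) (y r (\<kappa> + kalpha H m))) =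
        (\<Sum>G = 1..H+d2. cst (topc (H + d2) G) * F H G)" if H: "1 \<le> H" "H \<le> d" for H
    proof -
      have "\<Phi> (chain (Suc m + t) (Suc m) (y r (\<kappa> + kalpha H m))) =
        (\<Sum>G = 1..H+d2. cst (topc (H + d2) G) * \<Phi> (y r (\<kappa> + kalpha H m + kalpha G (Suc m)) *
            W t (Suc (Suc m)) G (\<kappa> + kalpha H m + kalpha G (Suc m))))"
      proof (rule Suc.IH)
        show "\<kappa> + kalpha H m \<in> weights r" using Suc.prems by (intro weights_simps) auto
        show "lookup (\<kappa> + kalpha H m) i < lookup (\<kappa> + kalpha H m) (i + 1)"
          if "Suc m \<le> i" "i \<le> Suc m + t" for i
          using Suc.prems(5)[of i] that H by (cases "i = Suc m") (simp_all add: lookup_add lookup_kalpha)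
        show "\<Phi> f = 0" if "Suc m \<le> i" "i < Suc m + t" "f \<in> laur r" "T i f = - f" for i f
          using Suc.prems(1)[of i f] that by simp
      qed (use Suc.prems in \<open>auto simp: lookup_add lookup_kalpha d2_def\<close>)
      then show ?thesis by (simp add: w F_def)
    qed
    \<comment> \<open>The last bracket is the surplus. Its terms carry \<open>hflat\<close> because
      G \<le> H < H + d2, and the subtracted term is the unmoved entry of the row.\<close>
    have diff: "(\<Sum>G = 1..H+d2. cst (topc (H + d2) G) * F H G) =
       (\<Sum>G = H..H+d2. cst (rowc d2 H G) * F H G) + ((\<Sum>G = 1..H. cst (hflat n v G) * F H G) - F H H)"
      if H: "1 \<le> H" for H
    proof -
      have "{1..H+d2} = {1..H} \<union> {H+1..H+d2}" "{H..H+d2} = {H} \<union> {H+1..H+d2}" using H d2 by auto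
      then have "(\<Sum>G = 1..H+d2. cst (topc (H + d2) G) * F H G) =
         (\<Sum>G = 1..H. cst (topc (H + d2) G) * F H G) + (\<Sum>G = H+1..H+d2. cst (topc (H + d2) G) * F H G)"
        "(\<Sum>G = H..H+d2. cst (rowc d2 H G) * F H G) =
          cst (rowc d2 H H) * F H H + (\<Sum>G = H+1..H+d2. cst (rowc d2 H G) * F H G)"
        by (simp_all add: sum.union_disjoint)
      moreover have "(\<Sum>G = H+1..H+d2. cst (rowc d2 H G) * F H G) = (\<Sum>G = H+1..H+d2. cst (topc (H + d2) G) * F H G)"
        by (intro sum.cong) (auto simp: rowc_def)
      moreover have "(\<Sum>G = 1..H. cst (topc (H + d2) G) * F H G) = (\<Sum>G = 1..H. cst (hflat n v G) * F H G)"
        using d2 by (intro sum.cong) (auto simp: topc_def)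
      ultimately show ?thesis using d2 by (simp add: rowc_def)
    qed
    \<comment> \<open>For fixed G the surplus is collected over all H \<ge> G, starting from the
      weight with G units moved at both m and m + 1; there the gap at m is d - G.\<close>
    have mm: "cst (hflat n v G) * (\<Sum>H = G..d. cst (topc d H) * F H G) = cst (topc d G) * F G G"
      if G: "1 \<le> G" "G \<le> d" for G
    proof -
      define \<nu> where "\<nu> = \<kappa> + kalpha G m + kalpha G (m + 1)"
      have "\<kappa> + kalpha H m + kalpha G (m + 1) = \<nu> + kalpha (H - G) m" for H
        using kalpha_add[of G "H - G" m] by (simp add: \<nu>_def add_ac)
      then have F: "F H G = \<Phi> (y r (\<nu> + kalpha (H - G) m) * w G)" for H
        by (simp only: F_def)
      have wG: "w G \<in> laur r" "homog m 0 (w G)" "perm_s m (w G) = w G"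
        using W_laur[of "m + 2" t r] W_fixed[of m "m + 2"] Suc.prems by (simp_all add: w_def)
      have "cst (hflat n v G) * (\<Sum>H = G..d. cst (topc d H) * \<Phi> (y r (\<nu> + kalpha (H - G) m) * w G))
         = cst (topc d G) * \<Phi> (y r \<nu> * w G)"
      proof (rule mismatch[of \<Phi> r m \<nu> "w G" G d, OF \<Phi> _ _ _ _ wG G])
        show "\<Phi> f = 0" if "f \<in> laur r" "T m f = - f" for f
          using Suc.prems(1)[of m f] that by simp
        show "\<nu> \<in> weights r" unfolding \<nu>_def using Suc.prems by (intro weights_simps) auto
        show "d = G + (lookup \<nu> (m + 1) - lookup \<nu> m)"
          using Suc.prems by (simp add: \<nu>_def lookup_add lookup_kalpha)
      qed (use Suc.prems in auto)
      then show ?thesis by (simp add: F)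
    qed
    have tri: "(\<Sum>H = 1..d. \<Sum>G = 1..H. A H G) = (\<Sum>G = 1..d. \<Sum>H = G..d. A H G)" for A :: "int \<Rightarrow> int \<Rightarrow> ratfun"
    proof -
      have "(\<Sum>H = 1..d. \<Sum>G = 1..H. A H G) = (\<Sum>H = 1..d. \<Sum>G | G \<in> {1..d} \<and> G \<le> H. A H G)"
        by (intro sum.cong) auto
      also have "\<dots> = (\<Sum>G = 1..d. \<Sum>H | H \<in> {1..d} \<and> G \<le> H. A H G)"
        by (rule sum.swap_restrict) auto
      also have "\<dots> = (\<Sum>G = 1..d. \<Sum>H = G..d. A H G)"
        by (intro sum.cong) auto
      finally show ?thesis .
    qed
    have "\<Phi> (chain (m + Suc t) m (y r \<kappa>)) = (\<Sum>H = 1..d. cst (topc d H) * (\<Sum>G = 1..H+d2. cst (topc (H + d2) G) * F H G))"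
    proof -
      have "chain (m + Suc t) m (y r \<kappa>) = chain (m + Suc t) (Suc m) (\<Sum>H = 1..d. cst (topc d H) * y r (\<kappa> + kalpha H m))"
        using Suc.prems d1 T_y_pos[of m r d \<kappa>] by (subst chain_first) auto
      also have "\<dots> = (\<Sum>H = 1..d. cst (topc d H) * chain (m + Suc t) (Suc m) (y r (\<kappa> + kalpha H m)))"
      proof -
        have "chain k l (sum B A) = (\<Sum>a\<in>A. chain k l (B a))" for k l B and A :: "int set"
          using chain_cst[of k l 0 0] by (induction A rule: infinite_finite_induct) (simp_all add: chain_add)
        then show ?thesis by (simp add: chain_cst)
      qed
      finally show ?thesis using ch by (simp add: sum \<Phi>(2))
    qed
    also have "\<dots> = (\<Sum>H = 1..d. cst (topc d H) * (\<Sum>G = H..H+d2. cst (rowc d2 H G) * F H G)) +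
       ((\<Sum>H = 1..d. \<Sum>G = 1..H. cst (topc d H) * (cst (hflat n v G) * F H G)) - (\<Sum>H = 1..d. cst (topc d H) * F H H))"
      by (simp add: diff distrib_left right_diff_distrib sum.distrib sum_subtractf sum_distrib_left)
    also have "(\<Sum>H = 1..d. \<Sum>G = 1..H. cst (topc d H) * (cst (hflat n v G) * F H G)) =
      (\<Sum>G = 1..d. cst (hflat n v G) * (\<Sum>H = G..d. cst (topc d H) * F H G))"
      by (simp add: tri sum_distrib_left mult.left_commute)
    also have "\<dots> = (\<Sum>H = 1..d. cst (topc d H) * F H H)"
      by (simp add: mm)
    finally show ?case by (simp only: row diff_self add_0_right)
  }
qed

text \<open>Under \<Phi>, the chain that starts at l yields the rows whose first moved entry is at
  l, and the empty chain l = m + t yields the unmoved row. Strict increase gives unmoved entries the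
  coefficient 1.\<close>

lemma chain_sum_rows:
  assumes \<Phi>: "\<And>f h. \<Phi> (f + h) = \<Phi> f + \<Phi> h" "\<And>c f. \<Phi> (cst c * f) = cst c * \<Phi> f"
    and kill: "\<And>i f. m \<le> i \<Longrightarrow> i + 1 < m + t \<Longrightarrow> f \<in> laur r \<Longrightarrow> T i f = - f \<Longrightarrow> \<Phi> f = (0::ratfun)"
    and m: "1 \<le> m" "m + t \<le> r + 1" and \<kappa>: "\<kappa> \<in> weights r"
    and incr: "\<And>i. m \<le> i \<Longrightarrow> i < m + t \<Longrightarrow> lookup \<kappa> i < lookup \<kappa> (i + 1)"
  shows "(\<Sum>l = m..m + t. \<Phi> (chain (m + t - 1) l (y r \<kappa>))) = \<Phi> (y r \<kappa> * W t m 0 \<kappa>)"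
  using kill m \<kappa> incr
proof (induction t arbitrary: m)
  case 0
  then show ?case by (simp add: chain_id)
next
  case (Suc t)
  have sum: "\<Phi> (sum F A) = (\<Sum>a\<in>A. \<Phi> (F a))" for F and A :: "int set"
    using \<Phi>(2)[of 0 0] by (induction A rule: infinite_finite_induct) (simp_all add: \<Phi>(1))
  define d where "d = lookup \<kappa> (m + 1) - lookup \<kappa> m"
  have d: "d \<ge> 1" using Suc.prems(5)[of m] by (simp add: d_def)
  have "(\<Sum>l = m..m + Suc t. \<Phi> (chain (m + Suc t - 1) l (y r \<kappa>))) =
     \<Phi> (chain (m + t) m (y r \<kappa>)) + (\<Sum>l = Suc m..Suc m + t. \<Phi> (chain (Suc m + t - 1) l (y r \<kappa>)))"
    by (subst sum.atLeast_Suc_atMost) simp_all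
  also have "(\<Sum>l = Suc m..Suc m + t. \<Phi> (chain (Suc m + t - 1) l (y r \<kappa>))) = \<Phi> (y r \<kappa> * W t (Suc m) 0 \<kappa>)"
  proof (rule Suc.IH)
    show "\<Phi> f = 0" if "Suc m \<le> i" "i + 1 < Suc m + t" "f \<in> laur r" "T i f = - f" for i f
      using Suc.prems(1)[of i f] that by simp
  qed (use Suc.prems in auto)
  also have "\<Phi> (chain (m + t) m (y r \<kappa>)) =
    (\<Sum>G = 1..d. cst (topc d G) * \<Phi> (y r (\<kappa> + kalpha G m) * W t (Suc m) G (\<kappa> + kalpha G m)))"
    using Suc.prems by (intro chain_rows \<Phi>) (auto simp: d_def)
  also have "\<dots> + \<Phi> (y r \<kappa> * W t (Suc m) 0 \<kappa>) =
    (\<Sum>G = 0..d. cst (rowc d 0 G) * \<Phi> (y r (\<kappa> + kalpha G m) * W t (Suc m) G (\<kappa> + kalpha G m)))"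
  proof -
    have "{0..d} = insert 0 {1..d}" using d by auto
    then show ?thesis using d by (simp add: rowc_def)
  qed
  also have "\<dots> = \<Phi> (y r \<kappa> * W (Suc t) m 0 \<kappa>)"
  proof -
    have "y r \<kappa> * W (Suc t) m 0 \<kappa> =
      (\<Sum>G = 0..d. cst (rowc d 0 G) * (y r (\<kappa> + kalpha G m) * W t (Suc m) G (\<kappa> + kalpha G m)))"
      by (simp add: Let_def d_def sum_distrib_left y_def xpow_add xpow_diff mult_ac)
    then show ?thesis by (simp only: sum \<Phi>(2))
  qed
  finally show ?case .
qed

end

section \<open>Gelfand--Tsetlin patterns, one row at a time\<close>

definition Gam :: "(nat \<Rightarrow> int) \<Rightarrow> (nat \<Rightarrow> int) \<Rightarrow> nat \<Rightarrow> nat \<Rightarrow> int" where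
  "Gam \<nu> b m l = (\<Sum>i = m..l. b i - \<nu> i)"

text \<open>The counterpart of \<open>gt_factor\<close> for rows in increasing order:
  \<open>\<nu>\<close> is the upper row, \<open>b\<close> the lower one, and \<open>G\<close> the
  Gamma-value at position \<open>l\<close>.\<close>

definition entc :: "nat \<Rightarrow> complex \<Rightarrow> (int \<Rightarrow> complex) \<Rightarrow> (nat \<Rightarrow> int) \<Rightarrow> (nat \<Rightarrow> int) \<Rightarrow> nat \<Rightarrow> int \<Rightarrow> complex" where
  "entc n v g \<nu> b l G = (if b l = \<nu> l then (if \<nu> l = \<nu> (Suc l) then 0 else 1)
     else if b l < \<nu> (Suc l) then hflat n v G else gflat v g G)"

text \<open>\<open>demazure_crystal\<close> with the length of w replaced by a free bound L, so that
  the condition can be passed on to patterns of smaller rank.\<close>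

definition gt_trunc :: "nat \<Rightarrow> nat \<Rightarrow> (nat \<Rightarrow> int) \<Rightarrow> (nat \<Rightarrow> nat \<Rightarrow> int) set" where
  "gt_trunc s L \<kappa> = {a \<in> gt_patterns s \<kappa>.
     \<forall>i j. 1 \<le> i \<and> i \<le> j \<and> j \<le> s \<and> bzl_index s i j > L \<longrightarrow> gt_Gamma s a i j = 0}"

definition gts :: "nat \<Rightarrow> complex \<Rightarrow> (int \<Rightarrow> complex) \<Rightarrow> nat \<Rightarrow> nat \<Rightarrow> (nat \<Rightarrow> int) \<Rightarrow> ratfun" where
  "gts n v g s L \<kappa> = (\<Sum>a \<in> gt_trunc s L \<kappa>. cst (gt_coeff n v g s a) * xpow (gt_wt s a))"

text \<open>Rows are read from right to left, so that they increase and are indexed from 1: for the top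
  row \<open>\<kappa>\<close> of a pattern of rank \<open>s + 1\<close>, \<open>\<nu> l = \<kappa> (s + 2 - l)\<close>.\<close>

definition gt_rows :: "nat \<Rightarrow> nat \<Rightarrow> (nat \<Rightarrow> int) \<Rightarrow> (nat \<Rightarrow> int) set" where
  "gt_rows s L \<nu> = {b \<in> PiE {1..s} (\<lambda>l. {\<nu> l..\<nu> (Suc l)}).
     \<forall>l \<in> {1..s}. (s choose 2) + (Suc s - l) > L \<longrightarrow> Gam \<nu> b 1 l = 0}"

definition gt_glue :: "nat \<Rightarrow> (nat \<Rightarrow> int) \<Rightarrow> (nat \<Rightarrow> nat \<Rightarrow> int) \<Rightarrow> nat \<Rightarrow> nat \<Rightarrow> int" where
  "gt_glue s \<kappa> a i j = (if i = 0 then (if j \<le> Suc s then \<kappa> j else 0)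
     else if i \<le> j \<and> j \<le> Suc s then a (i - 1) (j - 1) else 0)"

lemma finite_gt_rows: "finite (gt_rows s L \<nu>)"
  unfolding gt_rows_def by (rule finite_subset[OF _ finite_PiE[of "{1..s}" "\<lambda>l. {\<nu> l..\<nu> (Suc l)}"]]) auto

lemma gt_Gamma_glue:
  assumes "1 \<le> i" "i \<le> j" "j \<le> s"
  shows "gt_Gamma (Suc s) (gt_glue s \<kappa> a) (Suc i) (Suc j) = gt_Gamma s a i j"
proof -
  have "gt_Gamma (Suc s) (gt_glue s \<kappa> a) (Suc i) (Suc j) = (\<Sum>k = j..s. gt_glue s \<kappa> a (Suc i) (Suc k) - gt_glue s \<kappa> a i (Suc k))"
    unfolding gt_Gamma_def by (simp add: sum.shift_bounds_cl_Suc_ivl del: sum.cl_ivl_Suc)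
  also have "\<dots> = gt_Gamma s a i j"
    unfolding gt_Gamma_def using assms by (intro sum.cong) (auto simp: gt_glue_def)
  finally show ?thesis .
qed

lemma gt_Gamma_top:
  assumes "a \<in> gt_patterns s (\<lambda>j. b (Suc s - j))" "1 \<le> j" "j \<le> Suc s"
  shows "gt_Gamma (Suc s) (gt_glue s \<kappa> a) 1 j = Gam (\<lambda>l. \<kappa> (s + 2 - l)) b 1 (s + 2 - j)"
proof -
  have "gt_Gamma (Suc s) (gt_glue s \<kappa> a) 1 j = (\<Sum>k = j..Suc s. b (s + 2 - k) - \<kappa> k)"
    unfolding gt_Gamma_def
  proof (intro sum.cong refl)
    fix k assume "k \<in> {j..Suc s}"
    moreover from this have "a 0 (k - 1) = b (Suc s - (k - 1))"
      using assms by (auto simp: gt_patterns_def)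
    ultimately show "gt_glue s \<kappa> a 1 k - gt_glue s \<kappa> a (1 - 1) k = b (s + 2 - k) - \<kappa> k"
      using assms by (auto simp: gt_glue_def Suc_diff_le)
  qed
  also have "\<dots> = Gam (\<lambda>l. \<kappa> (s + 2 - l)) b 1 (s + 2 - j)"
    unfolding Gam_def using assms
    by (intro sum.reindex_bij_witness[of _ "\<lambda>l. s + 2 - l" "\<lambda>k. s + 2 - k"]) auto
  finally show ?thesis .
qed

text \<open>\<open>bzl_index\<close> depends only on the distance of a row from the bottom and on
  the offset within the row, so deleting the top row leaves the indices of the remaining
  Gamma-entries unchanged. The truncation thus splits into a condition on the second row and the
  same condition, with the same L, below it.\<close>

lemma gt_glue_bij:
  defines "\<nu> \<equiv> \<lambda>\<kappa> s l. \<kappa> (s + 2 - l)"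
  shows "bij_betw (\<lambda>(b, a). gt_glue s \<kappa> a)
    (SIGMA b : gt_rows (Suc s) L (\<nu> \<kappa> s). gt_trunc s L (\<lambda>j. b (Suc s - j))) (gt_trunc (Suc s) L \<kappa>)"
proof (rule bij_betwI[where g = "\<lambda>a. (\<lambda>l. if l \<in> {1..Suc s} then a 1 (s + 2 - l) else undefined, \<lambda>i j. a (Suc i) (Suc j))"])
  let ?S = "SIGMA b : gt_rows (Suc s) L (\<nu> \<kappa> s). gt_trunc s L (\<lambda>j. b (Suc s - j))"
  let ?h = "\<lambda>a :: nat \<Rightarrow> nat \<Rightarrow> int. (\<lambda>l. if l \<in> {1..Suc s} then a 1 (s + 2 - l) else undefined, \<lambda>i j. a (Suc i) (Suc j))"
  show "(\<lambda>(b, a). gt_glue s \<kappa> a) \<in> ?S \<rightarrow> gt_trunc (Suc s) L \<kappa>"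
  proof clarify
    fix b a assume b: "b \<in> gt_rows (Suc s) L (\<nu> \<kappa> s)" and a: "a \<in> gt_trunc s L (\<lambda>j. b (Suc s - j))"
    have a0: "a 0 j = b (Suc s - j)" if "j \<le> s" for j using a that by (auto simp: gt_trunc_def gt_patterns_def)
    have ap: "a \<in> gt_patterns s (\<lambda>j. b (Suc s - j))" using a by (simp add: gt_trunc_def)
    have bl: "\<kappa> (s + 2 - l) \<le> b l" "b l \<le> \<kappa> (Suc s - l)" if "1 \<le> l" "l \<le> Suc s" for l
      using b that by (auto simp: gt_rows_def PiE_iff \<nu>_def)
    have "gt_glue s \<kappa> a \<in> gt_patterns (Suc s) \<kappa>"
      unfolding gt_patterns_def
    proof (intro CollectI conjI allI impI)
      fix i j assume ij: "1 \<le> i \<and> i \<le> j \<and> j \<le> Suc s"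
      have *: "gt_glue s \<kappa> a i j \<le> gt_glue s \<kappa> a (i - 1) (j - 1) \<and> gt_glue s \<kappa> a (i - 1) j \<le> gt_glue s \<kappa> a i j"
      proof (cases "i = 1")
        case True
        have l: "Suc s - (j - 1) = s + 2 - j" "s + 2 - (s + 2 - j) = j" "Suc s - (s + 2 - j) = j - 1" using ij by auto
        show ?thesis using True ij bl[of "s + 2 - j"] a0[of "j - 1"] unfolding gt_glue_def l by auto
      next
        case False
        obtain i' j' where i': "i = Suc (Suc i')" "j = Suc j'" using ij False
          by (metis One_nat_def Suc_le_D le_0_eq not_less_eq_eq le_SucE nat.exhaust)
        have "1 \<le> Suc i' \<and> Suc i' \<le> j' \<and> j' \<le> s" using ij i' by simp
        then have "a (Suc i' - 1) (j' - 1) \<ge> a (Suc i') j' \<and> a (Suc i') j' \<ge> a (Suc i' - 1) j'"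
          using ap unfolding gt_patterns_def by blast
        then show ?thesis using ij i' by (auto simp: gt_glue_def)
      qed
      show "gt_glue s \<kappa> a i j \<le> gt_glue s \<kappa> a (i - 1) (j - 1)" "gt_glue s \<kappa> a (i - 1) j \<le> gt_glue s \<kappa> a i j"
        using * by simp_all
    qed (auto simp: gt_glue_def)
    moreover have "gt_Gamma (Suc s) (gt_glue s \<kappa> a) i j = 0"
      if ij: "1 \<le> i \<and> i \<le> j \<and> j \<le> Suc s \<and> bzl_index (Suc s) i j > L" for i j
    proof (cases "i = 1")
      case True
      have "(Suc s choose 2) + (Suc (Suc s) - (s + 2 - j)) > L"
        using ij True by (auto simp: bzl_index_def)
      moreover have "s + 2 - j \<in> {1..Suc s}" using ij by auto
      ultimately have "Gam (\<nu> \<kappa> s) b 1 (s + 2 - j) = 0"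
        using b unfolding gt_rows_def by blast
      then show ?thesis using gt_Gamma_top[OF ap, of j] ij True by (simp add: \<nu>_def)
    next
      case False
      obtain i' j' where i': "i = Suc i'" "j = Suc j'" using ij
        by (metis One_nat_def Suc_le_D order.trans)
      then have "bzl_index s i' j' > L" using ij by (auto simp: bzl_index_def)
      then have "gt_Gamma s a i' j' = 0" using a ij i' False by (auto simp: gt_trunc_def)
      then show ?thesis using gt_Gamma_glue[of i' j' s \<kappa> a] ij i' False by simp
    qed
    ultimately show "gt_glue s \<kappa> a \<in> gt_trunc (Suc s) L \<kappa>" by (simp add: gt_trunc_def)
  qed
  have glue: "gt_glue s \<kappa> (\<lambda>i j. a (Suc i) (Suc j)) = a" if "a \<in> gt_patterns (Suc s) \<kappa>" for a
  proof (intro ext)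
    fix i j
    show "gt_glue s \<kappa> (\<lambda>i j. a (Suc i) (Suc j)) i j = a i j"
      using that by (cases i; cases j) (auto simp: gt_glue_def gt_patterns_def)
  qed
  show "?h \<in> gt_trunc (Suc s) L \<kappa> \<rightarrow> ?S"
  proof
    fix a assume a: "a \<in> gt_trunc (Suc s) L \<kappa>"
    then have ap: "a \<in> gt_patterns (Suc s) \<kappa>" by (simp add: gt_trunc_def)
    define b where "b = (\<lambda>l. if l \<in> {1..Suc s} then a 1 (s + 2 - l) else undefined)"
    define a' where "a' = (\<lambda>i j. a (Suc i) (Suc j))"
    have a': "a' \<in> gt_patterns s (\<lambda>j. b (Suc s - j))"
      unfolding gt_patterns_def
    proof (intro CollectI conjI allI impI)
      fix i j
      show "\<not> (i \<le> j \<and> j \<le> s) \<Longrightarrow> a' i j = 0"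
        using ap by (simp add: a'_def gt_patterns_def)
      show "j \<le> s \<Longrightarrow> a' 0 j = b (Suc s - j)"
        by (simp add: a'_def b_def Suc_diff_le)
      assume ij: "1 \<le> i \<and> i \<le> j \<and> j \<le> s"
      then have "1 \<le> Suc i \<and> Suc i \<le> Suc j \<and> Suc j \<le> Suc s" by simp
      then have "a (Suc i - 1) (Suc j - 1) \<ge> a (Suc i) (Suc j) \<and> a (Suc i) (Suc j) \<ge> a (Suc i - 1) (Suc j)"
        using ap unfolding gt_patterns_def by blast
      then show "a' i j \<le> a' (i - 1) (j - 1)" "a' (i - 1) j \<le> a' i j"
        using ij by (simp_all add: a'_def)
    qed
    have g: "gt_glue s \<kappa> a' = a" using glue[OF ap] by (simp add: a'_def)
    have "gt_Gamma s a' i j = 0" if ij: "1 \<le> i \<and> i \<le> j \<and> j \<le> s \<and> bzl_index s i j > L" for i j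
    proof -
      have "gt_Gamma (Suc s) a (Suc i) (Suc j) = 0"
        using a ij by (auto simp: gt_trunc_def bzl_index_def)
      then show ?thesis using gt_Gamma_glue[of i j s \<kappa> a'] ij g by simp
    qed
    then have "a' \<in> gt_trunc s L (\<lambda>j. b (Suc s - j))" using a' by (simp add: gt_trunc_def)
    moreover have "b \<in> gt_rows (Suc s) L (\<nu> \<kappa> s)"
      unfolding gt_rows_def
    proof (intro CollectI conjI ballI impI)
      show "b \<in> PiE {1..Suc s} (\<lambda>l. {\<nu> \<kappa> s l..\<nu> \<kappa> s (Suc l)})"
      proof (rule PiE_I)
        fix l assume l: "l \<in> {1..Suc s}"
        then have "1 \<le> (1::nat) \<and> 1 \<le> s + 2 - l \<and> s + 2 - l \<le> Suc s" by auto
        then have "a (1 - 1) (s + 2 - l - 1) \<ge> a 1 (s + 2 - l) \<and> a 1 (s + 2 - l) \<ge> a (1 - 1) (s + 2 - l)"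
          using ap unfolding gt_patterns_def by blast
        moreover have "a 0 (s + 2 - l - 1) = \<kappa> (s + 2 - l - 1)" "a 0 (s + 2 - l) = \<kappa> (s + 2 - l)"
          using ap l unfolding gt_patterns_def by auto
        ultimately show "b l \<in> {\<nu> \<kappa> s l..\<nu> \<kappa> s (Suc l)}"
          using l by (simp add: b_def \<nu>_def)
      qed (auto simp: b_def)
      fix l assume l: "l \<in> {1..Suc s}" "L < (Suc s choose 2) + (Suc (Suc s) - l)"
      then have "L < bzl_index (Suc s) 1 (s + 2 - l)" by (auto simp: bzl_index_def)
      moreover have "1 \<le> (1::nat)" "1 \<le> s + 2 - l" "s + 2 - l \<le> Suc s" using l by auto
      ultimately have "gt_Gamma (Suc s) a 1 (s + 2 - l) = 0"
        using a unfolding gt_trunc_def by blast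
      moreover have "s + 2 - (s + 2 - l) = l" using l by auto
      ultimately show "Gam (\<nu> \<kappa> s) b 1 l = 0"
        using gt_Gamma_top[OF a', of "s + 2 - l" \<kappa>] l g by (auto simp: \<nu>_def)
    qed
    ultimately show "?h a \<in> ?S" by (simp add: a'_def b_def)
  qed
  show "?h (case x of (b, a) \<Rightarrow> gt_glue s \<kappa> a) = x" if "x \<in> ?S" for x
  proof -
    obtain b a where x: "x = (b, a)" by force
    with that have b: "b \<in> gt_rows (Suc s) L (\<nu> \<kappa> s)" and a: "a \<in> gt_patterns s (\<lambda>j. b (Suc s - j))"
      by (auto simp: gt_trunc_def)
    have e1: "(if l \<in> {1..Suc s} then gt_glue s \<kappa> a 1 (s + 2 - l) else undefined) = b l" for l
    proof (cases "l \<in> {1..Suc s}")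
      case True
      then have "s + 2 - l - 1 \<le> s" by auto
      then have "a 0 (s + 2 - l - 1) = b (Suc s - (s + 2 - l - 1))"
        using a unfolding gt_patterns_def by blast
      moreover have "Suc s - (s + 2 - l - 1) = l" using True by auto
      ultimately show ?thesis using True by (auto simp: gt_glue_def)
    next
      case False
      then show ?thesis using b by (auto simp: gt_rows_def PiE_iff extensional_def)
    qed
    have e2: "gt_glue s \<kappa> a (Suc i) (Suc j) = a i j" for i j
      using a by (auto simp: gt_glue_def gt_patterns_def)
    show ?thesis unfolding x prod.case e1 e2 ..
  qed
  show "(case ?h a of (b, a) \<Rightarrow> gt_glue s \<kappa> a) = a" if "a \<in> gt_trunc (Suc s) L \<kappa>" for a
    using that glue by (simp add: gt_trunc_def)
qed

lemma gt_trunc_0: "gt_trunc 0 L \<kappa> = {\<lambda>i j. if i = 0 \<and> j = 0 then \<kappa> 0 else 0}"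
  by (auto simp: gt_trunc_def gt_patterns_def fun_eq_iff)

lemma finite_gt_trunc: "finite (gt_trunc s L \<kappa>)"
proof (induction s arbitrary: \<kappa>)
  case (Suc s)
  then show ?case
    using bij_betw_finite[OF gt_glue_bij[of s \<kappa> L]] finite_gt_rows by blast
qed (simp add: gt_trunc_0)

lemma gts_0: "gts n v g 0 L \<kappa> = xpow (single 1 (\<kappa> 0))"
  by (simp add: gts_def gt_trunc_0 gt_coeff_def gt_wt_def gt_d_def)

lemma gt_coeff_glue:
  assumes b: "b \<in> gt_rows (Suc s) L (\<lambda>l. \<kappa> (s + 2 - l))" and a: "a \<in> gt_patterns s (\<lambda>j. b (Suc s - j))"
  shows "gt_coeff n v g (Suc s) (gt_glue s \<kappa> a) =
    (\<Prod>l = 1..Suc s. entc n v g (\<lambda>l. \<kappa> (s + 2 - l)) b l (Gam (\<lambda>l. \<kappa> (s + 2 - l)) b 1 l)) * gt_coeff n v g s a"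
proof -
  let ?c = "gt_glue s \<kappa> a" and ?\<nu> = "\<lambda>l. \<kappa> (s + 2 - l)"
  have top: "gt_factor n v g (Suc s) ?c 1 j = entc n v g ?\<nu> b (s + 2 - j) (Gam ?\<nu> b 1 (s + 2 - j))"
    if j: "j \<in> {1..Suc s}" for j
  proof -
    have l: "s + 2 - (s + 2 - j) = j" "s + 2 - Suc (s + 2 - j) = j - 1" "Suc s - (j - 1) = s + 2 - j" using j by auto
    have "b (s + 2 - j) \<in> {?\<nu> (s + 2 - j)..?\<nu> (Suc (s + 2 - j))}"
      using b j by (auto simp: gt_rows_def dest!: PiE_mem[of _ _ _ "s + 2 - j"])
    then have le: "\<kappa> j \<le> b (s + 2 - j)" "b (s + 2 - j) \<le> \<kappa> (j - 1)" unfolding l by auto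
    have "a 0 (j - 1) = b (Suc s - (j - 1))" using a j by (auto simp: gt_patterns_def)
    then have c: "?c 1 j = b (s + 2 - j)" "?c 0 j = \<kappa> j" "?c 0 (j - 1) = \<kappa> (j - 1)"
      using j unfolding l by (auto simp: gt_glue_def)
    have G: "gt_Gamma (Suc s) ?c 1 j = Gam ?\<nu> b 1 (s + 2 - j)"
      using j by (intro gt_Gamma_top a) auto
    show ?thesis unfolding gt_factor_def entc_def G diff_self_eq_0 c l using le by auto
  qed
  have low: "gt_factor n v g (Suc s) ?c (Suc i) (Suc j) = gt_factor n v g s a i j"
    if "1 \<le> i" "i \<le> j" "j \<le> s" for i j
    unfolding gt_factor_def using that gt_Gamma_glue[OF that, of \<kappa> a] by (simp add: gt_glue_def)
  have "gt_coeff n v g (Suc s) ?c = (\<Prod>j = 1..Suc s. gt_factor n v g (Suc s) ?c 1 j) *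
     (\<Prod>i = Suc 1..Suc s. \<Prod>j = i..Suc s. gt_factor n v g (Suc s) ?c i j)"
    unfolding gt_coeff_def by (subst prod.atLeast_Suc_atMost) auto
  also have "(\<Prod>i = Suc 1..Suc s. \<Prod>j = i..Suc s. gt_factor n v g (Suc s) ?c i j) = gt_coeff n v g s a"
    unfolding gt_coeff_def prod.shift_bounds_cl_Suc_ivl
    by (intro prod.cong refl) (simp_all add: low)
  also have "(\<Prod>j = 1..Suc s. gt_factor n v g (Suc s) ?c 1 j) =
     (\<Prod>l = 1..Suc s. entc n v g ?\<nu> b l (Gam ?\<nu> b 1 l))"
    by (intro prod.reindex_bij_witness[of _ "\<lambda>l. s + 2 - l" "\<lambda>k. s + 2 - k"]) (auto simp: top simp del: One_nat_def)
  finally show ?thesis .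
qed

text \<open>The new last coordinate is d_0 - d_1. All top entries but the leftmost one,
  \<open>\<kappa> 0\<close>, pair with an entry of the second row, and these differences add up to
  the last Gamma-value.\<close>

lemma gt_wt_glue:
  assumes a: "a \<in> gt_patterns s (\<lambda>j. b (Suc s - j))"
  shows "gt_wt (Suc s) (gt_glue s \<kappa> a) = gt_wt s a +
    single (s + 2) (\<kappa> 0 - Gam (\<lambda>l. \<kappa> (s + 2 - l)) b 1 (Suc s))"
proof -
  let ?c = "gt_glue s \<kappa> a"
  have d: "gt_d (Suc s) ?c (Suc i) = gt_d s a i" for i
    unfolding gt_d_def sum.shift_bounds_cl_Suc_ivl by (intro sum.cong) (auto simp: gt_glue_def)
  have "gt_d (Suc s) ?c 0 - gt_d (Suc s) ?c 1 = \<kappa> 0 - Gam (\<lambda>l. \<kappa> (s + 2 - l)) b 1 (Suc s)"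
  proof -
    have "gt_d (Suc s) ?c 0 = \<kappa> 0 + (\<Sum>j = 1..Suc s. ?c 0 j)"
      unfolding gt_d_def by (subst sum.atLeast_Suc_atMost) (auto simp: gt_glue_def)
    moreover have "gt_d (Suc s) ?c 1 - (\<Sum>j = 1..Suc s. ?c 0 j) = Gam (\<lambda>l. \<kappa> (s + 2 - l)) b 1 (Suc s)"
      using gt_Gamma_top[OF a, of 1 \<kappa>] by (simp add: gt_d_def gt_Gamma_def sum_subtractf)
    ultimately show ?thesis by simp
  qed
  moreover have "gt_wt (Suc s) ?c = (\<Sum>m = 1..s+1. single m (gt_d (Suc s) ?c (Suc s + 1 - m) - gt_d (Suc s) ?c (Suc s + 2 - m)))
     + single (s + 2) (gt_d (Suc s) ?c 0 - gt_d (Suc s) ?c 1)"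
    by (simp add: gt_wt_def)
  moreover have "(\<Sum>m = 1..s+1. single m (gt_d (Suc s) ?c (Suc s + 1 - m) - gt_d (Suc s) ?c (Suc s + 2 - m))) = gt_wt s a"
    unfolding gt_wt_def
    by (intro sum.cong) (auto simp: d[symmetric] Suc_diff_le)
  ultimately show ?thesis by simp
qed

lemma gts_Suc:
  fixes \<kappa> s
  defines "\<nu> \<equiv> \<lambda>l. \<kappa> (s + 2 - l)"
  shows "gts n v g (Suc s) L \<kappa> = (\<Sum>b \<in> gt_rows (Suc s) L \<nu>.
    cst (\<Prod>l = 1..Suc s. entc n v g \<nu> b l (Gam \<nu> b 1 l)) *
    xpow (single (s + 2) (\<kappa> 0 - Gam \<nu> b 1 (Suc s))) * gts n v g s L (\<lambda>j. b (Suc s - j)))"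
proof -
  let ?S = "SIGMA b : gt_rows (Suc s) L \<nu>. gt_trunc s L (\<lambda>j. b (Suc s - j))"
  have "gts n v g (Suc s) L \<kappa> = (\<Sum>(b, a) \<in> ?S. cst (gt_coeff n v g (Suc s) (gt_glue s \<kappa> a)) * xpow (gt_wt (Suc s) (gt_glue s \<kappa> a)))"
    unfolding gts_def using sum.reindex_bij_betw[OF gt_glue_bij[of s \<kappa> L], of
      "\<lambda>a. cst (gt_coeff n v g (Suc s) a) * xpow (gt_wt (Suc s) a)"]
    by (simp add: case_prod_unfold \<nu>_def)
  also have "\<dots> = (\<Sum>(b, a) \<in> ?S. cst (\<Prod>l = 1..Suc s. entc n v g \<nu> b l (Gam \<nu> b 1 l)) *
    xpow (single (s + 2) (\<kappa> 0 - Gam \<nu> b 1 (Suc s))) * (cst (gt_coeff n v g s a) * xpow (gt_wt s a)))"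
  proof (intro sum.cong refl, clarify)
    fix b a assume "b \<in> gt_rows (Suc s) L \<nu>" "a \<in> gt_trunc s L (\<lambda>j. b (Suc s - j))"
    then have "b \<in> gt_rows (Suc s) L (\<lambda>l. \<kappa> (s + 2 - l))" "a \<in> gt_patterns s (\<lambda>j. b (Suc s - j))"
      by (simp_all add: gt_trunc_def \<nu>_def)
    then show "cst (gt_coeff n v g (Suc s) (gt_glue s \<kappa> a)) * xpow (gt_wt (Suc s) (gt_glue s \<kappa> a)) =
      cst (\<Prod>l = 1..Suc s. entc n v g \<nu> b l (Gam \<nu> b 1 l)) *
    xpow (single (s + 2) (\<kappa> 0 - Gam \<nu> b 1 (Suc s))) * (cst (gt_coeff n v g s a) * xpow (gt_wt s a))"
      unfolding \<nu>_def by (simp add: gt_coeff_glue gt_wt_glue cst_mult xpow_add mult_ac del: prod.cl_ivl_Suc)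
  qed
  also have "\<dots> = (\<Sum>b \<in> gt_rows (Suc s) L \<nu>. \<Sum>a \<in> gt_trunc s L (\<lambda>j. b (Suc s - j)).
     cst (\<Prod>l = 1..Suc s. entc n v g \<nu> b l (Gam \<nu> b 1 l)) *
    xpow (single (s + 2) (\<kappa> 0 - Gam \<nu> b 1 (Suc s))) * (cst (gt_coeff n v g s a) * xpow (gt_wt s a)))"
    by (subst sum.Sigma) (auto simp: finite_gt_rows finite_gt_trunc)
  finally show ?thesis unfolding gts_def by (simp only: sum_distrib_left)
qed

lemma sum_PiE_insert:
  assumes "i \<notin> I"
  shows "(\<Sum>f \<in> PiE (insert i I) A. h f) = (\<Sum>a \<in> A i. \<Sum>f \<in> PiE I A. h (f(i := a)))"
proof -
  have "(\<Sum>f \<in> PiE (insert i I) A. h f) = (\<Sum>(a, f) \<in> A i \<times> PiE I A. h (f(i := a)))"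
    unfolding PiE_insert_eq
    by (subst sum.reindex[OF inj_combinator[OF assms]]) (simp add: case_prod_unfold)
  then show ?thesis by (simp add: sum.cartesian_product)
qed

lemma Gam_Suc: "m \<le> Suc l \<Longrightarrow> Gam \<nu> b m (Suc l) = Gam \<nu> b m l + (b (Suc l) - \<nu> (Suc l))"
  by (simp add: Gam_def)

text \<open>Gamma-values are partial sums of the differences of entries, so their vanishing fixes
  the entries one after the other.\<close>

lemma Gam_eq_0_iff: "(\<forall>l \<in> {1..m}. Gam \<nu> b 1 l = 0) \<longleftrightarrow> (\<forall>l \<in> {1..m}. b l = \<nu> l)"
proof (induction m)
  case (Suc m)
  have "{1..Suc m} = insert (Suc m) {1..m}" by auto
  moreover have "Gam \<nu> b 1 m = 0" if "\<forall>l\<in>{1..m}. b l = \<nu> l"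
    using that by (simp add: Gam_def)
  ultimately show ?case using Suc Gam_Suc[of 1 m \<nu> b] by auto
qed simp

lemma gts_cong:
  assumes "\<And>j. j \<le> s \<Longrightarrow> \<kappa> j = \<kappa>' j"
  shows "gts n v g s L \<kappa> = gts n v g s L \<kappa>'"
proof -
  have "gt_patterns s \<kappa> = gt_patterns s \<kappa>'"
    unfolding gt_patterns_def using assms by (intro Collect_cong conj_cong refl) auto
  then show ?thesis by (simp add: gts_def gt_trunc_def)
qed

lemma gts_rows:
  assumes "\<And>l. 1 \<le> l \<Longrightarrow> l \<le> s + 2 \<Longrightarrow> \<kappa> (s + 2 - l) = \<nu> l"
  shows "gts n v g (Suc s) L \<kappa> = (\<Sum>b \<in> gt_rows (Suc s) L \<nu>.
    cst (\<Prod>l = 1..Suc s. entc n v g \<nu> b l (Gam \<nu> b 1 l)) *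
    xpow (single (s + 2) (\<nu> (s + 2) - Gam \<nu> b 1 (Suc s))) * gts n v g s L (\<lambda>j. b (Suc s - j)))"
proof -
  have G: "Gam (\<lambda>l. \<kappa> (s + 2 - l)) b 1 l = Gam \<nu> b 1 l" if "l \<le> Suc s" for b l
    unfolding Gam_def using assms that by (intro sum.cong) auto
  have rows: "gt_rows (Suc s) L (\<lambda>l. \<kappa> (s + 2 - l)) = gt_rows (Suc s) L \<nu>"
    unfolding gt_rows_def using G assms[of "Suc _"] assms
    by (intro Collect_cong conj_cong ball_cong arg_cong2[of _ _ _ _ "(\<in>)"] PiE_cong refl) (auto simp del: One_nat_def)
  have e: "entc n v g (\<lambda>l. \<kappa> (s + 2 - l)) b l x = entc n v g \<nu> b l x" if "1 \<le> l" "l \<le> Suc s" for b l x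
    unfolding entc_def using assms[of l] assms[of "Suc l"] that by simp
  have k0: "\<kappa> 0 = \<nu> (s + 2)" using assms[of "s + 2"] by simp
  show ?thesis
    unfolding gts_Suc rows k0
  proof (rule sum.cong[OF refl])
    fix b
    have "(\<Prod>l = 1..Suc s. entc n v g (\<lambda>l. \<kappa> (s + 2 - l)) b l (Gam (\<lambda>l. \<kappa> (s + 2 - l)) b 1 l)) =
      (\<Prod>l = 1..Suc s. entc n v g \<nu> b l (Gam \<nu> b 1 l))"
    proof (rule prod.cong[OF refl])
      fix l assume "l \<in> {1..Suc s}"
      then have "1 \<le> l" "l \<le> Suc s" by auto
      then show "entc n v g (\<lambda>l. \<kappa> (s + 2 - l)) b l (Gam (\<lambda>l. \<kappa> (s + 2 - l)) b 1 l) = entc n v g \<nu> b l (Gam \<nu> b 1 l)"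
        by (simp only: e G)
    qed
    then show "cst (\<Prod>l = 1..Suc s. entc n v g (\<lambda>l. \<kappa> (s + 2 - l)) b l (Gam (\<lambda>l. \<kappa> (s + 2 - l)) b 1 l)) *
         xpow (single (s + 2) (\<nu> (s + 2) - Gam (\<lambda>l. \<kappa> (s + 2 - l)) b 1 (Suc s))) *
         gts n v g s L (\<lambda>j. b (Suc s - j)) =
      cst (\<Prod>l = 1..Suc s. entc n v g \<nu> b l (Gam \<nu> b 1 l)) *
         xpow (single (s + 2) (\<nu> (s + 2) - Gam \<nu> b 1 (Suc s))) *
         gts n v g s L (\<lambda>j. b (Suc s - j))"
      by (simp only: G order_refl)
  qed
qed

section \<open>Matching the row expansions with patterns\<close>

context metaplectic
begin

text \<open>Each summation variable G' of \<open>W\<close> is the accumulated Gamma-value at its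
  position, so choosing them successively amounts to choosing a row b. The correction of
  \<open>\<nu>\<close> at m undoes the lowering by G.\<close>

lemma W_rows:
  fixes \<kappa> m G
  defines "\<nu> \<equiv> \<lambda>l. lookup \<kappa> l + (if l = m then G else 0)"
  shows "W t m G \<kappa> = (\<Sum>b \<in> PiE {m..<m+t} (\<lambda>l. {\<nu> l..\<nu> (Suc l)}).
    cst (\<Prod>l \<in> {m..<m+t}. entc n v g \<nu> b l (G + Gam \<nu> b m l)) *
    xpow (\<Sum>l \<in> {m..<m+t}. kalpha (G + Gam \<nu> b m l) l))"
  unfolding \<nu>_def
proof (induction t arbitrary: m G \<kappa>)
  case (Suc t)
  define \<nu> where "\<nu> l = lookup \<kappa> l + (if l = m then G else 0)" for l
  define d where "d = \<nu> (Suc m) - \<nu> m"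
  let ?I = "{Suc m..<Suc m + t}"
  have I: "{m..<m + Suc t} = insert m ?I" "m \<notin> ?I" "finite ?I" by auto
  define H where "H b = cst (\<Prod>l \<in> {m..<m+Suc t}. entc n v g \<nu> b l (G + Gam \<nu> b m l)) *
    xpow (\<Sum>l \<in> {m..<m+Suc t}. kalpha (G + Gam \<nu> b m l) l)" for b
  have inner: "cst (rowc d G G') * xpow (kalpha G' m) * W t (Suc m) G' (\<kappa> + kalpha G' m) =
     (\<Sum>b \<in> PiE ?I (\<lambda>l. {\<nu> l..\<nu> (Suc l)}). H (b(m := \<nu> m + (G' - G))))" if G': "G' \<in> {G..G+d}" for G'
  proof -
    define \<nu>' where "\<nu>' l = lookup (\<kappa> + kalpha G' m) l + (if l = Suc m then G' else 0)" for l
    have \<nu>': "\<nu>' l = \<nu> l" if "l > m" for l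
      using that by (auto simp: \<nu>'_def \<nu>_def lookup_add lookup_kalpha)
    have "W t (Suc m) G' (\<kappa> + kalpha G' m) = (\<Sum>b \<in> PiE ?I (\<lambda>l. {\<nu>' l..\<nu>' (Suc l)}).
      cst (\<Prod>l \<in> ?I. entc n v g \<nu>' b l (G' + Gam \<nu>' b (Suc m) l)) *
      xpow (\<Sum>l \<in> ?I. kalpha (G' + Gam \<nu>' b (Suc m) l) l))"
      unfolding \<nu>'_def by (rule Suc.IH)
    also have "PiE ?I (\<lambda>l. {\<nu>' l..\<nu>' (Suc l)}) = PiE ?I (\<lambda>l. {\<nu> l..\<nu> (Suc l)})"
      by (intro PiE_cong) (simp add: \<nu>')
    also have "(\<Sum>b \<in> PiE ?I (\<lambda>l. {\<nu> l..\<nu> (Suc l)}).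
      cst (\<Prod>l \<in> ?I. entc n v g \<nu>' b l (G' + Gam \<nu>' b (Suc m) l)) *
      xpow (\<Sum>l \<in> ?I. kalpha (G' + Gam \<nu>' b (Suc m) l) l)) =
      (\<Sum>b \<in> PiE ?I (\<lambda>l. {\<nu> l..\<nu> (Suc l)}).
      cst (\<Prod>l \<in> ?I. entc n v g \<nu> b l (G' + Gam \<nu> b (Suc m) l)) *
      xpow (\<Sum>l \<in> ?I. kalpha (G' + Gam \<nu> b (Suc m) l) l))"
    proof -
      have "Gam \<nu>' b (Suc m) l = Gam \<nu> b (Suc m) l" for b l
        unfolding Gam_def by (intro sum.cong) (auto simp: \<nu>')
      moreover have "entc n v g \<nu>' b l x = entc n v g \<nu> b l x" if "l \<in> ?I" for b l x
        using that by (auto simp: entc_def \<nu>')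
      ultimately show ?thesis by simp
    qed
    finally have W: "W t (Suc m) G' (\<kappa> + kalpha G' m) = \<dots>" .
    have H: "H (b(m := \<nu> m + (G' - G))) = cst (rowc d G G') * xpow (kalpha G' m) *
      (cst (\<Prod>l \<in> ?I. entc n v g \<nu> b l (G' + Gam \<nu> b (Suc m) l)) *
      xpow (\<Sum>l \<in> ?I. kalpha (G' + Gam \<nu> b (Suc m) l) l))" for b
    proof -
      let ?c = "b(m := \<nu> m + (G' - G))"
      have Gm: "G + Gam \<nu> ?c m m = G'" by (simp add: Gam_def)
      have Gl: "G + Gam \<nu> ?c m l = G' + Gam \<nu> b (Suc m) l" if "l \<in> ?I" for l
      proof -
        have "(\<Sum>i = Suc m..l. ?c i - \<nu> i) = (\<Sum>i = Suc m..l. b i - \<nu> i)"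
          by (intro sum.cong) auto
        then show ?thesis using that by (simp add: Gam_def sum.atLeast_Suc_atMost)
      qed
      have em: "entc n v g \<nu> ?c m G' = rowc d G G'"
        using G' by (auto simp: entc_def rowc_def topc_def d_def)
      have el: "entc n v g \<nu> ?c l x = entc n v g \<nu> b l x" if "l \<in> ?I" for l x
        using that by (simp add: entc_def)
      have "(\<Prod>l \<in> ?I. entc n v g \<nu> ?c l (G + Gam \<nu> ?c m l)) = (\<Prod>l \<in> ?I. entc n v g \<nu> b l (G' + Gam \<nu> b (Suc m) l))"
        by (intro prod.cong refl) (simp only: el Gl)
      moreover have "(\<Sum>l \<in> ?I. kalpha (G + Gam \<nu> ?c m l) l) = (\<Sum>l \<in> ?I. kalpha (G' + Gam \<nu> b (Suc m) l) l)"
        by (intro sum.cong refl) (simp only: Gl)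
      ultimately show ?thesis
        unfolding H_def I(1) using I(2,3) by (simp only: prod.insert sum.insert Gm em cst_mult xpow_add mult_ac not_False_eq_True)
    qed
    show ?thesis unfolding W H by (rule sum_distrib_left)
  qed
  have "W (Suc t) m G \<kappa> = (\<Sum>G' = G..G+d. cst (rowc d G G') * xpow (kalpha G' m) * W t (Suc m) G' (\<kappa> + kalpha G' m))"
    by (simp add: Let_def d_def \<nu>_def algebra_simps)
  also have "\<dots> = (\<Sum>G' = G..G+d. \<Sum>b \<in> PiE ?I (\<lambda>l. {\<nu> l..\<nu> (Suc l)}). H (b(m := \<nu> m + (G' - G))))"
    by (intro sum.cong refl inner)
  also have "\<dots> = (\<Sum>a \<in> {\<nu> m..\<nu> (Suc m)}. \<Sum>b \<in> PiE ?I (\<lambda>l. {\<nu> l..\<nu> (Suc l)}). H (b(m := a)))"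
    by (intro sum.reindex_bij_witness[of _ "\<lambda>a. a - \<nu> m + G" "\<lambda>G'. \<nu> m + (G' - G)"]) (auto simp: d_def)
  also have "\<dots> = (\<Sum>b \<in> PiE {m..<m + Suc t} (\<lambda>l. {\<nu> l..\<nu> (Suc l)}). H b)"
    unfolding I(1) by (rule sum_PiE_insert[symmetric]) simp
  finally show ?case unfolding H_def \<nu>_def .
qed (simp add: PiE_empty_domain)

text \<open>The part of the weight at positions that T_1, ..., T_k leave alone; it factors out of
  \<open>Z k\<close>.\<close>

definition hi :: "nat \<Rightarrow> nat \<Rightarrow> weight \<Rightarrow> weight" where
  "hi r k \<kappa> = (\<Sum>j = k + 2..r + 1. single j (lookup \<kappa> j))"

lemma lookup_hi: "lookup (hi r k \<kappa>) j = (if j \<in> {k+2..r+1} then lookup \<kappa> j else 0)"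
  unfolding hi_def by (simp add: lookup_sum lookup_single when_def del: sum.cl_ivl_Suc)

lemma lookup_sum_kalpha:
  assumes "finite I"
  shows "lookup (\<Sum>l \<in> I. kalpha (c l) l) j =
    (if j \<in> I then c j else 0) - (if j > 0 \<and> j - 1 \<in> I then c (j - 1) else 0)"
proof -
  have "lookup (\<Sum>l \<in> I. kalpha (c l) l) j =
     (\<Sum>l \<in> I. (if l = j then c l else 0) - (if l = j - 1 \<and> j > 0 then c l else 0))"
    unfolding lookup_sum by (intro sum.cong) (auto simp: lookup_kalpha)
  also have "\<dots> = (if j \<in> I then c j else 0) - (if j > 0 \<and> j - 1 \<in> I then c (j - 1) else 0)"
    using assms by (cases "j > 0") (simp_all add: sum_subtractf sum.delta)
  finally show ?thesis .
qed

text \<open>The chains \<open>T k \<circ> \<dots> \<circ> T m\<close> with \<open>m \<ge> m0\<close> produce the rows in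
  which only the entries from \<open>m0\<close> on may move.\<close>

lemma branching:
  fixes \<kappa> :: weight and s L m0 r :: nat
  defines "\<nu> \<equiv> lookup \<kappa>"
  assumes s: "Suc s \<le> r" and \<kappa>: "\<kappa> \<in> weights r"
    and incr: "\<And>i. 1 \<le> i \<Longrightarrow> i \<le> Suc s \<Longrightarrow> \<nu> i < \<nu> (Suc i)"
    and m0: "1 \<le> m0" "m0 \<le> s + 2"
    and L: "\<And>l. 1 \<le> l \<Longrightarrow> l \<le> Suc s \<Longrightarrow> (Suc s choose 2) + (s + 2 - l) > L \<longleftrightarrow> l < m0"
    and IH: "\<And>\<kappa>'. \<kappa>' \<in> weights r \<Longrightarrow>
      (\<And>i. 1 \<le> i \<Longrightarrow> i \<le> s \<Longrightarrow> lookup \<kappa>' i \<le> lookup \<kappa>' (Suc i)) \<Longrightarrow>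
      Z s (y r \<kappa>') = xpow (hi r s \<kappa>' - delta r) * gts n v g s L (\<lambda>j. lookup \<kappa>' (Suc s - j))"
  shows "(\<Sum>m = m0..s + 2. Z s (chain (Suc s) m (y r \<kappa>))) =
    xpow (hi r (Suc s) \<kappa> - delta r) * gts n v g (Suc s) L (\<lambda>j. lookup \<kappa> (s + 2 - j))"
proof -
  define t where "t = s + 2 - m0"
  have t: "m0 + t = s + 2" using m0 by (simp add: t_def)
  let ?I = "{m0..<m0+t}"
  have Zsum: "Z s (sum F A) = (\<Sum>a\<in>A. Z s (F a))" for F and A :: "(nat \<Rightarrow> int) set"
    using Z_cst[of s 0 0] by (induction A rule: infinite_finite_induct) (simp_all add: Z_add)
  define E where "E b = \<kappa> + (\<Sum>l \<in> ?I. kalpha (Gam \<nu> b m0 l) l)" for b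
  define ext where "ext b = (\<lambda>l. if l \<in> {1..<m0} then \<nu> l else b l)" for b :: "nat \<Rightarrow> int"
  have P: "PiE ?I (\<lambda>l. {\<nu> l..\<nu> (Suc l)}) = PiE {m0..Suc s} (\<lambda>l. {\<nu> l..\<nu> (Suc l)})"
    using t by (intro PiE_cong arg_cong2[of _ _ _ _ PiE]) (auto simp: Pi_def)
  have "(\<Sum>m = m0..s + 2. Z s (chain (Suc s) m (y r \<kappa>))) = Z s (y r \<kappa> * W t m0 0 \<kappa>)"
  proof -
    have "(\<Sum>l = m0..m0 + t. Z s (chain (m0 + t - 1) l (y r \<kappa>))) = Z s (y r \<kappa> * W t m0 0 \<kappa>)"
    proof (rule chain_sum_rows[of "Z s" m0 t r, OF Z_add Z_cst _ _ _ \<kappa>])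
      show "Z s f = 0" if "m0 \<le> i" "i + 1 < m0 + t" "f \<in> laur r" "T i f = - f" for i f
        using that m0 t s by (intro Z_kill[of f r i]) auto
    qed (use m0 t s incr in \<open>auto simp: \<nu>_def\<close>)
    then show ?thesis using t by simp
  qed
  also have "y r \<kappa> * W t m0 0 \<kappa> = (\<Sum>b \<in> PiE ?I (\<lambda>l. {\<nu> l..\<nu> (Suc l)}).
    cst (\<Prod>l \<in> ?I. entc n v g \<nu> b l (Gam \<nu> b m0 l)) * y r (E b))"
  proof -
    have "W t m0 0 \<kappa> = (\<Sum>b \<in> PiE ?I (\<lambda>l. {\<nu> l..\<nu> (Suc l)}).
      cst (\<Prod>l \<in> ?I. entc n v g \<nu> b l (Gam \<nu> b m0 l)) * xpow (\<Sum>l \<in> ?I. kalpha (Gam \<nu> b m0 l) l))"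
      using W_rows[of t m0 0 \<kappa>] by (simp add: \<nu>_def cong: if_cong)
    moreover have "y r (E b) = y r \<kappa> * xpow (\<Sum>l \<in> ?I. kalpha (Gam \<nu> b m0 l) l)" for b
      by (simp add: y_def E_def xpow_add[symmetric] diff_add_eq)
    ultimately show ?thesis by (simp add: sum_distrib_left mult.left_commute)
  qed
  also have "Z s \<dots> = (\<Sum>b \<in> PiE ?I (\<lambda>l. {\<nu> l..\<nu> (Suc l)}).
    cst (\<Prod>l \<in> ?I. entc n v g \<nu> b l (Gam \<nu> b m0 l)) * Z s (y r (E b)))"
    by (simp only: Zsum Z_cst)
  also have "\<dots> = (\<Sum>b \<in> PiE {m0..Suc s} (\<lambda>l. {\<nu> l..\<nu> (Suc l)}).
     xpow (hi r (Suc s) \<kappa> - delta r) * (cst (\<Prod>l = 1..Suc s. entc n v g \<nu> (ext b) l (Gam \<nu> (ext b) 1 l)) *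
     xpow (single (s + 2) (\<nu> (s + 2) - Gam \<nu> (ext b) 1 (Suc s))) * gts n v g s L (\<lambda>j. ext b (Suc s - j))))"
    unfolding P
  proof (rule sum.cong[OF refl])
    fix b assume b: "b \<in> PiE {m0..Suc s} (\<lambda>l. {\<nu> l..\<nu> (Suc l)})"
    have Gm: "Gam \<nu> (ext b) 1 l = (if l < m0 then 0 else Gam \<nu> b m0 l)" for l
    proof (cases "l < m0")
      case True
      then show ?thesis by (simp add: Gam_def ext_def)
    next
      case False
      then have "{1..l} = {1..<m0} \<union> {m0..l}" using m0 by auto
      then have "Gam \<nu> (ext b) 1 l = (\<Sum>i \<in> {1..<m0}. ext b i - \<nu> i) + (\<Sum>i = m0..l. ext b i - \<nu> i)"
        unfolding Gam_def by (simp only: sum.union_disjoint[OF finite_atLeastLessThan finite_atLeastAtMost] ivl_disj_int)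
      also have "(\<Sum>i \<in> {1..<m0}. ext b i - \<nu> i) = 0" by (simp add: ext_def)
      also have "(\<Sum>i = m0..l. ext b i - \<nu> i) = Gam \<nu> b m0 l"
        unfolding Gam_def by (intro sum.cong) (auto simp: ext_def)
      finally show ?thesis using False by simp
    qed
    \<comment> \<open>Position l gains the Gamma-value at l and loses the one at l - 1, which leaves
      the difference of b and \<nu> at l.\<close>
    have E: "lookup (E b) l = (if l \<in> {1..Suc s} then ext b l
        else if l = s + 2 then \<nu> l - Gam \<nu> (ext b) 1 (Suc s) else \<nu> l)" for l
    proof -
      have Gd: "Gam \<nu> b m0 l = Gam \<nu> b m0 (l - 1) + (b l - \<nu> l)" if "m0 < l"
        using Gam_Suc[of m0 "l - 1" \<nu> b] that by simp
      have G0: "Gam \<nu> b m0 m0 = b m0 - \<nu> m0" by (simp add: Gam_def)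
      have "lookup (E b) l = \<nu> l + ((if l \<in> ?I then Gam \<nu> b m0 l else 0) -
         (if l > 0 \<and> l - 1 \<in> ?I then Gam \<nu> b m0 (l - 1) else 0))"
        by (simp add: E_def lookup_add lookup_sum_kalpha \<nu>_def)
      moreover consider "l < m0" | "l = m0" | "m0 < l" "l \<le> Suc s" | "m0 < l" "l = s + 2" | "m0 < l" "l > s + 2"
        by linarith
      then have "\<nu> l + ((if l \<in> ?I then Gam \<nu> b m0 l else 0) - (if l > 0 \<and> l - 1 \<in> ?I then Gam \<nu> b m0 (l - 1) else 0))
        = (if l \<in> {1..Suc s} then ext b l
        else if l = s + 2 then \<nu> l - Gam \<nu> (ext b) 1 (Suc s) else \<nu> l)"
      proof cases
        case 1
        then show ?thesis using m0 t by (auto simp: ext_def)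
      next
        case 2
        then show ?thesis using m0 t Gm[of "Suc s"] by (cases "m0 = s + 2") (auto simp: G0 ext_def)
      next
        case 3
        then show ?thesis using m0 t Gd by (auto simp: ext_def)
      next
        case 4
        then show ?thesis using m0 t Gm[of "Suc s"] by auto
      next
        case 5
        then show ?thesis using m0 t by auto
      qed
      ultimately show ?thesis by simp
    qed
    have bb: "\<nu> l \<le> ext b l \<and> ext b l \<le> \<nu> (Suc l)" if "1 \<le> l" "l \<le> Suc s" for l
      using that b incr[of l] by (auto simp: ext_def PiE_iff)
    have w: "E b \<in> weights r"
      unfolding weights_iff E using \<kappa> s by (auto simp: weights_iff \<nu>_def)
    have "Z s (y r (E b)) = xpow (hi r s (E b) - delta r) * gts n v g s L (\<lambda>j. lookup (E b) (Suc s - j))"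
    proof (rule IH[OF w])
      fix i assume "1 \<le> i" "i \<le> s"
      then show "lookup (E b) i \<le> lookup (E b) (Suc i)"
        using bb[of i] bb[of "Suc i"] by (auto simp: E)
    qed
    also have "gts n v g s L (\<lambda>j. lookup (E b) (Suc s - j)) = gts n v g s L (\<lambda>j. ext b (Suc s - j))"
      by (rule gts_cong) (auto simp: E)
    also have "hi r s (E b) = hi r (Suc s) \<kappa> + single (s + 2) (\<nu> (s + 2) - Gam \<nu> (ext b) 1 (Suc s))"
      using s by (intro poly_mapping_eqI) (auto simp: lookup_hi E lookup_add lookup_single when_def \<nu>_def)
    finally have Z: "Z s (y r (E b)) = xpow (hi r (Suc s) \<kappa> - delta r) *
       (xpow (single (s + 2) (\<nu> (s + 2) - Gam \<nu> (ext b) 1 (Suc s))) * gts n v g s L (\<lambda>j. ext b (Suc s - j)))"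
      by (simp add: xpow_add xpow_diff)
    have "(\<Prod>l = 1..Suc s. entc n v g \<nu> (ext b) l (Gam \<nu> (ext b) 1 l)) = (\<Prod>l \<in> ?I. entc n v g \<nu> b l (Gam \<nu> b m0 l))"
    proof (rule prod.mono_neutral_cong_right)
      \<comment> \<open>Frozen entries have factor 1, and not 0, because \<nu> increases
        strictly.\<close>
      show "\<forall>l \<in> {1..Suc s} - ?I. entc n v g \<nu> (ext b) l (Gam \<nu> (ext b) 1 l) = 1"
      proof
        fix l assume l: "l \<in> {1..Suc s} - ?I"
        then have "\<nu> l < \<nu> (Suc l)" "l < m0" using incr[of l] t by auto
        then show "entc n v g \<nu> (ext b) l (Gam \<nu> (ext b) 1 l) = 1"
          using l by (simp add: entc_def ext_def)
      qed
      fix l assume "l \<in> ?I"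
      then show "entc n v g \<nu> (ext b) l (Gam \<nu> (ext b) 1 l) = entc n v g \<nu> b l (Gam \<nu> b m0 l)"
        unfolding Gm by (auto simp: entc_def ext_def)
    qed (use m0 t in auto)
    then show "cst (\<Prod>l \<in> ?I. entc n v g \<nu> b l (Gam \<nu> b m0 l)) * Z s (y r (E b)) =
      xpow (hi r (Suc s) \<kappa> - delta r) * (cst (\<Prod>l = 1..Suc s. entc n v g \<nu> (ext b) l (Gam \<nu> (ext b) 1 l)) *
     xpow (single (s + 2) (\<nu> (s + 2) - Gam \<nu> (ext b) 1 (Suc s))) * gts n v g s L (\<lambda>j. ext b (Suc s - j)))"
      unfolding Z by (simp only: mult_ac)
  qed
  also have "\<dots> = xpow (hi r (Suc s) \<kappa> - delta r) * (\<Sum>b \<in> gt_rows (Suc s) L \<nu>.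
     cst (\<Prod>l = 1..Suc s. entc n v g \<nu> b l (Gam \<nu> b 1 l)) *
     xpow (single (s + 2) (\<nu> (s + 2) - Gam \<nu> b 1 (Suc s))) * gts n v g s L (\<lambda>j. b (Suc s - j)))"
    unfolding sum_distrib_left
  proof (rule sum.reindex_bij_witness[of _ "\<lambda>b. restrict b {m0..Suc s}" ext])
    have rows: "b \<in> gt_rows (Suc s) L \<nu> \<longleftrightarrow> b \<in> PiE {1..Suc s} (\<lambda>l. {\<nu> l..\<nu> (Suc l)}) \<and> (\<forall>l \<in> {1..m0 - 1}. b l = \<nu> l)" for b
    proof -
      have "(\<forall>l \<in> {1..Suc s}. (Suc s choose 2) + (Suc (Suc s) - l) > L \<longrightarrow> Gam \<nu> b 1 l = 0) \<longleftrightarrow>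
         (\<forall>l \<in> {1..m0 - 1}. Gam \<nu> b 1 l = 0)"
        using L m0 by (auto simp del: One_nat_def)
      then show ?thesis unfolding gt_rows_def Gam_eq_0_iff by auto
    qed
    fix b
    show "restrict (ext b) {m0..Suc s} = b" if "b \<in> PiE {m0..Suc s} (\<lambda>l. {\<nu> l..\<nu> (Suc l)})"
      using that by (auto simp: fun_eq_iff ext_def restrict_def PiE_iff extensional_def)
    show "ext b \<in> gt_rows (Suc s) L \<nu>" if "b \<in> PiE {m0..Suc s} (\<lambda>l. {\<nu> l..\<nu> (Suc l)})"
      unfolding rows using that incr m0 by (auto simp: ext_def PiE_iff extensional_def less_imp_le)
    show "ext (restrict b {m0..Suc s}) = b" if "b \<in> gt_rows (Suc s) L \<nu>"
      using that m0 unfolding rows by (auto simp: fun_eq_iff ext_def restrict_def PiE_iff extensional_def)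
    show "restrict b {m0..Suc s} \<in> PiE {m0..Suc s} (\<lambda>l. {\<nu> l..\<nu> (Suc l)})" if "b \<in> gt_rows (Suc s) L \<nu>"
      using that m0 unfolding rows by (auto simp: PiE_iff)
  qed simp
  also have "(\<Sum>b \<in> gt_rows (Suc s) L \<nu>.
     cst (\<Prod>l = 1..Suc s. entc n v g \<nu> b l (Gam \<nu> b 1 l)) *
     xpow (single (s + 2) (\<nu> (s + 2) - Gam \<nu> b 1 (Suc s))) * gts n v g s L (\<lambda>j. b (Suc s - j))) =
     gts n v g (Suc s) L (\<lambda>j. lookup \<kappa> (s + 2 - j))"
    by (rule gts_rows[symmetric]) (simp add: \<nu>_def)
  finally show ?thesis .
qed

text \<open>The bound on L makes the truncation vacuous. Weakly increasing weights have to be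
  covered, since a strict row can have non-strict rows below it. If two adjacent entries agree, the
  left side is 0 by \<open>Z_kill\<close>, and on the right interlacing pins the entry between them,
  whose factor is then 0.\<close>

lemma Z_full:
  assumes "k \<le> r" "\<kappa> \<in> weights r" "(Suc k choose 2) \<le> L"
    and "\<And>i. 1 \<le> i \<Longrightarrow> i \<le> k \<Longrightarrow> lookup \<kappa> i \<le> lookup \<kappa> (Suc i)"
  shows "Z k (y r \<kappa>) = xpow (hi r k \<kappa> - delta r) * gts n v g k L (\<lambda>j. lookup \<kappa> (Suc k - j))"
  using assms
proof (induction k arbitrary: \<kappa>)
  case 0
  have "\<kappa> = hi r 0 \<kappa> + single 1 (lookup \<kappa> 1)"
    using 0 by (intro poly_mapping_eqI) (auto simp: lookup_add lookup_hi lookup_single when_def weights_iff)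
  then have "y r \<kappa> = xpow (hi r 0 \<kappa> + single 1 (lookup \<kappa> 1) - delta r)"
    by (simp add: y_def)
  then show ?case by (simp add: gts_0 xpow_add xpow_diff)
next
  case (Suc s)
  have ch: "(Suc (Suc s) choose 2) = (Suc s choose 2) + Suc s" by (simp add: numeral_2_eq_2)
  show ?case
  proof (cases "\<forall>i. 1 \<le> i \<longrightarrow> i \<le> Suc s \<longrightarrow> lookup \<kappa> i < lookup \<kappa> (Suc i)")
    case True
    have "(\<Sum>m = 1..s + 2. Z s (chain (Suc s) m (y r \<kappa>))) =
      xpow (hi r (Suc s) \<kappa> - delta r) * gts n v g (Suc s) L (\<lambda>j. lookup \<kappa> (s + 2 - j))"
    proof (rule branching)
      show "Z s (y r \<kappa>') = xpow (hi r s \<kappa>' - delta r) * gts n v g s L (\<lambda>j. lookup \<kappa>' (Suc s - j))"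
        if "\<kappa>' \<in> weights r" "\<And>i. 1 \<le> i \<Longrightarrow> i \<le> s \<Longrightarrow> lookup \<kappa>' i \<le> lookup \<kappa>' (Suc i)" for \<kappa>'
        using that Suc.prems ch by (intro Suc.IH) auto
    qed (use True Suc.prems ch in auto)
    then show ?thesis by simp
  next
    case False
    then obtain i where i: "1 \<le> i" "i \<le> Suc s" "lookup \<kappa> (Suc i) = lookup \<kappa> i"
      using Suc.prems(4) by (metis antisym not_less)
    have "Z (Suc s) (y r \<kappa>) = 0"
      using i Suc.prems by (intro Z_kill[of _ r i] y_laur T_y_0) auto
    moreover have "gts n v g (Suc s) L (\<lambda>j. lookup \<kappa> (s + 2 - j)) = 0"
    proof -
      have "entc n v g (lookup \<kappa>) b i x = 0" if "b \<in> gt_rows (Suc s) L (lookup \<kappa>)" for b x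
      proof -
        have "b \<in> PiE {1..Suc s} (\<lambda>l. {lookup \<kappa> l..lookup \<kappa> (Suc l)})"
          using that unfolding gt_rows_def by blast
        from PiE_mem[OF this, of i] i
        have "b i \<in> {lookup \<kappa> i..lookup \<kappa> (Suc i)}" by simp
        then show ?thesis using i by (simp add: entc_def)
      qed
      then have p0: "(\<Prod>l = 1..Suc s. entc n v g (lookup \<kappa>) b l (Gam (lookup \<kappa>) b 1 l)) = 0"
        if "b \<in> gt_rows (Suc s) L (lookup \<kappa>)" for b
        using that i by (intro prod_zero bexI[of _ i]) auto
      show ?thesis
      proof (subst gts_rows[of s _ "lookup \<kappa>"])
        show "lookup \<kappa> (s + 2 - (s + 2 - l)) = lookup \<kappa> l" if "l \<le> s + 2" for l
          using that by simp
      qed (intro sum.neutral ballI, simp only: p0 cst_0 mult_zero_left)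
    qed
    ultimately show ?thesis by simp
  qed
qed

text \<open>The Gamma-entries of the d upper steps have index above L and vanish, so each of these
  rows repeats the one above it without its largest entry. Strictness gives the factor 1, and the
  dropped entries form the monomial.\<close>

lemma gts_peel:
  fixes \<nu> :: "nat \<Rightarrow> int"
  assumes "L \<le> (Suc k choose 2)" "\<And>i. 1 \<le> i \<Longrightarrow> i \<le> k + d \<Longrightarrow> \<nu> i < \<nu> (Suc i)"
  shows "gts n v g (k + d) L (\<lambda>j. \<nu> (Suc (k + d) - j)) =
    xpow (\<Sum>j = k + 2..k + d + 1. single j (\<nu> j)) * gts n v g k L (\<lambda>j. \<nu> (Suc k - j))"
  using assms(2)
proof (induction d)
  case (Suc d)
  define s where "s = k + d"
  define b where "b = restrict \<nu> {1..Suc s}"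
  have "(Suc k choose 2) \<le> (Suc s choose 2)" by (rule binomial_right_mono) (simp add: s_def)
  with assms(1) have L: "L \<le> (Suc s choose 2)" by simp
  have rows: "gt_rows (Suc s) L \<nu> = {b}"
  proof (intro equalityI subsetI)
    fix c assume c: "c \<in> gt_rows (Suc s) L \<nu>"
    then have "\<forall>l \<in> {1..Suc s}. Gam \<nu> c 1 l = 0" using L by (auto simp: gt_rows_def simp del: One_nat_def)
    then have "\<forall>l \<in> {1..Suc s}. c l = \<nu> l" by (simp only: Gam_eq_0_iff)
    then show "c \<in> {b}" using c by (auto simp: b_def gt_rows_def fun_eq_iff PiE_iff extensional_def restrict_def)
  next
    fix c assume "c \<in> {b}"
    moreover have "\<forall>l \<in> {1..Suc s}. Gam \<nu> b 1 l = 0" unfolding Gam_eq_0_iff by (simp add: b_def)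
    moreover have "b \<in> PiE {1..Suc s} (\<lambda>l. {\<nu> l..\<nu> (Suc l)})"
      using Suc.prems by (auto simp: b_def s_def PiE_iff extensional_def less_imp_le)
    ultimately show "c \<in> gt_rows (Suc s) L \<nu>" by (simp add: gt_rows_def)
  qed
  have G: "Gam \<nu> b 1 (Suc s) = 0" by (simp add: Gam_def b_def)
  have "(\<Prod>l = 1..Suc s. entc n v g \<nu> b l (Gam \<nu> b 1 l)) = 1"
    using Suc.prems by (intro prod.neutral) (auto simp: entc_def b_def s_def less_imp_neq)
  then have "gts n v g (Suc s) L (\<lambda>j. \<nu> (s + 2 - j)) =
     xpow (single (s + 2) (\<nu> (s + 2))) * gts n v g s L (\<lambda>j. b (Suc s - j))"
    using gts_rows[of s "\<lambda>j. \<nu> (s + 2 - j)" \<nu> n v g L] by (simp add: rows G[simplified] del: prod.cl_ivl_Suc)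
  also have "gts n v g s L (\<lambda>j. b (Suc s - j)) = gts n v g s L (\<lambda>j. \<nu> (Suc s - j))"
    by (rule gts_cong) (auto simp: b_def)
  also have "\<dots> = xpow (\<Sum>j = k + 2..k + d + 1. single j (\<nu> j)) * gts n v g k L (\<lambda>j. \<nu> (Suc k - j))"
    unfolding s_def using Suc.prems by (intro Suc.IH) auto
  finally show ?case by (simp add: s_def xpow_add mult_ac)
qed simp

end

section \<open>The symmetric group\<close>

abbreviation pinv :: "(nat \<Rightarrow> nat) \<Rightarrow> nat \<Rightarrow> nat" where
  "pinv u \<equiv> inv_into UNIV u"

section \<open>Length as the number of inversions\<close>

definition Invs :: "nat \<Rightarrow> (nat \<Rightarrow> nat) \<Rightarrow> (nat \<times> nat) set" where
  "Invs r u = {(a, b). 1 \<le> a \<and> a < b \<and> b \<le> r + 1 \<and> u b < u a}"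

definition invs :: "nat \<Rightarrow> (nat \<Rightarrow> nat) \<Rightarrow> nat" where
  "invs r u = card (Invs r u)"

lemma finite_Invs [simp]: "finite (Invs r u)"
  by (rule finite_subset[of _ "{1..r+1} \<times> {1..r+1}"]) (auto simp: Invs_def)

text \<open>The map \<phi> applies the transposition to both members of an inversion of u if this
  keeps them in increasing order, and otherwise leaves the pair alone. It is injective into the
  inversions of the product and misses the pair (a, b).\<close>

lemma invs_less_transpose:
  assumes "inj u" "1 \<le> a" "a < b" "b \<le> r + 1" "u a < u b"
  shows "invs r u < invs r (u \<circ> Transposition.transpose a b)"
proof -
  let ?t = "Transposition.transpose a b"
  define \<phi> where "\<phi> = (\<lambda>(c, d). if ?t c < ?t d then (?t c, ?t d) else (c, d))"
  have mem: "\<phi> x \<in> Invs r (u \<circ> ?t) - {(a, b)}" if "x \<in> Invs r u" for x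
  proof -
    obtain c d where x: "x = (c, d)" by force
    then have cd: "1 \<le> c" "c < d" "d \<le> r + 1" "u d < u c" using that by (auto simp: Invs_def)
    have "\<phi> (c, d) \<in> {(c, d). 1 \<le> c \<and> c < d \<and> d \<le> r + 1 \<and> u (?t d) < u (?t c)} - {(a, b)}"
      using assms cd unfolding \<phi>_def transpose_def
      by (cases "c = a"; cases "c = b"; cases "d = a"; cases "d = b") (auto simp: not_less)
    then show ?thesis unfolding x Invs_def by simp
  qed
  have "inj_on \<phi> (Invs r u)"
  proof (rule inj_onI)
    fix x x' assume "x \<in> Invs r u" "x' \<in> Invs r u" and e: "\<phi> x = \<phi> x'"
    then obtain c d c' d' where x: "x = (c, d)" "x' = (c', d')" "c < d" "c' < d'"
      by (auto simp: Invs_def)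
    have tt: "?t (?t z) = z" for z by simp
    have e': "(if ?t c < ?t d then (?t c, ?t d) else (c, d)) = (if ?t c' < ?t d' then (?t c', ?t d') else (c', d'))"
      using e by (simp add: x(1,2) \<phi>_def)
    show "x = x'"
    proof (cases "?t c < ?t d")
      case True
      show ?thesis
      proof (cases "?t c' < ?t d'")
        case False
        then have "c' = ?t c" "d' = ?t d" using e' True by auto
        then show ?thesis using False x(3) tt by metis
      qed (use e' True x tt in \<open>metis prod.inject\<close>)
    next
      case False
      show ?thesis
      proof (cases "?t c' < ?t d'")
        case True
        then have "c = ?t c'" "d = ?t d'" using e' False by auto
        then show ?thesis using False x(4) tt by metis
      qed (use e' False x in simp)
    qed
  qed
  then have "invs r u = card (\<phi> ` Invs r u)" by (simp add: invs_def card_image)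
  also have "\<dots> \<le> card (Invs r (u \<circ> ?t) - {(a, b)})"
    by (intro card_mono image_subsetI mem) simp_all
  also have "\<dots> < card (Invs r (u \<circ> ?t))"
    by (rule card_Diff1_less[OF finite_Invs]) (use assms in \<open>simp add: Invs_def\<close>)
  finally show ?thesis by (simp add: invs_def)
qed

lemma invs_id: "invs r id = 0"
proof -
  have "Invs r id = {}" by (auto simp: Invs_def)
  then show ?thesis by (simp add: invs_def)
qed

lemma sigma_permutes: "1 \<le> i \<Longrightarrow> i \<le> r \<Longrightarrow> sigma i permutes {1..r+1}"
  unfolding sigma_def by (rule permutes_swap_id) auto

lemma sigma_comp_sigma [simp]: "sigma i \<circ> sigma i = id" "sigma i \<circ> (sigma i \<circ> u) = u"
  by (simp_all add: sigma_def fun_eq_iff)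

text \<open>Left multiplication exchanges the values i and i + 1, so only the pair formed by their
  positions can change its status.\<close>

lemma invs_sigma_up:
  assumes u: "u permutes {1..r+1}" and i: "1 \<le> i" "i \<le> r" and less: "pinv u i < pinv u (Suc i)"
  shows "invs r (sigma i \<circ> u) = Suc (invs r u)"
proof -
  define a b where "a = pinv u i" and "b = pinv u (Suc i)"
  have ua: "u a = i" "u b = Suc i" using u by (simp_all add: a_def b_def permutes_inverses)
  have ab: "a < b" "1 \<le> a" "b \<le> r + 1"
    using less i permutes_in_image[OF u, of a] permutes_in_image[OF u, of b] ua by (auto simp: a_def b_def)
  have inj: "u c = u d \<longleftrightarrow> c = d" for c d using permutes_inj[OF u] by (simp add: inj_eq)
  have "Invs r (sigma i \<circ> u) = insert (a, b) (Invs r u)"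
  proof -
    have "sigma i (u d) < sigma i (u c) \<longleftrightarrow> u d < u c \<or> (c, d) = (a, b)" if "c < d" for c d
    proof -
      have "u c = i \<longleftrightarrow> c = a" "u c = Suc i \<longleftrightarrow> c = b" "u d = i \<longleftrightarrow> d = a" "u d = Suc i \<longleftrightarrow> d = b"
        using inj ua by metis+
      then show ?thesis using that ab(1) by (auto simp: sigma_def transpose_def)
    qed
    then show ?thesis using ab by (auto simp: Invs_def)
  qed
  moreover have "(a, b) \<notin> Invs r u" using ua by (simp add: Invs_def)
  ultimately show ?thesis by (simp add: invs_def)
qed

lemma pinv_sigma_comp:
  assumes "u permutes S"
  shows "pinv (sigma i \<circ> u) x = pinv u (sigma i x)"
proof -
  have "bij u" "bij (sigma i)" using permutes_bij[OF assms] by (simp_all add: sigma_def)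
  then have "pinv (sigma i \<circ> u) = pinv u \<circ> pinv (sigma i)" by (simp add: o_inv_distrib)
  moreover have "pinv (sigma i) = sigma i" by (rule inv_unique_comp) simp_all
  ultimately show ?thesis by simp
qed

lemma pinv_sigma_simps:
  assumes "u permutes S"
  shows "pinv (sigma i \<circ> u) i = pinv u (Suc i)" "pinv (sigma i \<circ> u) (Suc i) = pinv u i"
    "x \<noteq> i \<Longrightarrow> x \<noteq> Suc i \<Longrightarrow> pinv (sigma i \<circ> u) x = pinv u x"
  unfolding pinv_sigma_comp[OF assms] by (simp_all add: sigma_def)

lemma invs_sigma_down:
  assumes u: "u permutes {1..r+1}" and i: "1 \<le> i" "i \<le> r" and less: "pinv u (Suc i) < pinv u i"
  shows "Suc (invs r (sigma i \<circ> u)) = invs r u"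
proof -
  have "sigma i \<circ> u permutes {1..r+1}" using permutes_compose[OF u sigma_permutes[OF i]] .
  moreover have "pinv (sigma i \<circ> u) i < pinv (sigma i \<circ> u) (Suc i)"
    using less by (simp add: pinv_sigma_simps[OF u])
  ultimately show ?thesis using invs_sigma_up[of "sigma i \<circ> u" r i] i by simp
qed

lemma pinv_neq: "u permutes S \<Longrightarrow> x \<noteq> y \<Longrightarrow> pinv u x \<noteq> pinv u y"
  by (metis permutes_inverses(1))

lemma invs_sigma_le:
  assumes u: "u permutes {1..r+1}" and i: "1 \<le> i" "i \<le> r"
  shows "invs r (sigma i \<circ> u) \<le> Suc (invs r u)"
  using invs_sigma_up[OF assms] invs_sigma_down[OF assms] pinv_neq[OF u, of i "Suc i"]
  by (cases "pinv u i < pinv u (Suc i)") auto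

section \<open>Words, reduced words and Matsumoto's theorem\<close>

lemma word_perm_simps [simp]: "word_perm [] = id" "word_perm (i # is) = sigma i \<circ> word_perm is"
  by (simp_all add: word_perm_def)

lemma word_perm_append: "word_perm (is @ js) = word_perm is \<circ> word_perm js"
  by (induction "is") (simp_all add: o_assoc)

lemma word_perm_permutes: "set is \<subseteq> {1..r} \<Longrightarrow> word_perm is permutes {1..r+1}"
  by (induction "is") (auto intro: permutes_compose sigma_permutes simp: permutes_id simp del: One_nat_def)

lemma invs_word_le: "set is \<subseteq> {1..r} \<Longrightarrow> invs r (word_perm is) \<le> length is"
proof (induction "is")
  case (Cons i "is")
  then have "invs r (word_perm (i # is)) \<le> Suc (invs r (word_perm is))"
    unfolding word_perm_simps by (intro invs_sigma_le word_perm_permutes) auto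
  moreover have "invs r (word_perm is) \<le> length is" using Cons by simp
  ultimately show ?case unfolding length_Cons by linarith
qed (simp add: invs_id)

lemma increasing_permutes_id:
  fixes f :: "nat \<Rightarrow> nat"
  assumes f: "f permutes {1..m}" and incr: "\<And>p q. 1 \<le> p \<Longrightarrow> p < q \<Longrightarrow> q \<le> m \<Longrightarrow> f p < f q"
  shows "f = id"
proof -
  have ge: "f p \<ge> p" if "1 \<le> p" "p \<le> m" for p
    using that
  proof (induction p rule: nat_induct_at_least[of 1])
    case base
    then show ?case using permutes_in_image[OF f, of 1] by simp
  next
    case (Suc p)
    then show ?case using incr[of p "Suc p"] by simp
  qed
  have le: "f p \<le> p" if "1 \<le> p" "p \<le> m" for p
  proof -
    have "f q + (m - q) \<le> m" if "1 \<le> q" "q \<le> m" for q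
      using that(2,1)
    proof (induction q rule: inc_induct)
      case base
      then show ?case using permutes_in_image[OF f, of m] by simp
    next
      case (step q)
      then show ?case using incr[of q "Suc q"] by simp
    qed
    then show ?thesis using that by force
  qed
  show ?thesis
  proof
    fix p show "f p = id p"
      using ge[of p] le[of p] permutes_not_in[OF f, of p] by (cases "p \<in> {1..m}") auto
  qed
qed

lemma exists_descent:
  assumes u: "u permutes {1..r+1}" and "u \<noteq> id"
  shows "\<exists>i. 1 \<le> i \<and> i \<le> r \<and> pinv u (Suc i) < pinv u i"
proof (rule ccontr)
  assume *: "\<not> ?thesis"
  have "pinv u p < pinv u q" if "1 \<le> p" "p < q" "q \<le> r + 1" for p q
    using that(2,3)
  proof (induction q)
    case (Suc q)
    have "pinv u q < pinv u (Suc q)" if "1 \<le> q" "q \<le> r" for q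
      using * that pinv_neq[OF u, of q "Suc q"] by force
    then show ?case using Suc \<open>1 \<le> p\<close> by (cases "p = q") (auto intro: less_trans)
  qed simp
  then have "pinv u = id" by (intro increasing_permutes_id[OF permutes_inv[OF u]])
  then have "u = id" by (metis u permutes_inv_inv inv_id)
  then show False using assms by simp
qed

lemma exists_reduced:
  assumes "u permutes {1..r+1}"
  shows "\<exists>is. set is \<subseteq> {1..r} \<and> word_perm is = u \<and> length is = invs r u"
  using assms
proof (induction "invs r u" arbitrary: u rule: less_induct)
  case less
  show ?case
  proof (cases "u = id")
    case True
    then show ?thesis by (intro exI[of _ "[]"]) (simp add: invs_id)
  next
    case False
    then obtain i where i: "1 \<le> i" "i \<le> r" "pinv u (Suc i) < pinv u i"
      using exists_descent[OF less.prems] by blast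
    have d: "Suc (invs r (sigma i \<circ> u)) = invs r u" using invs_sigma_down[OF less.prems i] .
    have "sigma i \<circ> u permutes {1..r+1}" using permutes_compose[OF less.prems sigma_permutes[OF i(1,2)]] .
    with less.hyps[of "sigma i \<circ> u"] d obtain js where
      "set js \<subseteq> {1..r}" "word_perm js = sigma i \<circ> u" "length js = invs r (sigma i \<circ> u)" by auto
    with d i show ?thesis by (intro exI[of _ "i # js"]) auto
  qed
qed

text \<open>A letter raises the inversion number by at most one, and a permutation other than the
  identity has a descent whose removal lowers it by one.\<close>

lemma ell_eq_invs:
  assumes "u permutes {1..r+1}"
  shows "ell r u = invs r u"
  unfolding ell_def
proof (rule Least_equality)
  show "\<exists>is. set is \<subseteq> {1..r} \<and> word_perm is = u \<and> length is = invs r u" by (rule exists_reduced[OF assms])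
qed (use invs_word_le in auto)

lemma exists_reduced_word:
  assumes "u permutes {1..r+1}"
  shows "\<exists>is. reduced_word r u is"
  using exists_reduced[OF assms] by (simp add: reduced_word_def ell_eq_invs[OF assms])

lemma reduced_word_tl:
  assumes "reduced_word r u (i # is)"
  shows "reduced_word r (sigma i \<circ> u) is" "1 \<le> i" "i \<le> r" "pinv u (Suc i) < pinv u i" "u permutes {1..r+1}"
proof -
  let ?u' = "word_perm is"
  have set_is: "set is \<subseteq> {1..r}" and i: "1 \<le> i" "i \<le> r" and u: "u = sigma i \<circ> ?u'"
    using assms by (auto simp: reduced_word_def)
  have u': "?u' permutes {1..r+1}" using word_perm_permutes[OF set_is] .
  show up: "u permutes {1..r+1}" unfolding u using permutes_compose[OF u' sigma_permutes[OF i]] .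
  have len: "Suc (length is) = invs r u" using assms ell_eq_invs[OF up] by (simp add: reduced_word_def)
  have "invs r u \<le> Suc (invs r ?u')" unfolding u by (rule invs_sigma_le[OF u' i])
  with len invs_word_le[OF set_is] have l: "length is = invs r ?u'" by simp
  have e: "sigma i \<circ> u = ?u'" unfolding u by simp
  show "reduced_word r (sigma i \<circ> u) is"
    unfolding e reduced_word_def using set_is l ell_eq_invs[OF u'] by simp
  show "1 \<le> i" "i \<le> r" by fact+
  show "pinv u (Suc i) < pinv u i"
  proof (rule ccontr)
    assume "\<not> pinv u (Suc i) < pinv u i"
    then have "pinv u i < pinv u (Suc i)" using pinv_neq[OF up, of i "Suc i"] by simp
    then have "invs r (sigma i \<circ> u) = Suc (invs r u)" using invs_sigma_up[OF up i] by simp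
    then show False using e l len by simp
  qed
qed

lemma reduced_word_Cons:
  assumes "reduced_word r (sigma i \<circ> u) is" "u permutes {1..r+1}" "1 \<le> i" "i \<le> r" "pinv u (Suc i) < pinv u i"
  shows "reduced_word r u (i # is)"
proof -
  have "sigma i \<circ> u permutes {1..r+1}" using permutes_compose[OF assms(2) sigma_permutes[OF assms(3,4)]] .
  then show ?thesis using assms invs_sigma_down[OF assms(2-5)]
    by (auto simp: reduced_word_def ell_eq_invs)
qed

text \<open>Matsumoto's theorem, for maps that satisfy the commutation and braid relations on an
  invariant set V; the relations for T_i are established on Laurent polynomials.\<close>

lemma matsumoto:
  fixes T :: "nat \<Rightarrow> 'a \<Rightarrow> 'a"
  assumes V: "\<And>i f. 1 \<le> i \<Longrightarrow> i \<le> r \<Longrightarrow> f \<in> V \<Longrightarrow> T i f \<in> V"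
    and comm: "\<And>i j f. 1 \<le> i \<Longrightarrow> i + 1 < j \<Longrightarrow> j \<le> r \<Longrightarrow> f \<in> V \<Longrightarrow> T i (T j f) = T j (T i f)"
    and braid: "\<And>i f. 1 \<le> i \<Longrightarrow> Suc i \<le> r \<Longrightarrow> f \<in> V \<Longrightarrow>
      T i (T (Suc i) (T i f)) = T (Suc i) (T i (T (Suc i) f))"
    and "reduced_word r u is" "reduced_word r u js" "f \<in> V"
  shows "foldr T is f = foldr T js f"
  using assms(4,5)
proof (induction "is" arbitrary: u js rule: length_induct)
  case (1 "is")
  have len: "length is = length js" using 1 by (simp add: reduced_word_def)
  have fV: "foldr T ks f \<in> V" if "set ks \<subseteq> {1..r}" for ks
    using that by (induction ks) (auto intro: V \<open>f \<in> V\<close>)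
  show ?case
  proof (cases "is")
    case Nil
    then show ?thesis using len by simp
  next
    case (Cons i is')
    then obtain j js' where js: "js = j # js'" using len by (cases js) auto
    note i = reduced_word_tl[OF 1(2)[unfolded Cons]] and j = reduced_word_tl[OF 1(3)[unfolded js]]
    note u = i(5)
    have IH: "foldr T is1 f = foldr T is2 f"
      if "reduced_word r u' is1" "reduced_word r u' is2" "length is1 < length is" for u' is1 is2
      using 1(1) that by blast
    text \<open>If \<open>u\<close> has the left descents \<open>i\<close> and \<open>j\<close>, both words may be replaced by words that start
      with the longest word of the dihedral subgroup of \<open>\<sigma>\<^sub>i\<close> and \<open>\<sigma>\<^sub>j\<close>.\<close>
    have far: "foldr T (i # is') f = foldr T (j # js') f"
      if ij: "i + 1 < j" and i: "reduced_word r (sigma i \<circ> u) is'" "1 \<le> i" "i \<le> r" "pinv u (Suc i) < pinv u i"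
        and j: "reduced_word r (sigma j \<circ> u) js'" "1 \<le> j" "j \<le> r" "pinv u (Suc j) < pinv u j"
        and l: "length is' < length is" "length js' < length is" for i j is' js'
    proof -
      define u2 where "u2 = sigma j \<circ> (sigma i \<circ> u)"
      have u2': "u2 = sigma i \<circ> (sigma j \<circ> u)"
        using ij by (auto simp: u2_def sigma_def fun_eq_iff transpose_def)
      have p: "sigma i \<circ> u permutes {1..r+1}" "sigma j \<circ> u permutes {1..r+1}"
        using permutes_compose[OF u sigma_permutes] i j by blast+
      have "u2 permutes {1..r+1}" unfolding u2_def using permutes_compose[OF p(1) sigma_permutes] j by blast
      then obtain ks where ks: "reduced_word r u2 ks" using exists_reduced_word by blast
      have "reduced_word r (sigma i \<circ> u) (j # ks)"
        using ks i j ij by (intro reduced_word_Cons[OF _ p(1)]) (auto simp: u2_def pinv_sigma_simps[OF u])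
      moreover have "reduced_word r (sigma j \<circ> u) (i # ks)"
        using ks i j ij by (intro reduced_word_Cons[OF _ p(2)]) (auto simp: u2' pinv_sigma_simps[OF u])
      ultimately have "foldr T is' f = foldr T (j # ks) f" "foldr T js' f = foldr T (i # ks) f"
        using IH[OF i(1) _ l(1)] IH[OF j(1) _ l(2)] by blast+
      moreover have "foldr T ks f \<in> V" using ks by (intro fV) (simp add: reduced_word_def)
      ultimately show ?thesis using comm[of i j "foldr T ks f"] i j ij by simp
    qed
    have near: "foldr T (i # is') f = foldr T (j # js') f"
      if ij: "j = Suc i" and i: "reduced_word r (sigma i \<circ> u) is'" "1 \<le> i" "i \<le> r" "pinv u (Suc i) < pinv u i"
        and j: "reduced_word r (sigma j \<circ> u) js'" "1 \<le> j" "j \<le> r" "pinv u (Suc j) < pinv u j"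
        and l: "length is' < length is" "length js' < length is" for i j is' js'
    proof -
      define u3 where "u3 = sigma i \<circ> (sigma j \<circ> (sigma i \<circ> u))"
      have u3': "u3 = sigma j \<circ> (sigma i \<circ> (sigma j \<circ> u))"
        using ij by (auto simp: u3_def sigma_def fun_eq_iff transpose_def)
      have p: "sigma i \<circ> u permutes {1..r+1}" "sigma j \<circ> u permutes {1..r+1}"
        using permutes_compose[OF u sigma_permutes] i j by blast+
      have p2: "sigma j \<circ> (sigma i \<circ> u) permutes {1..r+1}" "sigma i \<circ> (sigma j \<circ> u) permutes {1..r+1}"
        using permutes_compose[OF p(1) sigma_permutes] permutes_compose[OF p(2) sigma_permutes] i j by blast+
      have "u3 permutes {1..r+1}" unfolding u3_def using permutes_compose[OF p2(1) sigma_permutes] i by blast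
      then obtain ks where ks: "reduced_word r u3 ks" using exists_reduced_word by blast
      have "reduced_word r (sigma j \<circ> (sigma i \<circ> u)) (i # ks)"
        using ks i j ij by (intro reduced_word_Cons[OF _ p2(1)]) (auto simp: u3_def pinv_sigma_simps[OF u] pinv_sigma_simps[OF p(1)])
      then have "reduced_word r (sigma i \<circ> u) (j # i # ks)"
        using i j ij by (intro reduced_word_Cons[OF _ p(1)]) (auto simp: pinv_sigma_simps[OF u])
      moreover have "reduced_word r (sigma i \<circ> (sigma j \<circ> u)) (j # ks)"
        using ks i j ij by (intro reduced_word_Cons[OF _ p2(2)]) (auto simp: u3' pinv_sigma_simps[OF u] pinv_sigma_simps[OF p(2)[unfolded ij]])
      then have "reduced_word r (sigma j \<circ> u) (i # j # ks)"
        using i j ij by (intro reduced_word_Cons[OF _ p(2)]) (auto simp: pinv_sigma_simps[OF u])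
      ultimately have "foldr T is' f = foldr T (j # i # ks) f" "foldr T js' f = foldr T (i # j # ks) f"
        using IH[OF i(1) _ l(1)] IH[OF j(1) _ l(2)] by blast+
      moreover have "foldr T ks f \<in> V" using ks by (intro fV) (simp add: reduced_word_def)
      ultimately show ?thesis using braid[of i "foldr T ks f"] i j ij by simp
    qed
    have l: "length is' < length is" "length js' < length is" using len Cons js by simp_all
    consider "i = j" | "i + 1 < j" | "j + 1 < i" | "j = Suc i" | "i = Suc j" by linarith
    then show ?thesis
    proof cases
      case 1
      then show ?thesis using IH[OF i(1) _ l(1), of js'] j(1) Cons js by simp
    next
      case 2
      then show ?thesis using far[OF _ i(1-4) j(1-4) l] Cons js by simp
    next
      case 3
      then show ?thesis using far[OF _ j(1-4) i(1-4) l(2,1)] Cons js by simp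
    next
      case 4
      then show ?thesis using near[OF _ i(1-4) j(1-4) l] Cons js by simp
    next
      case 5
      then show ?thesis using near[OF _ j(1-4) i(1-4) l(2,1)] Cons js by simp
    qed
  qed
qed

section \<open>Cycles, beginning sections of the long word and the Bruhat interval below
  them\<close>

definition cyc :: "nat \<Rightarrow> nat \<Rightarrow> nat \<Rightarrow> nat" where
  "cyc k m = word_perm (rev [m..<Suc k])"

lemma cyc_step: "m \<le> k \<Longrightarrow> cyc k m = cyc k (Suc m) \<circ> sigma m"
  by (simp add: cyc_def upt_conv_Cons word_perm_append del: upt_Suc)

text \<open>These cycles are the minimal representatives of the right cosets of S_k in S_(k+1), and
  \<open>chain k m\<close> is the operator along the defining word of
  \<open>cyc k m\<close>.\<close>

lemma cyc_apply:
  assumes "1 \<le> m" "m \<le> Suc k"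
  shows "cyc k m x = (if x = m then Suc k else if m < x \<and> x \<le> Suc k then x - 1 else x)"
  using assms(2,1)
proof (induction m arbitrary: x rule: inc_induct)
  case base
  then show ?case by (simp add: cyc_def)
next
  case (step m)
  then show ?case by (auto simp: cyc_step sigma_def transpose_def)
qed

lemma cyc_permutes: "1 \<le> m \<Longrightarrow> k \<le> r \<Longrightarrow> cyc k m permutes {1..r+1}"
  unfolding cyc_def by (rule word_perm_permutes) auto

lemma long_word_Suc: "long_word (Suc k) = long_word k @ rev [1..<k + 2]"
  by (simp add: long_word_def)

lemma length_long_word: "length (long_word k) = (Suc k choose 2)"
  by (induction k) (simp_all add: long_word_Suc numeral_2_eq_2, simp add: long_word_def)

lemma set_long_word: "set (long_word k) \<subseteq> {1..k}"
  by (auto simp: long_word_def)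

lemma word_perm_long_word: "word_perm (long_word k) = w0 k"
proof (induction k)
  case 0
  show ?case by (auto simp: long_word_def w0_def fun_eq_iff)
next
  case (Suc k)
  have "word_perm (long_word (Suc k)) = w0 k \<circ> cyc (Suc k) 1"
    by (simp add: long_word_Suc word_perm_append Suc cyc_def)
  also have "\<dots> = w0 (Suc k)"
    by (rule ext) (auto simp: cyc_apply w0_def)
  finally show ?case .
qed

lemma take_long_word:
  assumes "L \<le> length (long_word k)" "k \<le> r"
  shows "take L (long_word r) = take L (long_word k)"
  using assms(2)
proof (induction r rule: dec_induct)
  case (step r)
  have "length (long_word k) \<le> length (long_word r)"
    unfolding length_long_word using step by (intro binomial_right_mono) simp
  then show ?case using assms(1) step by (simp add: long_word_Suc)
qed simp

text \<open>The word w consists of full blocks, whose product is \<open>w0 (k - 1)\<close>, and k +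
  1 - j letters of the k-th block. The empty word appears as k = 1, j = 2.\<close>

lemma beginning_section_cases:
  assumes "beginning_section r w" "1 \<le> r"
  obtains k j where "1 \<le> k" "k \<le> r" "1 \<le> j" "j \<le> Suc k" "w = w0 (k - 1) \<circ> cyc k j"
    "ell r w = (k choose 2) + (Suc k - j)"
proof -
  define L where "L = ell r w"
  have w: "w permutes {1..r+1}" "w = word_perm (take L (long_word r))"
    using assms(1) by (simp_all add: beginning_section_def L_def)
  have "set (take L (long_word r)) \<subseteq> {1..r}" by (rule order_trans[OF set_take_subset set_long_word])
  from invs_word_le[OF this] have "invs r w \<le> length (take L (long_word r))"
    by (simp only: w(2)[symmetric])
  then have "L \<le> length (long_word r)"
    unfolding ell_eq_invs[OF w(1), folded L_def, symmetric] by simp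
  then have Lr: "L \<le> (Suc r choose 2)" by (simp add: length_long_word)
  define k where "k = (LEAST k. 1 \<le> k \<and> L \<le> (Suc k choose 2))"
  have k: "1 \<le> k" "L \<le> (Suc k choose 2)" "k \<le> r"
  proof -
    have ex: "1 \<le> r \<and> L \<le> (Suc r choose 2)" using assms(2) Lr by simp
    show "1 \<le> k" "L \<le> (Suc k choose 2)" using LeastI[of "\<lambda>k. 1 \<le> k \<and> L \<le> (Suc k choose 2)", OF ex] by (simp_all add: k_def)
    show "k \<le> r" unfolding k_def by (rule Least_le) (rule ex)
  qed
  have Lk: "(k choose 2) \<le> L"
  proof (cases "k = 1")
    case False
    with k obtain k' where k': "k = Suc k'" "1 \<le> k'" by (cases k) auto
    have "k' < (LEAST k. 1 \<le> k \<and> L \<le> (Suc k choose 2))" unfolding k_def[symmetric] by (simp add: k'(1))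
    then have "\<not> (1 \<le> k' \<and> L \<le> (Suc k' choose 2))"
      by (rule not_less_Least[where P = "\<lambda>k. 1 \<le> k \<and> L \<le> (Suc k choose 2)"])
    then show ?thesis using k' by simp
  qed (simp add: numeral_2_eq_2)
  define m where "m = L - (k choose 2)"
  have ch: "Suc k choose 2 = (k choose 2) + k" by (simp add: numeral_2_eq_2)
  have m: "m \<le> k" "L = (k choose 2) + m" using Lk k(2) ch by (simp_all add: m_def)
  obtain k' where k': "k = Suc k'" using k(1) by (cases k) auto
  have "take L (long_word r) = take L (long_word k)"
    using k by (intro take_long_word) (simp_all add: length_long_word)
  also have "\<dots> = long_word k' @ take m (rev [1..<Suc k])"
    by (simp add: k' long_word_Suc m(2) length_long_word)
  also have "take m (rev [1..<Suc k]) = rev [Suc k - m..<Suc k]"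
    using m by (simp add: take_rev drop_upt del: upt_Suc) (simp add: Suc_diff_le)
  finally have "w = w0 (k - 1) \<circ> cyc k (Suc k - m)"
    by (simp add: w(2) word_perm_append word_perm_long_word cyc_def k' del: upt_Suc)
  moreover have "ell r w = (k choose 2) + (Suc k - (Suc k - m))" using m by (simp add: L_def)
  ultimately show ?thesis
    using that[OF k(1,3), of "Suc k - m"] m(1) by linarith
qed

text \<open>Before sigma_m is appended, the value at position m + 1 is k + 1 and the one at position
  m is at most k, so every further letter creates an inversion.\<close>

lemma reduced_word_append_cyc:
  assumes y: "y permutes {1..k}" and k: "k \<le> r" and m: "1 \<le> m" "m \<le> Suc k" and ws: "reduced_word r y ws"
  shows "reduced_word r (y \<circ> cyc k m) (ws @ rev [m..<Suc k])"
proof -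
  have yr: "y permutes {1..r+1}" by (rule permutes_subset[OF y]) (use k in auto)
  have p: "y \<circ> cyc k m permutes {1..r+1}" using permutes_compose[OF cyc_permutes yr] m k by blast
  have "invs r y + (Suc k - m) \<le> invs r (y \<circ> cyc k m)"
    using m(2,1)
  proof (induction m rule: inc_induct)
    case base
    then show ?case by (simp add: cyc_def)
  next
    case (step m)
    have pm: "y \<circ> cyc k (Suc m) permutes {1..r+1}" using permutes_compose[OF cyc_permutes yr] step k by simp
    have "y m \<le> k" using permutes_in_image[OF y, of m] step by simp
    then have "(y \<circ> cyc k (Suc m)) m < (y \<circ> cyc k (Suc m)) (Suc m)"
      using step permutes_not_in[OF y, of "Suc k"] by (simp add: cyc_apply)
    then have "invs r (y \<circ> cyc k (Suc m)) < invs r ((y \<circ> cyc k (Suc m)) \<circ> sigma m)"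
      unfolding sigma_def using step k by (intro invs_less_transpose permutes_inj[OF pm]) auto
    moreover have e: "y \<circ> cyc k m = (y \<circ> cyc k (Suc m)) \<circ> sigma m" using step by (simp add: cyc_step o_assoc)
    moreover have "invs r y + (Suc k - Suc m) \<le> invs r (y \<circ> cyc k (Suc m))" by (rule step.IH) simp
    ultimately show ?case unfolding e using step.hyps by linarith
  qed
  moreover have set: "set (ws @ rev [m..<Suc k]) \<subseteq> {1..r}"
    using ws m k by (auto simp: reduced_word_def)
  moreover have wp: "word_perm (ws @ rev [m..<Suc k]) = y \<circ> cyc k m"
    using ws by (simp add: word_perm_append reduced_word_def cyc_def del: upt_Suc)
  moreover have "length (ws @ rev [m..<Suc k]) = invs r y + (Suc k - m)"
    using ws m by (auto simp: reduced_word_def ell_eq_invs[OF yr] Suc_diff_le)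
  ultimately show ?thesis
    using invs_word_le[OF set] by (simp add: reduced_word_def ell_eq_invs[OF p] del: upt_Suc)
qed

text \<open>The position of the value k + 1 determines the coset, and removing the corresponding
  cycle leaves a permutation that fixes k + 1.\<close>

lemma cyc_bij:
  assumes "1 \<le> j"
  shows "bij_betw (\<lambda>(m, y). y \<circ> cyc k m) ({j..Suc k} \<times> {y. y permutes {1..k}})
    {u. u permutes {1..Suc k} \<and> j \<le> pinv u (Suc k)}"
proof (rule bij_betwI[where g = "\<lambda>u. (pinv u (Suc k), u \<circ> pinv (cyc k (pinv u (Suc k))))"])
  have c: "cyc k m permutes {1..Suc k}" if "1 \<le> m" for m using cyc_permutes[of m k k] that by simp
  have cm: "cyc k m m = Suc k" if "1 \<le> m" "m \<le> Suc k" for m using that by (simp add: cyc_apply)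
  have pos: "pinv (y \<circ> cyc k m) (Suc k) = m" "y \<circ> cyc k m permutes {1..Suc k}"
    if "y permutes {1..k}" "1 \<le> m" "m \<le> Suc k" for y m
  proof -
    have "y permutes {1..Suc k}" by (rule permutes_subset[OF that(1)]) auto
    then show p: "y \<circ> cyc k m permutes {1..Suc k}" using permutes_compose[OF c] that by blast
    have "(y \<circ> cyc k m) m = Suc k" using permutes_not_in[OF that(1), of "Suc k"] that by (simp add: cm)
    then show "pinv (y \<circ> cyc k m) (Suc k) = m" using permutes_inv_eq[OF p] by blast
  qed
  show "(\<lambda>(m, y). y \<circ> cyc k m) \<in> {j..Suc k} \<times> {y. y permutes {1..k}} \<rightarrow>
      {u. u permutes {1..Suc k} \<and> j \<le> pinv u (Suc k)}"
    using pos assms by auto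
  have u: "1 \<le> pinv u (Suc k) \<and> pinv u (Suc k) \<le> Suc k \<and> u \<circ> pinv (cyc k (pinv u (Suc k))) permutes {1..k}"
    if u: "u permutes {1..Suc k}" for u
  proof -
    define m where "m = pinv u (Suc k)"
    have um: "u m = Suc k" using u by (simp add: m_def permutes_inverses)
    then have m: "1 \<le> m" "m \<le> Suc k" using permutes_in_image[OF u, of m] by auto
    have "pinv (cyc k m) (Suc k) = m" using cm[OF m] permutes_inv_eq[OF c[OF m(1)]] by blast
    then have "(u \<circ> pinv (cyc k m)) (Suc k) = Suc k" using um by simp
    then have "(u \<circ> pinv (cyc k m)) x = x" if "x \<in> {1..Suc k} - {1..k}" for x
      using that by (cases "x = Suc k") auto
    then have "u \<circ> pinv (cyc k m) permutes {1..k}"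
      by (rule permutes_superset[OF permutes_compose[OF permutes_inv[OF c[OF m(1)]] u]])
    with m show ?thesis by (simp add: m_def)
  qed
  show "(\<lambda>u. (pinv u (Suc k), u \<circ> pinv (cyc k (pinv u (Suc k))))) \<in>
     {u. u permutes {1..Suc k} \<and> j \<le> pinv u (Suc k)} \<rightarrow> {j..Suc k} \<times> {y. y permutes {1..k}}"
    using u by auto
  show "(case case x of (m, y) \<Rightarrow> y \<circ> cyc k m of u \<Rightarrow> (pinv u (Suc k), u \<circ> pinv (cyc k (pinv u (Suc k))))) = x"
    if "x \<in> {j..Suc k} \<times> {y. y permutes {1..k}}" for x
  proof -
    obtain m y where x: "x = (m, y)" by force
    then have y: "y permutes {1..k}" and m: "1 \<le> m" "m \<le> Suc k" using that assms by auto
    have "(y \<circ> cyc k m) \<circ> pinv (cyc k m) = y"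
      using permutes_inv_o(1)[OF c[OF m(1)]] by (simp add: o_assoc[symmetric])
    then show ?thesis by (simp add: x pos(1)[OF y m])
  qed
  show "(case (pinv u (Suc k), u \<circ> pinv (cyc k (pinv u (Suc k)))) of (m, y) \<Rightarrow> y \<circ> cyc k m) = u"
    if "u \<in> {u. u permutes {1..Suc k} \<and> j \<le> pinv u (Suc k)}" for u
  proof -
    have "1 \<le> pinv u (Suc k)" using that u by simp
    then show ?thesis using permutes_inv_o(2)[OF c] by (simp add: o_assoc[symmetric])
  qed
qed

text \<open>As a sequence of values, w is decreasing except that k + 1 stands at position j. Steps
  down from w stay in S_(k+1) and can move k + 1 only to the right. Conversely, every other member
  of the right-hand set admits a step up that stays inside the set, and w is the only place where
  this climb can end.\<close>

lemma bruhat_interval: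
  assumes k: "1 \<le> k" "k \<le> r" and j: "1 \<le> j" "j \<le> Suc k" and w: "w = w0 (k - 1) \<circ> cyc k j"
  shows "{u. u permutes {1..r+1} \<and> bruhat_le r u w} = {u. u permutes {1..Suc k} \<and> j \<le> pinv u (Suc k)}"
proof (intro equalityI subsetI)
  have wx: "w x = (if x = j then Suc k else if 1 \<le> x \<and> x < j then Suc k - x else if j < x \<and> x \<le> Suc k then k + 2 - x else x)" for x
    using k j by (auto simp: w cyc_apply w0_def)
  have wp: "w permutes {1..Suc k}"
  proof -
    have "w0 (k - 1) permutes {1..k - 1 + 1}"
      unfolding word_perm_long_word[symmetric] by (rule word_perm_permutes) (rule set_long_word)
    then have "w0 (k - 1) permutes {1..Suc k}" using k by (auto intro: permutes_subset)
    then show ?thesis unfolding w using permutes_compose[OF cyc_permutes[of j k k]] j by simp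
  qed
  have wj: "pinv w (Suc k) = j" using permutes_inv_eq[OF wp] wx by simp
  have big: "u permutes {1..r+1}" if "u permutes {1..Suc k}" for u
    using that by (rule permutes_subset) (use k in auto)
  {
    fix u assume "u \<in> {u. u permutes {1..r+1} \<and> bruhat_le r u w}"
    then have "(bruhat_step r)\<^sup>*\<^sup>* u w" by (simp add: bruhat_le_def)
    then show "u \<in> {u. u permutes {1..Suc k} \<and> j \<le> pinv u (Suc k)}"
    proof (induction rule: converse_rtranclp_induct)
      case base
      then show ?case using wp wj by simp
    next
      case (step u u')
      then have u': "u' permutes {1..Suc k}" "j \<le> pinv u' (Suc k)" by auto
      obtain a b where ab: "1 \<le> a" "a < b" "b \<le> r + 1" "u' = u \<circ> Transposition.transpose a b" "ell r u < ell r u'"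
        using step(1) by (auto simp: bruhat_step_def)
      have uu: "u = u' \<circ> Transposition.transpose a b" by (simp add: ab(4) o_assoc[symmetric])
      have t: "Transposition.transpose a b permutes {1..r+1}" using ab(1-3) by (intro permutes_swap_id) auto
      have up: "u permutes {1..r+1}" unfolding uu using permutes_compose[OF t big[OF u'(1)]] .
      have lt: "u' b < u' a"
      proof (rule ccontr)
        assume "\<not> u' b < u' a"
        then have "u' a < u' b" using permutes_inj[OF u'(1)] ab(2) by (metis inj_eq linorder_neqE_nat less_irrefl)
        then have "invs r u' < invs r u"
          unfolding uu using ab(1-3) by (intro invs_less_transpose permutes_inj[OF u'(1)])
        then show False using ab(5) by (simp add: ell_eq_invs[OF up] ell_eq_invs[OF big[OF u'(1)]])
      qed
      have "b \<le> Suc k"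
      proof (rule ccontr)
        assume "\<not> b \<le> Suc k"
        then have "u' b = b" using permutes_not_in[OF u'(1), of b] by simp
        then show False using lt ab(1-3) \<open>\<not> b \<le> Suc k\<close> permutes_not_in[OF u'(1), of a] permutes_in_image[OF u'(1), of a]
          by (cases "a \<in> {1..Suc k}") auto
      qed
      then have t': "Transposition.transpose a b permutes {1..Suc k}" using ab(1-3) by (intro permutes_swap_id) auto
      have up': "u permutes {1..Suc k}" unfolding uu using permutes_compose[OF t' u'(1)] .
      define p where "p = pinv u' (Suc k)"
      have p: "u' p = Suc k" using u'(1) by (simp add: p_def permutes_inverses)
      have "u' a \<le> Suc k" using permutes_in_image[OF u'(1), of a] ab(1,2) \<open>b \<le> Suc k\<close> by simp
      then have pb: "p \<noteq> b" using p lt by auto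
      have "u (if p = a then b else p) = Suc k"
        unfolding uu using p pb by (auto simp: transpose_def)
      then have "pinv u (Suc k) = (if p = a then b else p)"
        using permutes_inv_eq[OF up'] by blast
      then show ?case using up' u'(2) ab(1,2) by (auto simp: p_def)
    qed
  }
  {
    fix u assume "u \<in> {u. u permutes {1..Suc k} \<and> j \<le> pinv u (Suc k)}"
    then have "u permutes {1..Suc k}" "j \<le> pinv u (Suc k)" by auto
    then have "bruhat_le r u w"
    proof (induction "(r + 1) * (r + 1) - invs r u" arbitrary: u rule: less_induct)
      case less
      note u = less.prems(1)
      have bound: "invs r u' \<le> (r + 1) * (r + 1)" for u'
      proof -
        have "invs r u' \<le> card ({1..r+1} \<times> {1..r+1})"
          unfolding invs_def by (intro card_mono) (auto simp: Invs_def)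
        then show ?thesis by simp
      qed
      have up: "bruhat_le r u w"
        if ab: "1 \<le> a" "a < b" "b \<le> Suc k" "u a < u b" and pos: "j \<le> pinv (u \<circ> Transposition.transpose a b) (Suc k)" for a b
      proof -
        let ?u = "u \<circ> Transposition.transpose a b"
        have t: "Transposition.transpose a b permutes {1..Suc k}" using ab by (intro permutes_swap_id) auto
        have p: "?u permutes {1..Suc k}" using permutes_compose[OF t u] .
        have lt: "invs r u < invs r ?u" using ab k by (intro invs_less_transpose permutes_inj[OF u]) auto
        have "bruhat_le r ?u w" using less.hyps[of ?u] lt bound[of ?u] p pos by linarith
        moreover have "bruhat_step r u ?u"
          unfolding bruhat_step_def using ab k lt ell_eq_invs[OF big[OF u]] ell_eq_invs[OF big[OF p]]
          by (intro exI[of _ a] exI[of _ b]) auto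
        ultimately show ?thesis unfolding bruhat_le_def by (meson converse_rtranclp_into_rtranclp)
      qed
      define p where "p = pinv u (Suc k)"
      have up': "u p = Suc k" using u by (simp add: p_def permutes_inverses)
      have p: "j \<le> p" "p \<le> Suc k" using less.prems(2) permutes_in_image[OF u, of p] up' by (auto simp: p_def)
      have inj: "u a = u b \<longleftrightarrow> a = b" for a b using permutes_inj[OF u] by (simp add: inj_eq)
      have le: "u a \<le> Suc k" if "1 \<le> a" "a \<le> Suc k" for a using permutes_in_image[OF u, of a] that by simp
      have posI: "pinv (u \<circ> Transposition.transpose a b) (Suc k) = x"
        if "u (Transposition.transpose a b x) = Suc k" "1 \<le> a" "a < b" "b \<le> Suc k" for a b x
      proof -
        have t: "Transposition.transpose a b permutes {1..Suc k}" using that by (intro permutes_swap_id) auto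
        show ?thesis unfolding permutes_inv_eq[OF permutes_compose[OF t u]] using that by simp
      qed
      show ?case
      proof (cases "j < p")
        case True
        \<comment> \<open>The value k + 1 is the largest, so moving it one place to the left is a
          step up; its position remains at least j.\<close>
        have "u (p - 1) < u p"
        proof -
          have "1 \<le> p - 1" "p - 1 \<le> Suc k" "p - 1 \<noteq> p" using True j p by auto
          then show ?thesis using le[of "p - 1"] inj[of "p - 1" p] up' by linarith
        qed
        moreover have "pinv (u \<circ> Transposition.transpose (p - 1) p) (Suc k) = p - 1"
          using True j p up' by (intro posI) auto
        ultimately show ?thesis using True j p by (intro up[of "p - 1" p]) auto
      next
        case False
        then have pj: "p = j" using p by simp
        show ?thesis
        proof (cases "\<exists>a b. 1 \<le> a \<and> a < b \<and> b \<le> Suc k \<and> a \<noteq> j \<and> b \<noteq> j \<and> u a < u b")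
          case True
          then obtain a b where ab: "1 \<le> a" "a < b" "b \<le> Suc k" "a \<noteq> j" "b \<noteq> j" "u a < u b" by blast
          have "pinv (u \<circ> Transposition.transpose a b) (Suc k) = j"
            using ab up' pj by (intro posI) auto
          then show ?thesis using ab by (intro up[of a b]) auto
        next
          case False
          \<comment> \<open>No step up is available, so away from position j the values of u
            decrease as those of w do, and u composed with the inverse of w is increasing on
            {1..k}.\<close>
          define \<theta> where "\<theta> = u \<circ> pinv w"
          have "\<theta> permutes {1..k}"
          proof (rule permutes_superset[of _ "{1..Suc k}"])
            show "\<theta> permutes {1..Suc k}" unfolding \<theta>_def using permutes_compose[OF permutes_inv[OF wp] u] .
            show "\<theta> x = x" if "x \<in> {1..Suc k} - {1..k}" for x
            proof -
              have "x = Suc k" using that by auto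
              then show ?thesis using wj up' pj by (simp add: \<theta>_def)
            qed
          qed
          moreover have "\<theta> x < \<theta> z" if xz: "1 \<le> x" "x < z" "z \<le> k" for x z
          proof -
            define a b where "a = pinv w x" and "b = pinv w z"
            have wa: "w a = x" "w b = z" using wp by (simp_all add: a_def b_def permutes_inverses)
            have rng: "1 \<le> a" "a \<le> Suc k" "1 \<le> b" "b \<le> Suc k"
              using permutes_in_image[OF wp, of a] permutes_in_image[OF wp, of b] wa xz by auto
            have nj: "a \<noteq> j" "b \<noteq> j" using wa wx[of j] xz by auto
            have "b < a"
            proof (rule ccontr)
              assume "\<not> b < a"
              then have "a < b" using wa xz by (metis less_irrefl linorder_neqE_nat)
              then have "w b < w a" using rng nj by (auto simp: wx)
              then show False using wa xz by simp
            qed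
            then have "\<not> u b < u a" using False rng nj by blast
            then show ?thesis using inj[of a b] \<open>b < a\<close> by (simp add: \<theta>_def a_def b_def)
          qed
          ultimately have "\<theta> = id" by (intro increasing_permutes_id) auto
          then have "u \<circ> pinv w \<circ> w = w" by (simp add: \<theta>_def)
          then have "u = w" using permutes_inv_o(2)[OF wp] by (simp add: o_assoc[symmetric])
          then show ?thesis by (simp add: bruhat_le_def)
        qed
      qed
    qed
    then show "u \<in> {u. u permutes {1..r+1} \<and> bruhat_le r u w}"
      using big \<open>u permutes {1..Suc k}\<close> by simp
  }
qed

section \<open>Gauss sums\<close>

text \<open>The substitution a = d c removes c from the multiplicative part. The inner sum over c of
  an additive character is then q - 1 for d = -1 and -1 otherwise, and X(-1) = 1 leaves q without a
  sign.\<close>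

lemma gauss_sum_product:
  fixes R (structure) and e X :: "'a \<Rightarrow> complex"
  assumes R: "field R" "finite (carrier R)"
    and e_add: "\<And>a b. a \<in> carrier R \<Longrightarrow> b \<in> carrier R \<Longrightarrow> e (a \<oplus> b) = e a * e b"
    and e_0: "e \<zero> = 1" and e_sum: "(\<Sum>a\<in>carrier R. e a) = 0"
    and X_mult: "\<And>a b. a \<in> carrier R - {\<zero>} \<Longrightarrow> b \<in> carrier R - {\<zero>} \<Longrightarrow> X (a \<otimes> b) = X a * X b"
    and X_nz: "\<And>a. a \<in> carrier R - {\<zero>} \<Longrightarrow> X a \<noteq> 0"
    and X_neg: "X (\<ominus> \<one>) = 1" and X_sum: "(\<Sum>a\<in>carrier R - {\<zero>}. X a) = 0"
  shows "(\<Sum>a\<in>carrier R - {\<zero>}. X a * e a) * (\<Sum>a\<in>carrier R - {\<zero>}. inverse (X a) * e a) =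
    of_nat (card (carrier R))"
proof -
  interpret field R by (rule R)
  let ?U = "carrier R - {\<zero>}"
  have fin: "finite ?U" using R(2) by simp
  have m1: "\<ominus> \<one> \<in> ?U" using one_not_zero a_inv_closed by (metis DiffI minus_minus minus_zero one_closed singletonD)
  have bij: "bij_betw (\<lambda>x. x \<otimes> c) ?U ?U" if c: "c \<in> ?U" for c
  proof (rule bij_betwI[where g = "\<lambda>x. x \<otimes> inv c"])
    have cU: "c \<in> Units R" using c field_Units by blast
    then have ic: "inv c \<in> ?U" using field_Units by (metis Units_inv_Units)
    show "(\<lambda>x. x \<otimes> c) \<in> ?U \<rightarrow> ?U" using c integral by auto
    show "(\<lambda>x. x \<otimes> inv c) \<in> ?U \<rightarrow> ?U" using ic integral by auto
    show "x \<otimes> c \<otimes> inv c = x" if "x \<in> ?U" for x using that cU c by (simp add: m_assoc)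
    show "x \<otimes> inv c \<otimes> c = x" if "x \<in> ?U" for x using that cU c by (simp add: m_assoc)
  qed
  have e_U: "(\<Sum>a\<in>?U. e a) = - 1"
    using e_sum R(2) e_0 by (simp add: sum_diff1)
  have inner: "(\<Sum>c\<in>?U. e ((d \<oplus> \<one>) \<otimes> c)) = (if d = \<ominus> \<one> then of_nat (card (carrier R)) - 1 else - 1)"
    if d: "d \<in> ?U" for d
  proof (cases "d = \<ominus> \<one>")
    case True
    then have "d \<oplus> \<one> = \<zero>" by (simp add: l_neg)
    then have "(\<Sum>c\<in>?U. e ((d \<oplus> \<one>) \<otimes> c)) = (\<Sum>c\<in>?U. 1)"
      by (intro sum.cong) (auto simp: e_0)
    moreover have "Suc 0 \<le> card (carrier R)" using R(2) zero_closed by (auto simp: Suc_le_eq card_gt_0_iff)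
    ultimately show ?thesis using True R(2) by (simp add: card_Diff_singleton of_nat_diff)
  next
    case False
    have nz: "d \<oplus> \<one> \<in> ?U"
      using d False minus_equality[of d \<one>] by auto
    have "(\<Sum>c\<in>?U. e ((d \<oplus> \<one>) \<otimes> c)) = (\<Sum>c\<in>?U. e (c \<otimes> (d \<oplus> \<one>)))"
      using nz by (intro sum.cong) (auto simp: m_comm)
    also have "\<dots> = (\<Sum>c\<in>?U. e c)" by (rule sum.reindex_bij_betw[OF bij[OF nz]])
    finally show ?thesis using False e_U by simp
  qed
  have "(\<Sum>a\<in>?U. X a * e a) * (\<Sum>c\<in>?U. inverse (X c) * e c) =
     (\<Sum>c\<in>?U. \<Sum>a\<in>?U. X a * e a * (inverse (X c) * e c))"
    by (subst sum.swap) (simp add: sum_product)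
  also have "\<dots> = (\<Sum>c\<in>?U. \<Sum>d\<in>?U. X d * e ((d \<oplus> \<one>) \<otimes> c))"
  proof (rule sum.cong[OF refl])
    fix c assume c: "c \<in> ?U"
    have "(\<Sum>a\<in>?U. X a * e a * (inverse (X c) * e c)) = (\<Sum>d\<in>?U. X (d \<otimes> c) * e (d \<otimes> c) * (inverse (X c) * e c))"
      by (rule sum.reindex_bij_betw[OF bij[OF c], symmetric])
    also have "\<dots> = (\<Sum>d\<in>?U. X d * e ((d \<oplus> \<one>) \<otimes> c))"
    proof (rule sum.cong[OF refl])
      fix d assume d: "d \<in> ?U"
      have "e ((d \<oplus> \<one>) \<otimes> c) = e (d \<otimes> c) * e c"
        using c d by (simp add: l_distr e_add)
      then show "X (d \<otimes> c) * e (d \<otimes> c) * (inverse (X c) * e c) = X d * e ((d \<oplus> \<one>) \<otimes> c)"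
        using X_mult[OF d c] X_nz[OF c] by simp
    qed
    finally show "(\<Sum>a\<in>?U. X a * e a * (inverse (X c) * e c)) = (\<Sum>d\<in>?U. X d * e ((d \<oplus> \<one>) \<otimes> c))" .
  qed
  also have "\<dots> = (\<Sum>d\<in>?U. X d * (\<Sum>c\<in>?U. e ((d \<oplus> \<one>) \<otimes> c)))"
    by (subst sum.swap) (simp add: sum_distrib_left)
  also have "\<dots> = (\<Sum>d\<in>?U. (if d = \<ominus> \<one> then of_nat (card (carrier R)) * X d else 0) - X d)"
    by (intro sum.cong refl) (simp add: inner algebra_simps)
  also have "\<dots> = of_nat (card (carrier R))"
    using fin m1 X_sum X_neg by (simp add: sum_subtractf sum.delta)
  finally show ?thesis .
qed

section \<open>The residue field modulo p and its additive character\<close>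

lemma csub_simps [simp]:
  "carrier (csub A) = A" "mult (csub A) = (*)" "one (csub A) = 1" "zero (csub A) = 0" "add (csub A) = (+)"
  by (simp_all add: csub_def)

locale gauss_setup =
  fixes n :: nat and F :: "complex set" and S :: "complex set set"
    and \<psi> :: "complex \<Rightarrow> complex" and p :: complex
  assumes datum: "gauss_datum n F S \<psi> p" and n_pos: "n \<ge> 1"
begin

definition A :: "complex set" where "A = S_integers F S"
definition I :: "complex set" where "I = prime_ideal_of F S p"
definition Q :: "complex set ring" where "Q = residue_ring F S p"
definition K :: "complex \<Rightarrow> complex set" where "K a = I +>\<^bsub>csub A\<^esub> a"
definition q :: nat where "q = residue_card F S p"

lemma pd: "principal_domain (csub A)" and p_A: "p \<in> A" and p_prime: "ring_prime\<^bsub>csub A\<^esub> p"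
  and fin_Q: "finite (carrier Q)" and q_mod: "q mod (2 * n) = 1 mod (2 * n)"
  and roots_F: "{z. z ^ (2 * n) = 1} \<subseteq> F" and F_field: "subfield F (csub UNIV)"
  and psi: "additive_character F \<psi>" "has_conductor F \<psi> A"
  using datum unfolding gauss_datum_def number_field_def A_def Q_def q_def by auto

sublocale O: principal_domain "csub A" by (rule pd)

lemma A_closed: "a \<in> A \<Longrightarrow> b \<in> A \<Longrightarrow> a + b \<in> A" "a \<in> A \<Longrightarrow> b \<in> A \<Longrightarrow> a * b \<in> A" "1 \<in> A" "0 \<in> A"
  using O.a_closed[of a b] O.m_closed[of a b] O.one_closed O.zero_closed by simp_all

lemma csub_minus: "a \<in> A \<Longrightarrow> \<ominus>\<^bsub>csub A\<^esub> a = - a"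
  using O.minus_equality[of "\<ominus>\<^bsub>csub A\<^esub> a" a] O.l_neg[of a] by (simp add: eq_neg_iff_add_eq_0)

lemma A_minus: "a \<in> A \<Longrightarrow> - a \<in> A" "a \<in> A \<Longrightarrow> b \<in> A \<Longrightarrow> a - b \<in> A"
proof -
  show m: "- a \<in> A" if "a \<in> A" for a using O.a_inv_closed[of a] that by (simp add: csub_minus)
  show "a - b \<in> A" if "a \<in> A" "b \<in> A" using A_closed(1)[OF that(1) m[OF that(2)]] by simp
qed

lemma A_power: "a \<in> A \<Longrightarrow> a ^ k \<in> A"
  by (induction k) (auto intro: A_closed)

lemma A_of_nat: "of_nat k \<in> A"
  by (induction k) (auto intro: A_closed)

lemma A_sub_F: "A \<subseteq> F"
  by (auto simp: A_def S_integers_def)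

lemma F_closed: "x \<in> F \<Longrightarrow> y \<in> F \<Longrightarrow> x + y \<in> F" "x \<in> F \<Longrightarrow> y \<in> F \<Longrightarrow> x * y \<in> F" "x \<in> F \<Longrightarrow> y \<in> F \<Longrightarrow> x / y \<in> F"
proof -
  have fieldC: "field (csub UNIV)"
  proof (rule cring.cring_fieldI2)
    show "cring (csub UNIV)"
      by (rule cringI; (rule abelian_groupI comm_monoidI)?) (auto simp: algebra_simps intro: exI[of _ "- _"] add.left_inverse)
    fix a :: complex assume "a \<in> carrier (csub UNIV)" "a \<noteq> \<zero>\<^bsub>csub UNIV\<^esub>"
    then show "\<exists>b\<in>carrier (csub UNIV). a \<otimes>\<^bsub>csub UNIV\<^esub> b = \<one>\<^bsub>csub UNIV\<^esub>"
      by (intro bexI[of _ "inverse a"]) auto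
  qed simp
  interpret C: field "csub UNIV" by (rule fieldC)
  note sub = subringE[OF subfieldE(1)[OF F_field]]
  show "x \<in> F \<Longrightarrow> y \<in> F \<Longrightarrow> x + y \<in> F" using sub(7) by simp
  show m: "x \<in> F \<Longrightarrow> y \<in> F \<Longrightarrow> x * y \<in> F" for x y using sub(6) by simp
  have inv: "inverse y \<in> F" if "y \<in> F" for y
  proof (cases "y = 0")
    case False
    have "inv\<^bsub>csub UNIV\<^esub> y = inverse y"
      by (rule C.inv_char) (use False in auto)
    then show ?thesis using C.subfield_m_inv(1)[OF F_field, of y] that False by simp
  qed (use that in simp)
  show "x \<in> F \<Longrightarrow> y \<in> F \<Longrightarrow> x / y \<in> F" using m inv by (simp add: divide_inverse)
qed

lemma p_nz: "p \<noteq> 0" and inv_p: "1 / p \<notin> A"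
proof -
  show nz: "p \<noteq> 0" using p_prime by (simp add: ring_prime_def)
  show "1 / p \<notin> A"
  proof
    assume "1 / p \<in> A"
    then have "p \<in> Units (csub A)" using p_A nz unfolding Units_def by (auto intro!: bexI[of _ "1 / p"])
    then show False using p_prime by (simp add: ring_prime_def prime_def)
  qed
qed

lemma I_eq: "I = {c * p | c. c \<in> A}"
  by (auto simp: I_def prime_ideal_of_def cgenideal_def A_def)

sublocale ideal_I: ideal I "csub A"
  unfolding I_def prime_ideal_of_def A_def[symmetric] by (rule O.cgenideal_ideal) (simp add: p_A)

lemma Q_eq: "Q = csub A Quot I"
  by (simp add: Q_def residue_ring_def I_def A_def)

sublocale Q: field Q
  unfolding Q_eq I_def prime_ideal_of_def A_def[symmetric]
  using O.field_iff_prime[of p] p_A p_nz p_prime by simp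

lemma K_hom: "K \<in> ring_hom (csub A) Q"
  unfolding K_def Q_eq by (rule ideal_I.rcos_ring_hom)

lemma K_simps:
  "a \<in> A \<Longrightarrow> K a \<in> carrier Q"
  "a \<in> A \<Longrightarrow> b \<in> A \<Longrightarrow> K (a + b) = K a \<oplus>\<^bsub>Q\<^esub> K b"
  "a \<in> A \<Longrightarrow> b \<in> A \<Longrightarrow> K (a * b) = K a \<otimes>\<^bsub>Q\<^esub> K b"
  "K 1 = \<one>\<^bsub>Q\<^esub>" "K 0 = \<zero>\<^bsub>Q\<^esub>"
  using ring_hom_closed[OF K_hom, of a] ring_hom_add[OF K_hom, of a b] ring_hom_mult[OF K_hom, of a b]
    ring_hom_one[OF K_hom] ring_hom_zero[OF K_hom O.ring_axioms Q.ring_axioms] by simp_all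

lemma K_eq_iff:
  assumes "a \<in> A" "b \<in> A"
  shows "K a = K b \<longleftrightarrow> a - b \<in> I"
  using O.quotient_eq_iff_same_a_r_cos[OF ideal_I.is_ideal, of a b] assms A_minus
  by (simp add: K_def a_minus_def csub_minus)

lemma K_power: "a \<in> A \<Longrightarrow> K (a ^ k) = K a [^]\<^bsub>Q\<^esub> k"
  by (induction k) (simp_all add: K_simps A_power power_Suc2 del: power_Suc)

lemma K_surj: "B \<in> carrier Q \<Longrightarrow> \<exists>a\<in>A. B = K a"
  unfolding Q_eq FactRing_def A_RCOSETS_def' K_def by auto

definition rep :: "complex set \<Rightarrow> complex" where "rep B = (SOME b. b \<in> B)"

lemma rep: "B \<in> carrier Q \<Longrightarrow> rep B \<in> A \<and> K (rep B) = B"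
proof -
  assume "B \<in> carrier Q"
  then obtain a where a: "a \<in> A" "B = K a" using K_surj by blast
  have "a \<in> B" using a ideal_I.a_rcos_self[of a] by (simp add: K_def)
  then have b: "rep B \<in> B" unfolding rep_def by (rule someI)
  then obtain h where h: "h \<in> I" "rep B = h + a" using a by (auto simp: K_def a_r_coset_def')
  then have "h \<in> A" using ideal_I.Icarr by simp
  then have "rep B \<in> A" using h a A_closed by simp
  moreover have "K (rep B) = K a" using h a \<open>rep B \<in> A\<close> by (simp add: K_eq_iff)
  ultimately show ?thesis using a by simp
qed

definition e :: "complex set \<Rightarrow> complex" where "e B = \<psi> (rep B / p)"

lemma psi_A: "a \<in> A \<Longrightarrow> \<psi> a = 1"
  using psi(2) A_closed(3) unfolding has_conductor_def by (metis (mono_tags, lifting) mem_Collect_eq mult.right_neutral)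

lemma psi_add: "x \<in> F \<Longrightarrow> y \<in> F \<Longrightarrow> \<psi> (x + y) = \<psi> x * \<psi> y"
  using psi(1) by (simp add: additive_character_def)

lemma p_F: "a \<in> A \<Longrightarrow> a / p \<in> F"
  using F_closed(3) A_sub_F p_A by blast

text \<open>Another representative changes the quotient by p by an S-integer, on which \<psi> is
  1.\<close>

lemma e_K: "a \<in> A \<Longrightarrow> e (K a) = \<psi> (a / p)"
proof -
  assume a: "a \<in> A"
  have r: "rep (K a) \<in> A" "K (rep (K a)) = K a" using rep[OF K_simps(1)[OF a]] by auto
  then have "rep (K a) - a \<in> I" using K_eq_iff a by blast
  then obtain c where c: "c \<in> A" "rep (K a) - a = c * p" by (auto simp: I_eq)
  then have "rep (K a) / p = a / p + c" using p_nz by (simp add: field_simps)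
  then show ?thesis unfolding e_def using psi_add[OF p_F[OF a], of c] c psi_A A_sub_F by auto
qed

lemma e_add: "B \<in> carrier Q \<Longrightarrow> C \<in> carrier Q \<Longrightarrow> e (B \<oplus>\<^bsub>Q\<^esub> C) = e B * e C"
proof -
  assume BC: "B \<in> carrier Q" "C \<in> carrier Q"
  obtain a b where ab: "a \<in> A" "b \<in> A" "B = K a" "C = K b" using K_surj BC by blast
  then have "B \<oplus>\<^bsub>Q\<^esub> C = K (a + b)" by (simp add: K_simps)
  then show ?thesis using ab by (simp add: e_K A_closed add_divide_distrib psi_add p_F)
qed

lemma e_0: "e \<zero>\<^bsub>Q\<^esub> = 1"
  using e_K[of 0] psi_A[of 0] A_closed by (simp add: K_simps)

text \<open>The conductor is exactly the ring A, and 1/p lies outside it because p is not a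
  unit.\<close>

lemma e_nontrivial: "\<exists>B\<in>carrier Q. e B \<noteq> 1"
proof -
  have "1 / p \<in> F" using p_F A_closed(3) by blast
  then obtain y where "y \<in> A" "\<psi> (1 / p * y) \<noteq> 1"
    using inv_p psi(2) unfolding has_conductor_def by blast
  then show ?thesis using e_K[of y] K_simps(1)[of y] by (intro bexI[of _ "K y"]) auto
qed

lemma e_sum: "(\<Sum>B\<in>carrier Q. e B) = 0"
proof -
  obtain C where C: "C \<in> carrier Q" "e C \<noteq> 1" using e_nontrivial by blast
  have "bij_betw (\<lambda>B. B \<oplus>\<^bsub>Q\<^esub> C) (carrier Q) (carrier Q)"
    by (rule bij_betwI[where g = "\<lambda>B. B \<ominus>\<^bsub>Q\<^esub> C"]) (use C in \<open>auto simp: a_minus_def Q.a_assoc Q.r_neg Q.l_neg\<close>)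
  then have "(\<Sum>B\<in>carrier Q. e B) = (\<Sum>B\<in>carrier Q. e (B \<oplus>\<^bsub>Q\<^esub> C))" by (rule sum.reindex_bij_betw[symmetric])
  also have "\<dots> = (\<Sum>B\<in>carrier Q. e B) * e C" using C by (simp add: e_add sum_distrib_right)
  finally have "(\<Sum>B\<in>carrier Q. e B) * (e C - 1) = 0" by (simp add: algebra_simps)
  then show ?thesis using C by simp
qed

lemma q_card: "q = card (carrier Q)"
  by (simp add: q_def residue_card_def Q_def)

lemma q_ge_2: "q \<ge> 2"
proof -
  have "card {\<zero>\<^bsub>Q\<^esub>, \<one>\<^bsub>Q\<^esub>} \<le> card (carrier Q)" by (intro card_mono fin_Q) auto
  then show ?thesis using Q.one_not_zero by (simp add: q_card card_insert_if)
qed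

lemma q_form: obtains t where "q = 1 + 2 * n * t" "t \<ge> 1"
proof -
  have "q mod (2 * n) = 1" using q_mod n_pos by simp
  then have "q = 1 + 2 * n * (q div (2 * n))" by (metis add.commute mult_div_mod_eq)
  moreover from this have "q div (2 * n) \<ge> 1" using q_ge_2 by (metis Suc_1 Suc_eq_plus1_left Suc_n_not_le_n add.right_neutral less_one mult_0_right not_le plus_1_eq_Suc)
  ultimately show thesis by (rule that)
qed

definition N :: nat where "N = (q - 1) div n"

lemma N: "N * n = q - 1" "even N" "N > 0"
proof -
  obtain t where t: "q = 1 + 2 * n * t" "t \<ge> 1" by (rule q_form)
  then have "N = 2 * t" using n_pos by (simp add: N_def)
  then show "N * n = q - 1" "even N" "N > 0" using t by simp_all
qed

lemma K_pow_q1: "B \<in> carrier Q - {\<zero>\<^bsub>Q\<^esub>} \<Longrightarrow> B [^]\<^bsub>Q\<^esub> (q - 1) = \<one>\<^bsub>Q\<^esub>"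
proof -
  assume B: "B \<in> carrier Q - {\<zero>\<^bsub>Q\<^esub>}"
  have "B [^]\<^bsub>Multiplicative_Group.mult_of Q\<^esub> (order (Multiplicative_Group.mult_of Q)) = \<one>\<^bsub>Multiplicative_Group.mult_of Q\<^esub>"
    by (rule group.pow_order_eq_1[OF Q.field_mult_group]) (use B in simp)
  then show ?thesis
    unfolding Q.order_mult_of[OF fin_Q] Multiplicative_Group.nat_pow_mult_of
    by (simp add: q_card order_def)
qed

text \<open>In the residue field q is 0, while q = 1 + 2 n t as an integer; if n were 0 there, 1
  would equal 0.\<close>

lemma n_notin_I: "of_nat n \<notin> I"
proof
  assume nI: "of_nat n \<in> I"
  have Kn: "K (of_nat k) = [k] \<cdot>\<^bsub>Q\<^esub> \<one>\<^bsub>Q\<^esub>" for k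
  proof (induction k)
    case (Suc k)
    have "of_nat (Suc k) = of_nat k + (1 :: complex)" by simp
    then show ?case using Suc by (simp only: K_simps A_of_nat A_closed Q.add.nat_pow_Suc)
  qed (simp add: K_simps)
  have "[order Q] \<cdot>\<^bsub>Q\<^esub> \<one>\<^bsub>Q\<^esub> = \<zero>\<^bsub>Q\<^esub>"
    using group.pow_order_eq_1[OF Q.a_group, of "\<one>\<^bsub>Q\<^esub>"] by (simp add: order_def add_pow_def)
  then have q0: "K (of_nat q) = \<zero>\<^bsub>Q\<^esub>" by (simp add: Kn q_card order_def)
  obtain t where t: "q = 1 + 2 * n * t" by (rule q_form)
  have "K (of_nat n) = \<zero>\<^bsub>Q\<^esub>" using nI K_eq_iff[of "of_nat n" 0] A_of_nat A_closed by (simp add: K_simps)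
  moreover have "of_nat q = 1 + (of_nat (2 * t) * of_nat n :: complex)" by (simp add: t)
  ultimately have "K (of_nat q) = \<one>\<^bsub>Q\<^esub>"
    by (simp only: K_simps A_of_nat A_closed) (simp only: Q.r_null[OF K_simps(1)[OF A_of_nat]] Q.r_zero Q.one_closed)
  then show False using q0 by simp
qed

section \<open>Roots of unity modulo p and the power residue symbol\<close>

definition roots :: "complex set" where "roots = {\<zeta>. \<zeta> ^ n = 1}"

lemma root_F: "\<zeta> \<in> roots \<Longrightarrow> \<zeta> \<in> F"
  using roots_F by (auto simp: roots_def power_mult power_even_eq mult.commute)

lemma root_A:
  assumes "\<zeta> \<in> roots"
  shows "\<zeta> \<in> A"
proof -
  have alg: "algebraic_int \<zeta>"
  proof (rule algebraic_int.intros)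
    define f where "f = Polynomial.monom (1::complex) n - 1"
    have c: "Polynomial.coeff f i = (if i = n then 1 else 0) - (if i = 0 then 1 else 0)" for i
      by (simp add: f_def coeff_monom coeff_1)
    have deg: "Polynomial.degree f = n"
    proof (rule antisym)
      show "Polynomial.degree f \<le> n" by (rule degree_le) (use n_pos in \<open>auto simp: c\<close>)
      show "n \<le> Polynomial.degree f" by (rule le_degree) (use n_pos in \<open>simp add: c\<close>)
    qed
    show "lead_coeff f = 1" using n_pos by (simp add: deg c)
    show "\<forall>i. Polynomial.coeff f i \<in> \<int>" by (simp add: c)
    show "poly f \<zeta> = 0" using assms by (simp add: f_def poly_monom roots_def)
  qed
  have "\<exists>a\<in>ring_of_integers F. \<exists>b\<in>ring_of_integers F - P. \<zeta> = a / b" if P: "P \<in> finite_places F" for P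
  proof (intro bexI)
    interpret P: primeideal P "csub (ring_of_integers F)" using P by (simp add: finite_places_def)
    show "\<zeta> = \<zeta> / 1" by simp
    show "\<zeta> \<in> ring_of_integers F" using alg root_F[OF assms] by (simp add: ring_of_integers_def)
    have "1 \<notin> P" using P.one_imp_carrier P.I_notcarr by auto
    moreover have "1 \<in> ring_of_integers F" using P.one_closed by simp
    ultimately show "1 \<in> ring_of_integers F - P" by simp
  qed
  then show ?thesis using root_F[OF assms] by (simp add: A_def S_integers_def)
qed

text \<open>If the quotient \<omega> of two distinct roots were congruent to 1, the sum of its first
  n powers, which is 0, would be congruent to n, contradicting \<open>n_notin_I\<close>.\<close>

lemma K_inj_roots: "inj_on K roots"
proof (rule inj_onI)
  fix \<zeta> \<xi> assume z: "\<zeta> \<in> roots" "\<xi> \<in> roots" and K: "K \<zeta> = K \<xi>"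
  show "\<zeta> = \<xi>"
  proof (rule ccontr)
    assume ne: "\<zeta> \<noteq> \<xi>"
    define \<omega> where "\<omega> = \<zeta> / \<xi>"
    have xn: "\<xi> ^ n = 1" "\<zeta> ^ n = 1" using z by (auto simp: roots_def)
    then have x0: "\<xi> \<noteq> 0" using n_pos by (metis One_nat_def Suc_le_lessD power_0_left zero_neq_one less_numeral_extra(3))
    have w: "\<omega> \<in> roots" using xn by (simp add: \<omega>_def roots_def power_divide)
    have w1: "\<omega> \<noteq> 1" using ne x0 by (simp add: \<omega>_def)
    have "\<zeta> = \<omega> * \<xi>" using x0 by (simp add: \<omega>_def)
    then have eq: "K \<omega> \<otimes>\<^bsub>Q\<^esub> K \<xi> = K \<xi>" using K K_simps(3)[of \<omega> \<xi>] root_A z w by simp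
    have "K \<xi> \<otimes>\<^bsub>Q\<^esub> K (\<xi> ^ (n - 1)) = \<one>\<^bsub>Q\<^esub>"
    proof -
      have "\<xi> * \<xi> ^ (n - 1) = 1" using xn n_pos by (metis power_eq_if not_one_le_zero)
      then show ?thesis using K_simps(3)[of \<xi> "\<xi> ^ (n - 1)"] K_simps(4) root_A[OF z(2)] A_power by simp
    qed
    then have "K \<omega> = \<one>\<^bsub>Q\<^esub>"
    proof -
      assume u: "K \<xi> \<otimes>\<^bsub>Q\<^esub> K (\<xi> ^ (n - 1)) = \<one>\<^bsub>Q\<^esub>"
      have "K \<omega> = K \<omega> \<otimes>\<^bsub>Q\<^esub> (K \<xi> \<otimes>\<^bsub>Q\<^esub> K (\<xi> ^ (n - 1)))" using K_simps(1)[OF root_A[OF w]] by (simp only: u Q.r_one)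
      also have "\<dots> = K \<omega> \<otimes>\<^bsub>Q\<^esub> K \<xi> \<otimes>\<^bsub>Q\<^esub> K (\<xi> ^ (n - 1))"
        using root_A w z A_power by (simp add: K_simps Q.m_assoc)
      finally show ?thesis unfolding eq u .
    qed
    then have wk: "K (\<omega> ^ k) = \<one>\<^bsub>Q\<^esub>" for k using root_A[OF w] by (simp add: K_power)
    have sum: "K (\<Sum>k<m. \<omega> ^ k) = K (of_nat m)" for m
    proof (induction m)
      case (Suc m)
      have "(\<Sum>k<m. \<omega> ^ k) \<in> A" by (induction m) (auto intro: A_closed A_power root_A w)
      then show ?case using Suc A_power[OF root_A[OF w]] A_of_nat[of m] A_closed
        by (simp add: K_simps wk Q.a_comm)
    qed simp
    have "(\<Sum>k<n. \<omega> ^ k) = 0" using w w1 by (simp add: geometric_sum roots_def)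
    then have "K (of_nat n) = K 0" using sum[of n] by simp
    then show False using n_notin_I K_eq_iff[of "of_nat n" 0] A_of_nat A_closed by simp
  qed
qed

text \<open>A count: the n roots of unity have n distinct images, and a field contains at most n
  solutions.\<close>

lemma K_roots:
  assumes "B \<in> carrier Q" "B [^]\<^bsub>Q\<^esub> n = \<one>\<^bsub>Q\<^esub>"
  shows "B \<in> K ` roots"
proof -
  let ?R = "{x \<in> carrier Q. x [^]\<^bsub>Q\<^esub> n = \<one>\<^bsub>Q\<^esub>}"
  have "K ` roots \<subseteq> ?R"
    using root_A by (auto simp: K_simps K_power[symmetric] roots_def)
  moreover have "card (K ` roots) = n"
    using card_image[OF K_inj_roots] card_roots_unity_eq[of n] n_pos by (simp add: roots_def)
  moreover have "card ?R \<le> n" using Q.num_roots_le_deg[OF fin_Q, of n] n_pos by simp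
  moreover have "finite ?R" using fin_Q by simp
  ultimately have "K ` roots = ?R" by (metis card_mono card_subset_eq le_antisym)
  then show ?thesis using assms by auto
qed

definition X :: "complex set \<Rightarrow> complex" where "X B = residue_symbol n F S p (rep B)"

text \<open>N n = q - 1 makes the N-th power of B a solution of z^n = 1 in the residue field. It
  lifts to exactly one root of unity, so the description in \<open>residue_symbol\<close> is
  met.\<close>

lemma X: "B \<in> carrier Q - {\<zero>\<^bsub>Q\<^esub>} \<Longrightarrow> X B \<in> roots \<and> K (X B) = B [^]\<^bsub>Q\<^esub> N"
proof -
  assume B: "B \<in> carrier Q - {\<zero>\<^bsub>Q\<^esub>}"
  have r: "rep B \<in> A" "K (rep B) = B" using rep B by auto
  have "(B [^]\<^bsub>Q\<^esub> N) [^]\<^bsub>Q\<^esub> n = \<one>\<^bsub>Q\<^esub>"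
    using K_pow_q1[OF B] B by (simp add: Q.nat_pow_pow N)
  then have "B [^]\<^bsub>Q\<^esub> N \<in> K ` roots" using B by (intro K_roots) auto
  then obtain \<zeta> where z: "\<zeta> \<in> roots" "K \<zeta> = B [^]\<^bsub>Q\<^esub> N" by auto
  have iff: "\<xi> \<in> F \<and> \<xi> ^ n = 1 \<and> rep B ^ N - \<xi> \<in> I \<longleftrightarrow> \<xi> \<in> roots \<and> K \<xi> = B [^]\<^bsub>Q\<^esub> N" for \<xi>
    using root_F[of \<xi>] K_eq_iff[of "rep B ^ N" \<xi>] root_A[of \<xi>] A_power[OF r(1)] r
    by (auto simp: roots_def K_power)
  have "X B = (THE \<xi>. \<xi> \<in> roots \<and> K \<xi> = B [^]\<^bsub>Q\<^esub> N)"
    unfolding X_def residue_symbol_def by (simp only: iff[unfolded N_def q_def I_def] N_def q_def)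
  also have "\<dots> = \<zeta>"
    by (rule the_equality) (use z K_inj_roots in \<open>auto dest: inj_onD\<close>)
  finally show ?thesis using z by simp
qed

lemma Units_Q: "Units Q = carrier Q - {\<zero>\<^bsub>Q\<^esub>}"
  by (rule Q.field_Units)

lemma X_mult:
  assumes "B \<in> Units Q" "C \<in> Units Q"
  shows "X (B \<otimes>\<^bsub>Q\<^esub> C) = X B * X C"
proof (rule inj_onD[OF K_inj_roots])
  have BC: "B \<otimes>\<^bsub>Q\<^esub> C \<in> Units Q" using assms by (rule Q.Units_m_closed)
  note x = X[folded Units_Q]
  show "X (B \<otimes>\<^bsub>Q\<^esub> C) \<in> roots" using x[OF BC] by simp
  show "X B * X C \<in> roots" using x[OF assms(1)] x[OF assms(2)] by (simp add: roots_def power_mult_distrib)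
  show "K (X (B \<otimes>\<^bsub>Q\<^esub> C)) = K (X B * X C)"
    using x[OF BC] x[OF assms(1)] x[OF assms(2)] assms root_A
    by (simp add: K_simps Q.pow_mult_distrib Q.m_comm Q.Units_closed)
qed

lemma X_nz: "B \<in> Units Q \<Longrightarrow> X B \<noteq> 0"
  using X[folded Units_Q, of B] n_pos by (auto simp: roots_def power_0_left)

text \<open>The congruence q = 1 modulo 2n makes N = (q - 1) / n even.\<close>

lemma X_neg: "X (\<ominus>\<^bsub>Q\<^esub> \<one>\<^bsub>Q\<^esub>) = 1"
proof (rule inj_onD[OF K_inj_roots])
  have m1: "\<ominus>\<^bsub>Q\<^esub> \<one>\<^bsub>Q\<^esub> \<in> Units Q" by (rule Q.Units_minus_one_closed)
  note x = X[folded Units_Q, OF m1]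
  show "X (\<ominus>\<^bsub>Q\<^esub> \<one>\<^bsub>Q\<^esub>) \<in> roots" "1 \<in> roots" using x by (simp_all add: roots_def)
  obtain s where s: "N = 2 * s" using N(2) by blast
  have "(\<ominus>\<^bsub>Q\<^esub> \<one>\<^bsub>Q\<^esub>) [^]\<^bsub>Q\<^esub> (2::nat) = \<one>\<^bsub>Q\<^esub>"
    by (simp add: numeral_2_eq_2 Q.l_minus Q.r_minus)
  then have "(\<ominus>\<^bsub>Q\<^esub> \<one>\<^bsub>Q\<^esub>) [^]\<^bsub>Q\<^esub> N = \<one>\<^bsub>Q\<^esub>"
    by (simp add: s Q.nat_pow_pow[symmetric])
  then show "K (X (\<ominus>\<^bsub>Q\<^esub> \<one>\<^bsub>Q\<^esub>)) = K 1" using x by (simp add: K_simps)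
qed

section \<open>The identities for Gauss sums\<close>

lemma gauss_sum_eq: "gauss_sum n F S \<psi> p j = (\<Sum>B\<in>carrier Q - {\<zero>\<^bsub>Q\<^esub>}. X B powi j * e B)"
  unfolding gauss_sum_def Q_def[symmetric] Units_Q Let_def rep_def[symmetric] X_def e_def ..

lemma X_powi_add: "B \<in> Units Q \<Longrightarrow> X B powi (j + int n) = X B powi j"
  using X_nz[of B] X[folded Units_Q, of B] by (simp add: power_int_add roots_def)

lemma gauss_periodic: "gauss_sum n F S \<psi> p (j + int n) = gauss_sum n F S \<psi> p j"
  unfolding gauss_sum_eq by (intro sum.cong refl) (simp add: X_powi_add Units_Q)

lemma gauss_dvd:
  assumes "int n dvd j"
  shows "gauss_sum n F S \<psi> p j = - 1"
proof -
  obtain k where k: "j = int n * k" using assms by blast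
  have "X B powi j = 1" if "B \<in> carrier Q - {\<zero>\<^bsub>Q\<^esub>}" for B
  proof -
    have "X B powi j = (X B powi int n) powi k" by (simp add: k power_int_mult)
    also have "X B powi int n = 1" using X[OF that] by (simp add: roots_def)
    finally show ?thesis by simp
  qed
  then have "gauss_sum n F S \<psi> p j = (\<Sum>B\<in>carrier Q - {\<zero>\<^bsub>Q\<^esub>}. e B)"
    unfolding gauss_sum_eq by simp
  also have "\<dots> = - 1" using e_sum fin_Q e_0 by (simp add: sum_diff1)
  finally show ?thesis .
qed

text \<open>The product formula requires the character X^j to be nontrivial. With J the residue of j
  modulo n, triviality would make all q - 1 units satisfy B^(N J) = 1, although N J < N n = q -
  1.\<close>

lemma gauss_not_dvd:
  assumes j: "\<not> int n dvd j"
  shows "gauss_sum n F S \<psi> p j * gauss_sum n F S \<psi> p (- j) = of_nat q"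
proof -
  define J where "J = nat (j mod int n)"
  have J: "0 < J" "J < n" "int J = j mod int n"
  proof -
    have "j mod int n \<noteq> 0" "0 \<le> j mod int n" "j mod int n < int n" using j n_pos by (auto simp: dvd_eq_mod_eq_0)
    then show "0 < J" "J < n" "int J = j mod int n" by (auto simp: J_def)
  qed
  have XJ: "X B powi j = X B ^ J" if "B \<in> Units Q" for B
  proof -
    have "X B powi j = X B powi (int n * (j div int n) + j mod int n)" by simp
    also have "\<dots> = (X B powi int n) powi (j div int n) * X B powi int J"
      unfolding J(3) power_int_mult[symmetric] using X_nz[OF that] by (intro power_int_add) simp
    also have "X B powi int n = 1" using X[folded Units_Q, OF that] by (simp add: roots_def)
    finally show ?thesis by simp
  qed
  have "\<exists>C\<in>Units Q. X C powi j \<noteq> 1"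
  proof (rule ccontr)
    assume "\<not> ?thesis"
    then have 1: "X B ^ J = 1" if "B \<in> Units Q" for B using XJ that by auto
    have "B [^]\<^bsub>Q\<^esub> (N * J) = \<one>\<^bsub>Q\<^esub>" if "B \<in> Units Q" for B
    proof -
      have "K (X B ^ J) = (B [^]\<^bsub>Q\<^esub> N) [^]\<^bsub>Q\<^esub> J"
        using X[folded Units_Q, OF that] root_A by (simp add: K_power)
      then show ?thesis using that 1 by (simp add: K_simps Q.nat_pow_pow Q.Units_closed)
    qed
    then have "Units Q \<subseteq> {x \<in> carrier Q. x [^]\<^bsub>Q\<^esub> (N * J) = \<one>\<^bsub>Q\<^esub>}" by (auto simp: Q.Units_closed)
    then have "card (Units Q) \<le> card {x \<in> carrier Q. x [^]\<^bsub>Q\<^esub> (N * J) = \<one>\<^bsub>Q\<^esub>}"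
      using fin_Q by (intro card_mono) auto
    also have "\<dots> \<le> N * J" using N J by (intro Q.num_roots_le_deg fin_Q) auto
    also have "\<dots> < N * n" by (rule mult_less_mono2[OF J(2) N(3)])
    finally show False using fin_Q by (simp add: Units_Q N q_card)
  qed
  then obtain C where C: "C \<in> Units Q" "X C powi j \<noteq> 1" by blast
  have Xs: "(\<Sum>B\<in>Units Q. X B powi j) = 0"
  proof -
    have "bij_betw (\<lambda>B. B \<otimes>\<^bsub>Q\<^esub> C) (Units Q) (Units Q)"
      by (rule bij_betwI[where g = "\<lambda>B. B \<otimes>\<^bsub>Q\<^esub> inv\<^bsub>Q\<^esub> C"]) (use C in \<open>auto simp: Q.m_assoc Q.Units_closed\<close>)
    then have "(\<Sum>B\<in>Units Q. X B powi j) = (\<Sum>B\<in>Units Q. X (B \<otimes>\<^bsub>Q\<^esub> C) powi j)" by (rule sum.reindex_bij_betw[symmetric])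
    also have "\<dots> = (\<Sum>B\<in>Units Q. X B powi j) * X C powi j"
      using C by (simp add: X_mult power_int_mult_distrib sum_distrib_right)
    finally have "(\<Sum>B\<in>Units Q. X B powi j) * (X C powi j - 1) = 0" by (simp add: algebra_simps)
    then show ?thesis using C by simp
  qed
  have "(\<Sum>B\<in>carrier Q - {\<zero>\<^bsub>Q\<^esub>}. X B powi j * e B) * (\<Sum>B\<in>carrier Q - {\<zero>\<^bsub>Q\<^esub>}. inverse (X B powi j) * e B) = of_nat (card (carrier Q))"
  proof (rule gauss_sum_product[OF Q.field_axioms fin_Q e_add e_0 e_sum])
    show "X (a \<otimes>\<^bsub>Q\<^esub> b) powi j = X a powi j * X b powi j" if "a \<in> carrier Q - {\<zero>\<^bsub>Q\<^esub>}" "b \<in> carrier Q - {\<zero>\<^bsub>Q\<^esub>}" for a b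
      using that by (simp add: X_mult[unfolded Units_Q] power_int_mult_distrib)
    show "X a powi j \<noteq> 0" if "a \<in> carrier Q - {\<zero>\<^bsub>Q\<^esub>}" for a
      using X_nz[unfolded Units_Q, OF that] by simp
  qed (use X_neg Xs in \<open>simp_all add: Units_Q\<close>)
  then show ?thesis by (simp add: gauss_sum_eq power_int_minus q_card)
qed

end

section \<open>From operators along reduced words to the pattern sum\<close>

context metaplectic
begin

lemma foldr_demazure_lusztig:
  "set is \<subseteq> {1..r} \<Longrightarrow> f \<in> laur r \<Longrightarrow> foldr (demazure_lusztig r n v g) is f = foldr T is f"
  by (induction "is") (simp_all add: demazure_lusztig_eq foldr_T_laur)

text \<open>The word chosen inside \<open>T_op\<close> may be exchanged for any other reduced word,
  because f is a Laurent polynomial and the relations hold there.\<close>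

lemma T_op_eq:
  assumes "reduced_word r u ws" "f \<in> laur r"
  shows "T_op r n v g u f = foldr T ws f"
proof -
  define us where "us = (SOME is. reduced_word r u is)"
  have s: "reduced_word r u us" using assms(1) unfolding us_def by (rule someI)
  then have "T_op r n v g u f = foldr T us f"
    unfolding T_op_def us_def[symmetric] by (intro foldr_demazure_lusztig assms) (simp add: reduced_word_def)
  also have "\<dots> = foldr T ws f"
    by (rule matsumoto[OF _ _ _ s assms(1), of "laur r"]) (auto intro: T_laur T_commute T_braid assms(2))
  finally show ?thesis .
qed

lemma sum_T_op_cyc:
  assumes "k \<le> r" "1 \<le> j" "f \<in> laur r"
  shows "(\<Sum>u | u permutes {1..Suc k} \<and> j \<le> pinv u (Suc k). T_op r n v g u f) =
    (\<Sum>m = j..Suc k. \<Sum>y | y permutes {1..k}. T_op r n v g y (chain k m f))"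
proof -
  have "(\<Sum>u | u permutes {1..Suc k} \<and> j \<le> pinv u (Suc k). T_op r n v g u f) =
    (\<Sum>(m, y) \<in> {j..Suc k} \<times> {y. y permutes {1..k}}. T_op r n v g (y \<circ> cyc k m) f)"
    using sum.reindex_bij_betw[OF cyc_bij[OF assms(2), of k], of "\<lambda>u. T_op r n v g u f"]
    by (simp add: case_prod_unfold)
  also have "\<dots> = (\<Sum>(m, y) \<in> {j..Suc k} \<times> {y. y permutes {1..k}}. T_op r n v g y (chain k m f))"
  proof (intro sum.cong refl, clarify)
    fix m y assume m: "m \<in> {j..Suc k}" and y: "y permutes {1..k}"
    have "y permutes {1..r+1}" by (rule permutes_subset[OF y]) (use assms in auto)
    then obtain ws where ws: "reduced_word r y ws" using exists_reduced_word by blast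
    have "T_op r n v g (y \<circ> cyc k m) f = foldr T (ws @ rev [m..<Suc k]) f"
      using m assms by (intro T_op_eq reduced_word_append_cyc y ws) auto
    also have "\<dots> = foldr T ws (chain k m f)" by (simp add: chain_def)
    also have "\<dots> = T_op r n v g y (chain k m f)"
      using m assms by (intro T_op_eq[symmetric] ws chain_laur) auto
    finally show "T_op r n v g (y \<circ> cyc k m) f = T_op r n v g y (chain k m f)" .
  qed
  finally show ?thesis by (simp add: sum.cartesian_product)
qed

lemma sum_T_op:
  assumes "k \<le> r" "f \<in> laur r"
  shows "(\<Sum>u | u permutes {1..Suc k}. T_op r n v g u f) = Z k f"
  using assms
proof (induction k arbitrary: f)
  case 0
  have "{u. u permutes {1..Suc 0}} = {id}" by (auto simp: permutes_id permutes_sing)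
  moreover have "T_op r n v g id f = f"
    using T_op_eq[of r id "[]" f] 0 by (simp add: reduced_word_def ell_eq_invs permutes_id invs_id)
  ultimately show ?case by (simp add: id_def)
next
  case (Suc k)
  have "1 \<le> pinv u (Suc (Suc k))" if "u permutes {1..Suc (Suc k)}" for u
    using permutes_in_image[OF permutes_inv[OF that], of "Suc (Suc k)"] by simp
  then have "{u. u permutes {1..Suc (Suc k)}} = {u. u permutes {1..Suc (Suc k)} \<and> 1 \<le> pinv u (Suc (Suc k))}"
    by blast
  then have "(\<Sum>u | u permutes {1..Suc (Suc k)}. T_op r n v g u f) =
    (\<Sum>m = 1..Suc (Suc k). \<Sum>y | y permutes {1..Suc k}. T_op r n v g y (chain (Suc k) m f))"
    using sum_T_op_cyc[of "Suc k" r 1 f] Suc.prems by simp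
  also have "\<dots> = (\<Sum>m = 1..Suc (Suc k). Z k (chain (Suc k) m f))"
    using Suc.prems by (intro sum.cong refl Suc.IH chain_laur) auto
  finally show ?case by simp
qed

lemma lookup_push_w0:
  "lookup (push (w0 r) \<mu>) i = lookup \<mu> (w0 r i)"
proof -
  have inv: "w0 r (w0 r i) = i" for i by (auto simp: w0_def)
  then have "inj (w0 r)" by (metis injI)
  from lookup_push_inj[OF this, of \<mu> "w0 r i"] show ?thesis by (simp add: inv)
qed

lemma lookup_rho: "lookup (rho r) i = (if i \<in> {1..r+1} then int (r + 1 - i) else 0)"
  unfolding rho_def by (simp add: lookup_sum lookup_single when_def del: sum.cl_ivl_Suc)

lemma push_w0_rho: "push (w0 r) (rho r) = delta r"
  by (intro poly_mapping_eqI) (auto simp: lookup_push_w0 lookup_rho lookup_delta w0_def)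

text \<open>The weight \<kappa> is the top row lambda + rho read backwards. The number j plays two
  roles: it is the least start of a chain that occurs below w, and the first position at which the
  row of length k may differ from the one above it.\<close>

lemma sum_T_op_eq_sum_crystal:
  assumes r: "r \<ge> 1" and lam: "lam \<in> weights r"
    and dom: "\<forall>i \<in> {1..r}. lookup lam i \<ge> lookup lam (i + 1)"
    and w: "beginning_section r w"
  shows "(\<Sum>u | u permutes {1..r+1} \<and> bruhat_le r u w. T_op r n v g u (xpow (push (w0 r) lam)))
       = xpow (- push (w0 r) (rho r)) *
         (\<Sum>a \<in> demazure_crystal r (lam + rho r) w. cst (gt_coeff n v g r a) * xpow (gt_wt r a))"
proof -
  define \<kappa> where "\<kappa> = push (w0 r) lam + delta r"
  have \<kappa>: "\<kappa> \<in> weights r"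
    using lam by (auto simp: \<kappa>_def weights_iff lookup_add lookup_push_w0 lookup_delta w0_def)
  have incr: "lookup \<kappa> i < lookup \<kappa> (Suc i)" if "1 \<le> i" "i \<le> r" for i
  proof -
    have "r + 1 - i \<in> {1..r}" using that by auto
    with dom have "lookup lam (r + 1 - i) \<ge> lookup lam (r + 1 - i + 1)"
      by blast
    then show ?thesis using that by (auto simp: \<kappa>_def lookup_add lookup_push_w0 lookup_delta w0_def Suc_diff_le)
  qed
  have y: "xpow (push (w0 r) lam) = y r \<kappa>" by (simp add: \<kappa>_def y_def)
  obtain k j where k: "1 \<le> k" "k \<le> r" and j: "1 \<le> j" "j \<le> Suc k" and wkj: "w = w0 (k - 1) \<circ> cyc k j"
    and ell: "ell r w = (k choose 2) + (Suc k - j)"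
    by (rule beginning_section_cases[OF w r])
  obtain s where s: "k = Suc s" using k(1) by (cases k) auto
  define L where "L = ell r w"
  have ch: "(Suc k choose 2) = (k choose 2) + k" by (simp add: numeral_2_eq_2)
  have L: "L \<le> (Suc k choose 2)" using ell ch j by (simp add: L_def)
  have "(\<Sum>u | u permutes {1..r+1} \<and> bruhat_le r u w. T_op r n v g u (y r \<kappa>)) =
     (\<Sum>m = j..s + 2. Z s (chain (Suc s) m (y r \<kappa>)))"
  proof -
    have "(\<Sum>u | u permutes {1..r+1} \<and> bruhat_le r u w. T_op r n v g u (y r \<kappa>)) =
      (\<Sum>m = j..Suc k. \<Sum>u | u permutes {1..k}. T_op r n v g u (chain k m (y r \<kappa>)))"
      unfolding bruhat_interval[OF k j wkj] by (intro sum_T_op_cyc k j y_laur \<kappa>)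
    also have "\<dots> = (\<Sum>m = j..Suc k. Z s (chain k m (y r \<kappa>)))"
      unfolding s using k j s by (intro sum.cong refl sum_T_op chain_laur y_laur \<kappa>) auto
    finally show ?thesis by (simp add: s)
  qed
  also have "\<dots> = xpow (hi r (Suc s) \<kappa> - delta r) * gts n v g (Suc s) L (\<lambda>j. lookup \<kappa> (s + 2 - j))"
  proof (rule branching)
    \<comment> \<open>With k = s + 1 the left side is the index of a Gamma-entry in the rank-k part,
      and L is the same expression with j in place of l.\<close>
    show "(Suc s choose 2) + (s + 2 - l) > L \<longleftrightarrow> l < j" if "1 \<le> l" "l \<le> Suc s" for l
      using that j ell s by (auto simp: L_def)
    show "Z s (y r \<kappa>') = xpow (hi r s \<kappa>' - delta r) * gts n v g s L (\<lambda>j. lookup \<kappa>' (Suc s - j))"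
      if "\<kappa>' \<in> weights r" "\<And>i. 1 \<le> i \<Longrightarrow> i \<le> s \<Longrightarrow> lookup \<kappa>' i \<le> lookup \<kappa>' (Suc i)" for \<kappa>'
      using that k s ell by (intro Z_full) (auto simp: L_def)
  qed (use k j s \<kappa> incr in auto)
  also have "\<dots> = xpow (- delta r) * gts n v g r L (\<lambda>j. lookup \<kappa> (Suc r - j))"
  proof -
    have "gts n v g (k + (r - k)) L (\<lambda>j. lookup \<kappa> (Suc (k + (r - k)) - j)) =
      xpow (\<Sum>j = k + 2..k + (r - k) + 1. single j (lookup \<kappa> j)) *
        gts n v g k L (\<lambda>j. lookup \<kappa> (Suc k - j))"
      by (rule gts_peel[OF L]) (use incr k in auto)
    then have "gts n v g r L (\<lambda>j. lookup \<kappa> (Suc r - j)) =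
       xpow (hi r k \<kappa>) * gts n v g k L (\<lambda>j. lookup \<kappa> (Suc k - j))"
      using k by (simp add: hi_def)
    then show ?thesis using s by (simp add: xpow_diff xpow_uminus divide_inverse)
  qed
  also have "gts n v g r L (\<lambda>j. lookup \<kappa> (Suc r - j)) =
    (\<Sum>a \<in> demazure_crystal r (lam + rho r) w. cst (gt_coeff n v g r a) * xpow (gt_wt r a))"
  proof -
    have "gts n v g r L (\<lambda>j. lookup \<kappa> (Suc r - j)) =
      gts n v g r L (\<lambda>j. lookup (lam + rho r) (j + 1))"
      by (rule gts_cong) (auto simp: \<kappa>_def lookup_add lookup_push_w0 lookup_delta lookup_rho w0_def Suc_diff_le)
    then show ?thesis by (simp add: gts_def gt_trunc_def demazure_crystal_def L_def)
  qed
  finally show ?thesis by (simp add: y push_w0_rho)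
qed

end

theorem theorem2p1:
  fixes r n q :: nat
    and lam :: weight
    and w :: "nat \<Rightarrow> nat"
    and F :: "complex set" and S :: "complex set set"
    and \<psi> :: "complex \<Rightarrow> complex" and p v :: complex
    and g :: "int \<Rightarrow> complex"
  assumes "r \<ge> 1" and "n \<ge> 1"
    and "lam \<in> weights r"
    and "\<forall>i \<in> {1..r}. Poly_Mapping.lookup lam i \<ge> Poly_Mapping.lookup lam (i + 1)"
    and "Poly_Mapping.lookup lam (r + 1) \<ge> 0"
    and "beginning_section r w"
    and "gauss_datum n F S \<psi> p"
    and "q = residue_card F S p"
    and "v = inverse (of_nat q)"
    and "g = gauss_sum n F S \<psi> p"
  shows "(\<Sum>u | u permutes {1..r+1} \<and> bruhat_le r u w. T_op r n v g u (xpow (push (w0 r) lam)))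
       = xpow (- push (w0 r) (rho r)) *
         (\<Sum>a \<in> demazure_crystal r (lam + rho r) w. cst (gt_coeff n v g r a) * xpow (gt_wt r a))"
proof -
  interpret G: gauss_setup n F S \<psi> p
    by unfold_locales fact+
  have q: "q = G.q" by (simp add: assms G.q_def)
  have q_nz: "of_nat q \<noteq> (0 :: complex)" using G.q_ge_2 q by simp
  interpret metaplectic n v g
  proof
    show "v \<noteq> 0" using q_nz by (simp add: assms)
    show "g (a + int n) = g a" for a by (simp add: assms G.gauss_periodic)
    show "g a = - 1" if "int n dvd a" for a using that by (simp add: assms G.gauss_dvd)
    show "g a * g (- a) = inverse v" if "\<not> int n dvd a" for a
      using G.gauss_not_dvd[OF that] q assms by simp
  qed fact
  show ?thesis by (rule sum_T_op_eq_sum_crystal) fact+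
qed

end
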